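(* Let $U\subset\mathbb{C}$ be a simply connected domain, $U\ne\mathbb{C}$, let $\varphi:\mathbb{D}\to U$ be a Riemann map from the open unit disc onto $U$, and let $v\in\partial U$. Then there is a one-to-one correspondence between accesses from $U$ to $v$ and points $\zeta\in\partial\mathbb{D}$ such that the radial limit of $\varphi$ at $\zeta$ exists and is equal to $v$. The correspondence is given as follows. (a) If $\mathcal{A}$ is an access to $v\in\partial U$, then there is a point $\zeta\in\partial\mathbb{D}$ such that the radial limit of $\varphi$ at $\zeta$ is equal to $v$, and for every $\gamma\in\mathcal{A}$ the curve $\varphi^{-1}(\gamma)$ lands at $\zeta$. Moreover, different accesses correspond to different points in $\partial\mathbb{D}$. (b) If the radial limit of $\varphi$ at a point $\zeta\in\partial\mathbb{D}$ is equal to $v\in\partial U$, then there exists an access $\mathcal{A}$ to $v$ such that for every curve $\eta\subset\mathbb{D}$ landing at $\zeta$, if $\varphi(\eta)$ lands at some point $w\in\widehat{\mathbb{C}}$, then $w=v$ and $\varphi(\eta)\in\mathcal{A}$. Equivalently, there is a one-to-one correspondence between accesses to $v$ from $U$ and the prime ends of $\varphi$ of the first or second type whose impressions contain $v$ as a principal point.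
   Context: $\widehat{\mathbb{C}}$ is the Riemann sphere; $\partial U$ is the boundary of $U$ in $\widehat{\mathbb{C}}$. A curve $\gamma:[0,1)\to U$ (respectively into $\mathbb{D}$) lands at a point $v$ of the boundary if $\lim_{t\to1^-}\gamma(t)=v$ (then set $\gamma(1)=v$). The radial limit of $\varphi$ at $\zeta$ is $\lim_{t\to1^-}\varphi(t\zeta)$ (in $\widehat{\mathbb{C}}$). Access: fix $z_0=\varphi(0)$. An access from $U$ to $v\in\partial U$ is a homotopy class (with fixed endpoints) of curves $\gamma:[0,1]\to\widehat{\mathbb{C}}$ with $\gamma([0,1))\subset U$, $\gamma(0)=z_0$, $\gamma(1)=v$; a homotopy here is a continuous map $H:[0,1]^2\to U\cup\{v\}$ with $H([0,1)\times[0,1])\subset U$, $H(0,s)=z_0$, $H(1,s)=v$ for all $s$. A curve in $U$ landing at $v$ but not starting at $z_0$ is said to be in $\mathcal{A}$ if it is so after being preceded by a curve in $U$ joining $z_0$ to its starting point (the choice is irrelevant since $U$ is simply connected). Prime ends of $\varphi$ (of $U$) are in the usual Carathéodory bijection with the points of $\partial\mathbb{D}$. The impression of a prime end represented by a null-chain of crosscuts $(C_n)$, with $U_n$ the associated nested subdomains of $U$, is $\bigcap_n\overline{U_n}$; a principal point is a point to which some null-chain of crosscuts representing the prime end converges. A prime end is of the first type if its impression is a single point, and of the second type if it has exactly one principal point but its impression is not a single point. *)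

theory Defs
  imports "HOL-Complex_Analysis.Complex_Analysis"
begin

text \<open>The point at infinity is \<open>None\<close>; a finite point \<open>z\<close> is \<open>Some z\<close>.\<close>

definition riemann_sphere :: "complex option topology" where
  "riemann_sphere = Alexandroff_compactification (euclidean :: complex topology)"

definition sphere_boundary :: "complex set \<Rightarrow> complex option set" where
  "sphere_boundary U = riemann_sphere frontier_of (Some ` U)"

definition curve_in :: "complex set \<Rightarrow> (real \<Rightarrow> complex) \<Rightarrow> bool" where
  "curve_in S \<gamma> \<longleftrightarrow> continuous_on {0..<1} \<gamma> \<and> \<gamma> ` {0..<1} \<subseteq> S"

definition lands_at :: "(real \<Rightarrow> complex) \<Rightarrow> complex option \<Rightarrow> bool" where
  "lands_at \<gamma> v \<longleftrightarrow> limitin riemann_sphere (\<lambda>t. Some (\<gamma> t)) v (at_left 1)"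

definition has_radial_limit :: "(complex \<Rightarrow> complex) \<Rightarrow> complex \<Rightarrow> complex option \<Rightarrow> bool" where
  "has_radial_limit \<phi> \<zeta> v \<longleftrightarrow> lands_at (\<lambda>t. \<phi> (of_real t * \<zeta>)) v"

definition riemann_map :: "(complex \<Rightarrow> complex) \<Rightarrow> complex set \<Rightarrow> bool" where
  "riemann_map \<phi> U \<longleftrightarrow> \<phi> holomorphic_on ball 0 1 \<and> bij_betw \<phi> (ball 0 1) U"

definition access_curve ::
    "complex set \<Rightarrow> complex \<Rightarrow> complex option \<Rightarrow> (real \<Rightarrow> complex option) \<Rightarrow> bool" where
  "access_curve U z0 v \<gamma> \<longleftrightarrow>
     pathin riemann_sphere \<gamma> \<and> \<gamma> ` {0..<1} \<subseteq> Some ` U \<and> \<gamma> 0 = Some z0 \<and> \<gamma> 1 = v"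

text \<open>Only the restriction of a curve to \<open>{0..1}\<close> matters: curves agreeing there are homotopic.
  In \<^const>\<open>homotopic_with\<close> every intermediate curve is required to be an access curve again.\<close>

definition access_homotopic ::
    "complex set \<Rightarrow> complex \<Rightarrow> complex option \<Rightarrow> (real \<Rightarrow> complex option) \<Rightarrow> (real \<Rightarrow> complex option) \<Rightarrow> bool" where
  "access_homotopic U z0 v \<gamma> \<gamma>' \<longleftrightarrow>
     homotopic_with (access_curve U z0 v) (top_of_set {0..1})
       (subtopology riemann_sphere (Some ` U \<union> {v})) \<gamma> \<gamma>'"

definition accesses ::
    "complex set \<Rightarrow> complex \<Rightarrow> complex option \<Rightarrow> (real \<Rightarrow> complex option) set set" where
  "accesses U z0 v =
     {\<gamma>. access_curve U z0 v \<gamma>} //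
     {(\<gamma>, \<gamma>'). access_curve U z0 v \<gamma> \<and> access_curve U z0 v \<gamma>' \<and> access_homotopic U z0 v \<gamma> \<gamma>'}"

definition close_curve :: "complex option \<Rightarrow> (real \<Rightarrow> complex) \<Rightarrow> real \<Rightarrow> complex option" where
  "close_curve v \<gamma> = (\<lambda>t. if t < 1 then Some (\<gamma> t) else v)"

text \<open>\<open>in_access U z0 v \<gamma> A\<close>: the curve \<open>\<gamma>\<close> in \<open>U\<close> (on \<open>{0..<1}\<close>) lands at \<open>v\<close> and belongs to the
  access \<open>A\<close>, if need be after a path in \<open>U\<close> from \<open>z0\<close> to its starting point is put in front.\<close>

definition in_access ::
    "complex set \<Rightarrow> complex \<Rightarrow> complex option \<Rightarrow> (real \<Rightarrow> complex) \<Rightarrow> (real \<Rightarrow> complex option) set \<Rightarrow> bool" where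
  "in_access U z0 v \<gamma> A \<longleftrightarrow>
     curve_in U \<gamma> \<and> lands_at \<gamma> v \<and>
     (if \<gamma> 0 = z0 then close_curve v \<gamma> \<in> A
      else \<exists>\<alpha>. path \<alpha> \<and> path_image \<alpha> \<subseteq> U \<and> pathstart \<alpha> = z0 \<and> pathfinish \<alpha> = \<gamma> 0 \<and>
               close_curve v (\<alpha> +++ \<gamma>) \<in> A)"

text \<open>A crosscut is an open Jordan arc in \<open>U\<close> with both ends landing on the boundary of \<open>U\<close> in the
  sphere; the two end points may coincide.\<close>

definition crosscut :: "complex set \<Rightarrow> complex set \<Rightarrow> bool" where
  "crosscut U C \<longleftrightarrow> C \<subseteq> U \<and>
     (\<exists>g. pathin riemann_sphere g \<and> inj_on g {0<..<1} \<and> g ` {0<..<1} = Some ` C \<and>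
          g 0 \<in> sphere_boundary U \<and> g 1 \<in> sphere_boundary U)"

definition separates_in :: "complex set \<Rightarrow> complex set \<Rightarrow> complex set \<Rightarrow> complex set \<Rightarrow> bool" where
  "separates_in U C A B \<longleftrightarrow>
     (\<exists>K \<in> components (U - C). \<exists>L \<in> components (U - C). K \<noteq> L \<and> A \<subseteq> K \<and> B \<subseteq> L)"

text \<open>The chordal distance on the finite part of the sphere; this suffices, as crosscuts of
  \<open>U\<close> consist of finite points. It is equivalent to the great circle distance.\<close>

definition chordal_dist :: "complex \<Rightarrow> complex \<Rightarrow> real" where
  "chordal_dist z w = 2 * cmod (z - w) / (sqrt (1 + (cmod z)\<^sup>2) * sqrt (1 + (cmod w)\<^sup>2))"

definition spherical_diameter :: "complex set \<Rightarrow> real" where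
  "spherical_diameter C = (SUP (z, w) \<in> C \<times> C. chordal_dist z w)"

definition null_chain :: "complex set \<Rightarrow> (nat \<Rightarrow> complex set) \<Rightarrow> bool" where
  "null_chain U C \<longleftrightarrow>
     (\<forall>n. crosscut U (C n)) \<and>
     (\<forall>n. (riemann_sphere closure_of (Some ` C n)) \<inter>
          (riemann_sphere closure_of (Some ` C (Suc n))) = {}) \<and>
     (\<forall>n. separates_in U (C (Suc n)) (C n) (C (Suc (Suc n)))) \<and>
     (\<lambda>n. spherical_diameter (C n)) \<longlonglongrightarrow> 0"

definition chain_domain :: "complex set \<Rightarrow> (nat \<Rightarrow> complex set) \<Rightarrow> nat \<Rightarrow> complex set" where
  "chain_domain U C n = (THE K. K \<in> components (U - C n) \<and> C (Suc n) \<subseteq> K)"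

definition chain_equiv ::
    "complex set \<Rightarrow> ((nat \<Rightarrow> complex set) \<times> (nat \<Rightarrow> complex set)) set" where
  "chain_equiv U = {(C, C'). null_chain U C \<and> null_chain U C' \<and>
     (\<forall>m. \<exists>n. chain_domain U C' n \<subseteq> chain_domain U C m) \<and>
     (\<forall>m. \<exists>n. chain_domain U C n \<subseteq> chain_domain U C' m)}"

definition prime_ends :: "complex set \<Rightarrow> (nat \<Rightarrow> complex set) set set" where
  "prime_ends U = {C. null_chain U C} // chain_equiv U"

text \<open>The inner intersection is the same for all null-chains representing \<open>P\<close>.\<close>

definition impression :: "complex set \<Rightarrow> (nat \<Rightarrow> complex set) set \<Rightarrow> complex option set" where
  "impression U P = (\<Inter>C\<in>P. \<Inter>n. riemann_sphere closure_of (Some ` chain_domain U C n))"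

definition principal_point :: "(nat \<Rightarrow> complex set) set \<Rightarrow> complex option \<Rightarrow> bool" where
  "principal_point P p \<longleftrightarrow>
     (\<exists>C\<in>P. \<forall>W. openin riemann_sphere W \<and> p \<in> W \<longrightarrow> (\<forall>\<^sub>F n in sequentially. Some ` C n \<subseteq> W))"

definition first_type :: "complex set \<Rightarrow> (nat \<Rightarrow> complex set) set \<Rightarrow> bool" where
  "first_type U P \<longleftrightarrow> is_singleton (impression U P)"

definition second_type :: "complex set \<Rightarrow> (nat \<Rightarrow> complex set) set \<Rightarrow> bool" where
  "second_type U P \<longleftrightarrow> (\<exists>!p. principal_point P p) \<and> \<not> is_singleton (impression U P)"

text \<open>The Caratheodory correspondence: the prime end \<open>P\<close> belongs to the point \<open>\<zeta>\<close> of the unit circle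
  if the preimages of the nested domains of every null-chain representing \<open>P\<close> shrink to \<open>\<zeta>\<close>.\<close>

definition prime_end_at ::
    "(complex \<Rightarrow> complex) \<Rightarrow> complex set \<Rightarrow> (nat \<Rightarrow> complex set) set \<Rightarrow> complex \<Rightarrow> bool" where
  "prime_end_at \<phi> U P \<zeta> \<longleftrightarrow>
     P \<in> prime_ends U \<and> \<zeta> \<in> sphere 0 1 \<and>
     (\<forall>C\<in>P. (\<Inter>n. closure (ball 0 1 \<inter> \<phi> -` chain_domain U C n)) = {\<zeta>})"

end

theory Submission
  imports Defs
begin

text \<open>
  Up to a rational map of the sphere, \<open>\<phi>\<close> is a bounded univalent function, whose image has finite
  area. In the logarithmic coordinate at a point \<open>\<zeta>\<close> of the circle, the length-area inequality then
  gives arbitrarily small circular arcs around \<open>\<zeta>\<close> with images of small spherical diameter whose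
  endpoints avoid any finite set of boundary points. Since \<open>\<phi>\<close> has no interval of constant
  boundary values, this yields that the preimage of every curve landing at \<open>v\<close> lands at
  one point of the circle, and, with Bloch's theorem, that the radial limit there is \<open>v\<close>
  (Lindeloef).

  Two curves landing at \<open>v\<close> whose preimages land at the same \<open>\<zeta>\<close> are joined arbitrarily close to \<open>v\<close>
  by the images of such arcs. Between two successive arcs the curves bound a loop inside a simply
  connected part of \<open>U\<close> close to \<open>v\<close>, so a homotopy can be assembled from squares that
  shrink to \<open>v\<close>. Conversely, the slices of a homotopy at times close to 1
  pull back to connected sets near the circle on which \<open>\<phi>\<close> is close to \<open>v\<close>, and by Koebe's lemma
  the diameters of such sets tend to 0.

  The images of the arcs around \<open>\<zeta>\<close> also form null chains, and the preimage of every null chain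
  shrinks to one point of the circle. The principal points at \<open>\<zeta>\<close> are the radial cluster values, so
  \<open>v\<close> is the only principal point exactly when it is the radial limit.
\<close>

text \<open>Infinity may belong to the boundary of \<open>U\<close> and may even be
  \<open>v\<close>, so limits are taken in the metric of the embedded sphere; area, on the other
  hand, is finite only for a bounded planar image. The bounded model \<open>f\<close> with
  \<open>R (f z) = Some (\<phi> z)\<close> reconciles the two: \<open>R\<close> is uniformly
  continuous on the closure of the image, and its finite fibres turn the task of avoiding a point
  into that of avoiding finitely many.

  Boundary values are never assigned almost everywhere. Instead, for one omitted value the
  length-area inequality is applied to the part of the domain mapped near it, and shows that almost
  every arc around \<zeta> has an image at positive distance from that value. An arc avoiding
  \<open>v\<close> blocks connected sets whose image is near \<open>v\<close>; an arc avoiding the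
  ends of the previous one makes the closures of consecutive crosscuts disjoint.

  The radius of an arc can only be prescribed up to a factor 2. The bound for \<phi> on the radial
  segment between \<open>r\<close> and the actual \<rho> is what allows statements about arcs to
  reach every point of the radius, and hence to give full radial limits.\<close>

section \<open>The sphere embedded in Euclidean space\<close>

text \<open>Inverse stereographic projection onto the unit sphere, with infinity at the pole. The
  target is \<open>complex \<times> real\<close> because its product metric is Euclidean, so that
  limits and uniform continuity in \<open>riemann_sphere\<close> become metric statements.\<close>

definition stereo :: "complex option \<Rightarrow> complex \<times> real" where
  "stereo p = (case p of None \<Rightarrow> (0, 1)
     | Some z \<Rightarrow> (of_real (2 / (1 + (cmod z)\<^sup>2)) * z, ((cmod z)\<^sup>2 - 1) / ((cmod z)\<^sup>2 + 1)))"

lemma stereo_None: "stereo None = (0, 1)"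
  by (simp add: stereo_def)

lemma stereo_Some:
  "stereo (Some z) = (of_real (2 / (1 + (cmod z)\<^sup>2)) * z, ((cmod z)\<^sup>2 - 1) / ((cmod z)\<^sup>2 + 1))"
  by (simp add: stereo_def)

text \<open>Turns \<open>spherical_diameter\<close> into an ordinary diameter. With
  \<open>a\<close>, \<open>b\<close> for 1 + |z|^2, 1 + |w|^2 and \<open>p\<close> for the real
  inner product of z and w, both squared distances equal 4 (a + b - 2 - 2 p) / (a b).\<close>

lemma dist_stereo_Some: "dist (stereo (Some z)) (stereo (Some w)) = chordal_dist z w"
proof -
  define a where "a = 1 + (cmod z)\<^sup>2"
  define b where "b = 1 + (cmod w)\<^sup>2"
  have ab: "a > 0" "b > 0"
    unfolding a_def b_def by (smt (verit) zero_le_power2)+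
  have za: "(Re z)\<^sup>2 + (Im z)\<^sup>2 = a - 1" and wb: "(Re w)\<^sup>2 + (Im w)\<^sup>2 = b - 1"
    by (simp_all add: a_def b_def cmod_power2)
  define p where "p = Re z * Re w + Im z * Im w"
  have dpp: "(dist (x, s) (y, t))\<^sup>2 = (cmod (x - y))\<^sup>2 + (s - t)\<^sup>2" for x y :: complex and s t :: real
    unfolding dist_Pair_Pair by (simp add: dist_norm)
  have d1: "(dist (stereo (Some z)) (stereo (Some w)))\<^sup>2 =
     (2 / a * Re z - 2 / b * Re w)\<^sup>2 + (2 / a * Im z - 2 / b * Im w)\<^sup>2 + ((a - 2) / a - (b - 2) / b)\<^sup>2"
    using dpp[of "of_real (2 / a) * z" "(a - 2) / a" "of_real (2 / b) * w" "(b - 2) / b"]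
    by (simp add: stereo_Some a_def b_def add.commute cmod_power2)
  also have "\<dots> = (4 / a\<^sup>2 * ((Re z)\<^sup>2 + (Im z)\<^sup>2) - 8 / (a * b) * p + 4 / b\<^sup>2 * ((Re w)\<^sup>2 + (Im w)\<^sup>2))
      + ((a - 2) / a - (b - 2) / b)\<^sup>2"
    by (simp add: p_def power2_eq_square algebra_simps)
  also have "\<dots> = 4 * (a - 1 + (b - 1) - 2 * p) / (a * b)"
    unfolding za wb using ab by (simp add: field_simps power2_eq_square)
  also have "a - 1 + (b - 1) - 2 * p = (cmod (z - w))\<^sup>2"
    unfolding za[symmetric] wb[symmetric] p_def cmod_power2 by (simp add: power2_eq_square algebra_simps)
  also have "4 * (cmod (z - w))\<^sup>2 / (a * b) = (chordal_dist z w)\<^sup>2"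
    using ab by (simp add: chordal_dist_def a_def [symmetric] b_def [symmetric] power_divide power_mult_distrib)
  finally show ?thesis
    by (rule power2_eq_imp_eq) (use ab in \<open>auto simp: chordal_dist_def a_def b_def\<close>)
qed

lemma stereo_Some_neq_None: "stereo (Some z) \<noteq> stereo None"
  by (auto simp: stereo_Some stereo_None)

lemma stereo_eq_iff [simp]: "stereo p = stereo q \<longleftrightarrow> p = q"
proof
  assume eq: "stereo p = stereo q"
  have "z = w" if "stereo (Some z) = stereo (Some w)" for z w
  proof -
    have "chordal_dist z w = 0"
      using that by (simp flip: dist_stereo_Some)
    moreover have "1 + (cmod z)\<^sup>2 > 0" "1 + (cmod w)\<^sup>2 > 0"
      by (smt (verit) zero_le_power2)+
    ultimately show ?thesis
      by (auto simp: chordal_dist_def)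
  qed
  with eq stereo_Some_neq_None show "p = q"
    by (cases p; cases q) (fastforce | metis)+
qed auto

lemma inj_stereo: "inj stereo"
  by (simp add: inj_on_def)

lemma continuous_on_stereo_Some: "continuous_on S (\<lambda>z. stereo (Some z))"
proof -
  have "1 + (cmod z)\<^sup>2 \<noteq> 0" "(cmod z)\<^sup>2 + 1 \<noteq> 0" for z
    by (smt (verit) zero_le_power2)+
  then show ?thesis
    unfolding stereo_Some by (intro continuous_intros) auto
qed

text \<open>The distance of \<open>stereo (Some w)\<close> from the pole is exactly 2 / sqrt (1 +
  |w|^2), which tends to 0 as |w| grows.\<close>

lemma tendsto_stereo_infinity:
  assumes "filterlim z at_infinity F"
  shows "((\<lambda>n. stereo (Some (z n))) \<longlongrightarrow> stereo None) F"
proof -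
  have nz: "filterlim (\<lambda>n. cmod (z n)) at_top F"
    using assms by (simp add: filterlim_at_infinity_conv_norm_at_top)
  have d: "dist (stereo (Some w)) (stereo None) = 2 / sqrt (1 + (cmod w)\<^sup>2)" for w
  proof -
    define a where "a = 1 + (cmod w)\<^sup>2"
    have a: "a > 0"
      unfolding a_def by (smt (verit) zero_le_power2)
    have w: "(cmod w)\<^sup>2 = a - 1"
      by (simp add: a_def)
    have "(dist (stereo (Some w)) (stereo None))\<^sup>2 = (2 / a)\<^sup>2 * (cmod w)\<^sup>2 + ((a - 2) / a - 1)\<^sup>2"
    proof -
      have dpp: "(dist (x, s) (0 :: complex, 1))\<^sup>2 = (cmod x)\<^sup>2 + (s - 1)\<^sup>2" for x and s :: real
        unfolding dist_Pair_Pair by (simp add: dist_norm)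
      show ?thesis
        using a unfolding stereo_Some stereo_None a_def[symmetric] dpp[of "of_real (2 / a) * w" "(a - 2) / a"] w
        by (simp add: dpp norm_mult norm_divide power_mult_distrib power_divide w add.commute)
    qed
    also have "\<dots> = (2 / sqrt a)\<^sup>2"
      unfolding w using a by (simp add: field_simps power2_eq_square)
    finally show ?thesis
      unfolding a_def by (rule power2_eq_imp_eq) auto
  qed
  have "((\<lambda>x::real. 2 / sqrt (1 + x\<^sup>2)) \<longlongrightarrow> 0) at_top"
    by (rule tendsto_divide_0[OF tendsto_const], rule filterlim_at_top_imp_at_infinity, rule filterlim_compose[OF sqrt_at_top], rule filterlim_tendsto_add_at_top[OF tendsto_const], rule filterlim_pow_at_top) (auto intro: filterlim_ident)
  then have "((\<lambda>n. 2 / sqrt (1 + (cmod (z n))\<^sup>2)) \<longlongrightarrow> 0) F"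
    using nz by (rule filterlim_compose)
  then show ?thesis
    by (subst tendsto_dist_iff) (simp add: d)
qed

lemma topspace_riemann_sphere [simp]: "topspace riemann_sphere = UNIV"
  by (auto simp: riemann_sphere_def) (metis not_None_eq UNIV_I image_iff)

text \<open>If the open set contains the pole, the plane points outside its preimage form a closed
  set. This set is bounded, since an unbounded sequence in it would have images tending to the pole;
  so it is compact, as the topology of the compactification demands.\<close>

lemma continuous_map_stereo: "continuous_map riemann_sphere euclidean stereo"
proof -
  have "openin riemann_sphere {p. stereo p \<in> V}" if V: "open V" for V
  proof (cases "stereo None \<in> V")
    case False
    then have "{p. stereo p \<in> V} = Some ` {z. stereo (Some z) \<in> V}"
      by (auto simp: image_iff) (metis not_None_eq)
    moreover have "open {z. stereo (Some z) \<in> V}"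
      using continuous_on_stereo_Some[of UNIV] V by (simp add: continuous_on_open_vimage vimage_def)
    ultimately show ?thesis
      by (simp add: riemann_sphere_def)
  next
    case True
    define K where "K = {z. stereo (Some z) \<notin> V}"
    have "closed ((\<lambda>z. stereo (Some z)) -` (- V))"
      by (rule continuous_closed_vimage) (use V continuous_on_stereo_Some[of UNIV] in \<open>auto simp: closed_Compl continuous_on_eq_continuous_at\<close>)
    then have cl: "closed K"
      by (simp add: K_def vimage_def)
    have "bounded K"
    proof (rule ccontr)
      assume "\<not> bounded K"
      then have "\<forall>n::nat. \<exists>z\<in>K. cmod z > real n"
        by (auto simp: bounded_iff not_le)
      then obtain z where z: "\<And>n. z n \<in> K" "\<And>n. cmod (z n) > real n"
        by metis
      have "filterlim (\<lambda>n. cmod (z n)) at_top sequentially"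
        using filterlim_real_sequentially
        by (rule filterlim_at_top_mono) (use z(2) in \<open>auto intro: always_eventually less_imp_le\<close>)
      then have "(\<lambda>n. stereo (Some (z n))) \<longlonglongrightarrow> stereo None"
        by (intro tendsto_stereo_infinity) (simp add: filterlim_at_infinity_conv_norm_at_top)
      then have "\<forall>\<^sub>F n in sequentially. stereo (Some (z n)) \<in> V"
        using V True by (rule topological_tendstoD)
      then show False
        using z(1) by (auto simp: K_def eventually_sequentially)
    qed
    then have "compact K"
      using cl by (simp add: compact_eq_bounded_closed)
    moreover have "{p. stereo p \<in> V} = UNIV - Some ` K"
      using True by (auto simp: K_def image_iff) (metis not_None_eq)
    moreover have "x \<in> UNIV - Some ` K \<longleftrightarrow> x \<in> insert None (Some ` (UNIV - K))" for x
      by (cases x) auto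
    then have "UNIV - Some ` K = insert None (Some ` (UNIV - K))"
      by blast
    ultimately show ?thesis
      using cl by (auto simp: riemann_sphere_def openin_Alexandroff_compactification)
  qed
  then show ?thesis
    by (simp add: continuous_map_def)
qed

lemma compact_space_riemann_sphere: "compact_space riemann_sphere"
  by (simp add: riemann_sphere_def)

lemma compact_range_stereo: "compact (range stereo)"
  using image_compactin[OF _ continuous_map_stereo, of UNIV] compact_space_riemann_sphere
  by (simp add: compact_space_def)

text \<open>\<open>stereo\<close> is a continuous injection of a compact space into a metric space,
  hence an embedding: closed sets are compact, so are their images, and these are closed. The later
  transfer lemmas all rest on this.\<close>

lemma openin_riemann_sphere_iff: "openin riemann_sphere W \<longleftrightarrow> (\<exists>V. open V \<and> W = stereo -` V)"
proof
  assume W: "openin riemann_sphere W"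
  have "compactin riemann_sphere (- W)"
    by (rule closedin_compact_space[OF compact_space_riemann_sphere]) (use W in \<open>auto simp: closedin_def Compl_eq_Diff_UNIV double_diff\<close>)
  then have "compact (stereo ` (- W))"
    using image_compactin[OF _ continuous_map_stereo] by simp
  then have "open (- stereo ` (- W))"
    by (simp add: compact_imp_closed open_Compl)
  moreover have "W = stereo -` (- stereo ` (- W))"
    unfolding vimage_Compl inj_vimage_image_eq[OF inj_stereo] by (rule double_complement[symmetric])
  ultimately show "\<exists>V. open V \<and> W = stereo -` V"
    by blast
next
  assume "\<exists>V. open V \<and> W = stereo -` V"
  then show "openin riemann_sphere W"
    using continuous_map_stereo by (auto simp: continuous_map_def vimage_def)
qed

lemma limitin_riemann_sphere_iff:
  "limitin riemann_sphere h l F \<longleftrightarrow> ((\<lambda>x. stereo (h x)) \<longlongrightarrow> stereo l) F"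
  by (auto simp: limitin_def tendsto_def openin_riemann_sphere_iff)

lemma continuous_map_riemann_sphere_iff:
  "continuous_map X riemann_sphere h \<longleftrightarrow> continuous_map X euclidean (\<lambda>x. stereo (h x))"
  by (auto simp: continuous_map_def openin_riemann_sphere_iff)

lemma pathin_riemann_sphere_iff:
  "pathin riemann_sphere g \<longleftrightarrow> continuous_on {0..1} (\<lambda>x. stereo (g x))"
  by (simp add: pathin_def continuous_map_riemann_sphere_iff)

lemma closure_of_riemann_sphere_iff: "p \<in> riemann_sphere closure_of S \<longleftrightarrow> stereo p \<in> closure (stereo ` S)"
proof
  assume p: "p \<in> riemann_sphere closure_of S"
  show "stereo p \<in> closure (stereo ` S)"
    unfolding closure_approachable
  proof (intro allI impI)
    fix e :: real assume "e > 0"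
    then have "openin riemann_sphere (stereo -` ball (stereo p) e)" "p \<in> stereo -` ball (stereo p) e"
      by (auto simp: openin_riemann_sphere_iff)
    then have "\<exists>y\<in>S. y \<in> stereo -` ball (stereo p) e"
      using p unfolding in_closure_of by blast
    then show "\<exists>y\<in>stereo ` S. dist y (stereo p) < e"
      by (auto simp: dist_commute)
  qed
next
  assume p: "stereo p \<in> closure (stereo ` S)"
  have "\<exists>y\<in>S. y \<in> W" if W: "p \<in> W" "openin riemann_sphere W" for W
  proof -
    obtain V where V: "open V" "W = stereo -` V"
      using W(2) by (auto simp: openin_riemann_sphere_iff)
    then obtain e where "e > 0" "ball (stereo p) e \<subseteq> V"
      using W(1) open_contains_ball by blast
    moreover obtain y where "y \<in> S" "dist (stereo y) (stereo p) < e"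
      using p \<open>e > 0\<close> by (auto simp: closure_approachable)
    ultimately show ?thesis
      unfolding V(2) by (metis vimageI2 mem_ball dist_commute subsetD)
  qed
  then show "p \<in> riemann_sphere closure_of S"
    by (auto simp: in_closure_of)
qed

text \<open>The direction from the sphere to the plane holds because planar open sets are open in
  the sphere; it stands in for continuity of the inverse of \<open>stereo\<close> at finite
  points.\<close>

lemma tendsto_stereo_Some_iff:
  "((\<lambda>x. stereo (Some (h x))) \<longlongrightarrow> stereo (Some l)) F \<longleftrightarrow> (h \<longlongrightarrow> l) F"
proof
  assume lim: "((\<lambda>x. stereo (Some (h x))) \<longlongrightarrow> stereo (Some l)) F"
  show "(h \<longlongrightarrow> l) F"
  proof (rule topological_tendstoI)
    fix S assume "open S" "l \<in> S"
    then have "openin riemann_sphere (Some ` S)"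
      by (simp add: riemann_sphere_def)
    then obtain V where V: "open V" "Some ` S = stereo -` V"
      by (auto simp: openin_riemann_sphere_iff)
    with \<open>l \<in> S\<close> have "stereo (Some l) \<in> V"
      by auto
    then have "\<forall>\<^sub>F x in F. stereo (Some (h x)) \<in> V"
      using lim V(1) topological_tendstoD by blast
    then show "\<forall>\<^sub>F x in F. h x \<in> S"
      by (rule eventually_mono) (use V(2) in auto)
  qed
next
  assume "(h \<longlongrightarrow> l) F"
  then show "((\<lambda>x. stereo (Some (h x))) \<longlongrightarrow> stereo (Some l)) F"
    using continuous_on_tendsto_compose[OF continuous_on_stereo_Some[of UNIV]] by auto
qed

lemma open_Some_image_vimage:
  assumes "open S"
  obtains V where "open V" "Some ` S = stereo -` V"
proof -
  have "openin riemann_sphere (Some ` S)"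
    using assms by (simp add: riemann_sphere_def)
  then show ?thesis
    using that by (auto simp: openin_riemann_sphere_iff)
qed

lemma sphere_boundary_iff:
  assumes "open U"
  shows "p \<in> sphere_boundary U \<longleftrightarrow> stereo p \<in> closure (stereo ` Some ` U) \<and> p \<notin> Some ` U"
proof -
  have "riemann_sphere interior_of (Some ` U) = Some ` U"
    using assms by (simp add: interior_of_eq riemann_sphere_def)
  then show ?thesis
    by (auto simp: sphere_boundary_def frontier_of_def closure_of_riemann_sphere_iff)
qed

lemma stereo_convergent_subseq:
  obtains p s where "strict_mono (s :: nat \<Rightarrow> nat)" "(\<lambda>n. stereo (h (s n))) \<longlonglongrightarrow> stereo p"
proof -
  have "seq_compact (range stereo)"
    using compact_range_stereo by (simp add: compact_eq_seq_compact_metric)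
  then obtain l s where "l \<in> range stereo" "strict_mono (s :: nat \<Rightarrow> nat)" "((\<lambda>n. stereo (h n)) \<circ> s) \<longlonglongrightarrow> l"
    by (rule seq_compactE[where f = "\<lambda>n. stereo (h n)"]) auto
  then show ?thesis
    using that by (auto simp: o_def)
qed

section \<open>Univalent functions and area\<close>

text \<open>Lebesgue measure is determined by boxes, and boxes in \<open>complex\<close> are
  products of intervals. This makes Fubini available in the real and imaginary part.\<close>

lemma distr_lborel_Complex:
  "distr (lborel \<Otimes>\<^sub>M lborel) borel (\<lambda>(x, y). Complex x y) = lborel"
proof -
  have m [measurable]: "(\<lambda>(x, y). Complex x y) \<in> borel_measurable (borel :: (real \<times> real) measure)"
    unfolding Complex_eq case_prod_beta
    by (intro borel_measurable_continuous_onI continuous_intros)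
  show ?thesis
    unfolding lborel_prod
  proof (rule lborel_eqI[symmetric])
    fix l u :: complex
    assume le: "\<And>b. b \<in> Basis \<Longrightarrow> l \<bullet> b \<le> u \<bullet> b"
    have "(\<lambda>(x, y). Complex x y) -` box l u = box (Re l, Im l) (Re u, Im u)"
      by (auto simp: box_def Basis_complex_def Basis_prod_def)
    then show "emeasure (distr lborel borel (\<lambda>(x, y). Complex x y)) (box l u) = (\<Prod>b\<in>Basis. (u - l) \<bullet> b)"
      using le[of 1] le[of \<i>]
      by (subst emeasure_distr)
         (auto simp: emeasure_lborel_box_eq Basis_complex_def Basis_prod_def prod.union_disjoint algebra_simps)
  qed simp
qed

lemma borel_measurable_Complex: "(\<lambda>(x, y). Complex x y) \<in> borel_measurable (lborel \<Otimes>\<^sub>M lborel)"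
proof -
  have "(\<lambda>(x, y). Complex x y) \<in> borel_measurable (borel :: (real \<times> real) measure)"
    unfolding Complex_eq case_prod_beta
    by (intro borel_measurable_continuous_onI continuous_intros)
  then show ?thesis
    unfolding lborel_prod by simp
qed

lemma nn_integral_lborel_Complex:
  assumes [measurable]: "h \<in> borel_measurable borel"
  shows "(\<integral>\<^sup>+s. \<integral>\<^sup>+\<theta>. h (Complex s \<theta>) \<partial>lborel \<partial>lborel) = (\<integral>\<^sup>+z. h z \<partial>lborel)"
proof -
  note m = borel_measurable_Complex
  have "(\<integral>\<^sup>+z. h z \<partial>lborel) = (\<integral>\<^sup>+p. h (case p of (x, y) \<Rightarrow> Complex x y) \<partial>(lborel \<Otimes>\<^sub>M lborel))"
    by (subst distr_lborel_Complex[symmetric], subst nn_integral_distr) (use m in auto)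
  also have "\<dots> = (\<integral>\<^sup>+s. \<integral>\<^sup>+\<theta>. h (Complex s \<theta>) \<partial>lborel \<partial>lborel)"
    by (subst lborel.nn_integral_fst[symmetric]) (use measurable_compose[OF m assms] in auto)
  finally show ?thesis
    by simp
qed

lemma borel_measurable_nn_integral_Complex:
  assumes [measurable]: "h \<in> borel_measurable borel"
  shows "(\<lambda>s. \<integral>\<^sup>+\<theta>. h (Complex s \<theta>) \<partial>lborel) \<in> borel_measurable borel"
proof -
  note m = borel_measurable_Complex
  show ?thesis
    using lborel.borel_measurable_nn_integral_fst[OF measurable_compose[OF m assms]] by simp
qed

text \<open>The change of variables formula for measures of images is stated for vectors, so areas
  are carried over to \<open>real^2\<close>.\<close>

definition complex_of_vec :: "real^2 \<Rightarrow> complex" where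
  "complex_of_vec x = Complex (x $ 1) (x $ 2)"

definition vec_of_complex :: "complex \<Rightarrow> real^2" where
  "vec_of_complex z = (\<chi> i. if i = 1 then Re z else Im z)"

lemma complex_of_vec_of_complex [simp]: "complex_of_vec (vec_of_complex z) = z"
  by (simp add: complex_of_vec_def vec_of_complex_def)

lemma vec_of_complex_of_vec [simp]: "vec_of_complex (complex_of_vec x) = x"
  by (simp add: complex_of_vec_def vec_of_complex_def vec_eq_iff) (metis exhaust_2)

lemma bounded_linear_complex_of_vec: "bounded_linear complex_of_vec"
  by (rule linear_conv_bounded_linear[THEN iffD1])
     (auto simp: complex_of_vec_def linear_iff complex_eq_iff)

lemma bounded_linear_vec_of_complex: "bounded_linear vec_of_complex"
  by (rule linear_conv_bounded_linear[THEN iffD1])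
     (auto simp: vec_of_complex_def linear_iff vec_eq_iff)

lemma borel_measurable_complex_of_vec [measurable]: "complex_of_vec \<in> borel_measurable borel"
  using bounded_linear_complex_of_vec linear_continuous_on borel_measurable_continuous_onI by blast

lemma distr_lborel_complex_of_vec: "distr lborel borel complex_of_vec = lborel"
proof (rule lborel_eqI[symmetric])
  fix l u :: complex
  assume le: "\<And>b. b \<in> Basis \<Longrightarrow> l \<bullet> b \<le> u \<bullet> b"
  have B: "(Basis :: (real^2) set) = {axis 1 1, axis 2 1}"
    unfolding Basis_vec_def by auto (metis exhaust_2)
  have vc: "vec_of_complex z \<bullet> axis 1 1 = Re z" "vec_of_complex z \<bullet> axis 2 1 = Im z" for z
    by (simp_all add: vec_of_complex_def inner_axis)
  have cv: "x \<bullet> axis 1 1 = Re (complex_of_vec x)" "x \<bullet> axis 2 1 = Im (complex_of_vec x)" for x :: "real^2"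
    by (simp_all add: complex_of_vec_def inner_axis)
  have ne: "axis 1 1 \<noteq> (axis 2 1 :: real^2)"
    by (simp add: axis_eq_axis)
  have "x \<in> complex_of_vec -` box l u \<longleftrightarrow> x \<in> box (vec_of_complex l) (vec_of_complex u)" for x
    unfolding box_def B Basis_complex_def by (simp add: vc cv)
  then have "complex_of_vec -` box l u = box (vec_of_complex l) (vec_of_complex u)"
    by blast
  moreover have "emeasure lborel (box (vec_of_complex l) (vec_of_complex u)) = ennreal ((Re u - Re l) * (Im u - Im l))"
    unfolding emeasure_lborel_box_eq B using le[of 1] le[of \<i>] ne by (simp add: vc inner_diff_left Basis_complex_def)
  ultimately show "emeasure (distr lborel borel complex_of_vec) (box l u) = (\<Prod>b\<in>Basis. (u - l) \<bullet> b)"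
    by (subst emeasure_distr) (auto simp: Basis_complex_def)
qed simp

text \<open>The Jacobian determinant of a holomorphic map is the squared modulus of its derivative,
  so for injective \<open>G\<close> the integral is the area of the image. When that area is
  infinite the inequality is trivial.\<close>

lemma nn_integral_deriv_le_image:
  assumes "open \<Omega>" "G holomorphic_on \<Omega>" "inj_on G \<Omega>"
  shows "(\<integral>\<^sup>+z. indicator \<Omega> z * ennreal ((cmod (deriv G z))\<^sup>2) \<partial>lborel) \<le> emeasure lborel (G ` \<Omega>)"
proof (cases "emeasure lborel (G ` \<Omega>) = \<infinity>")
  case False
  define S where "S = complex_of_vec -` \<Omega>"
  define g where "g = vec_of_complex \<circ> G \<circ> complex_of_vec"
  define g' where "g' x h = vec_of_complex (deriv G (complex_of_vec x) * complex_of_vec h)" for x h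
  have cont_vec: "continuous_on A complex_of_vec" for A
    by (simp add: bounded_linear_complex_of_vec linear_continuous_on)
  have openS: "open S"
    unfolding S_def by (rule open_vimage[OF assms(1) cont_vec])
  have openG: "open (G ` \<Omega>)"
    using open_mapping_thm3[OF assms(2,1,3)] .
  have gS: "g ` S = complex_of_vec -` (G ` \<Omega>)"
  proof -
    have "x \<in> g ` S" if "complex_of_vec x = G z" "z \<in> \<Omega>" for x z
    proof (rule image_eqI[of _ _ "vec_of_complex z"])
      show "x = g (vec_of_complex z)"
        using that(1) vec_of_complex_of_vec[of x] by (simp add: g_def)
    qed (use that in \<open>auto simp: S_def\<close>)
    then show ?thesis
      by (auto simp: g_def S_def)
  qed
  have openg: "open (g ` S)"
    unfolding gS by (rule open_vimage[OF openG cont_vec])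
  have em: "emeasure lborel (g ` S) = emeasure lborel (G ` \<Omega>)"
  proof -
    have "emeasure lborel (G ` \<Omega>) = emeasure (distr lborel borel complex_of_vec) (G ` \<Omega>)"
      by (simp add: distr_lborel_complex_of_vec)
    also have "\<dots> = emeasure lborel (complex_of_vec -` (G ` \<Omega>) \<inter> space lborel)"
      by (rule emeasure_distr) (use openG in auto)
    finally show ?thesis
      by (simp add: gS)
  qed
  have der: "(g has_derivative g' x) (at x within S)" if "x \<in> S" for x
  proof -
    have "(G has_field_derivative deriv G (complex_of_vec x)) (at (complex_of_vec x))"
      using that assms by (intro holomorphic_derivI[of _ \<Omega>]) (auto simp: S_def)
    then have "(G has_derivative (\<lambda>h. deriv G (complex_of_vec x) * h)) (at (complex_of_vec x))"
      by (simp add: has_field_derivative_def)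
    then have "((G \<circ> complex_of_vec) has_derivative ((\<lambda>h. deriv G (complex_of_vec x) * h) \<circ> complex_of_vec)) (at x)"
      by (rule diff_chain_at[OF bounded_linear_imp_has_derivative[OF bounded_linear_complex_of_vec]])
    then have "((vec_of_complex \<circ> (G \<circ> complex_of_vec)) has_derivative
        (vec_of_complex \<circ> ((\<lambda>h. deriv G (complex_of_vec x) * h) \<circ> complex_of_vec))) (at x)"
      by (rule diff_chain_at[OF _ bounded_linear_imp_has_derivative[OF bounded_linear_vec_of_complex]])
    then have "(g has_derivative g' x) (at x)"
      by (simp add: g_def g'_def[abs_def] o_def)
    then show ?thesis
      by (rule has_derivative_at_withinI)
  qed
  have inj: "inj_on g S"
  proof (rule inj_onI)
    fix x y assume xy: "x \<in> S" "y \<in> S" "g x = g y"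
    then have "G (complex_of_vec x) = G (complex_of_vec y)"
      by (metis comp_apply complex_of_vec_of_complex g_def)
    then have "complex_of_vec x = complex_of_vec y"
      using xy assms(3) by (auto simp: S_def inj_on_def)
    then show "x = y"
      by (metis vec_of_complex_of_vec)
  qed
  have det: "\<bar>det (matrix (g' x))\<bar> = (cmod (deriv G (complex_of_vec x)))\<^sup>2" for x
    by (simp add: det_2 matrix_def g'_def complex_of_vec_def vec_of_complex_def axis_def cmod_power2)
       (simp add: power2_eq_square)
  have lmeas: "g ` S \<in> lmeasurable"
    using False openg by (simp add: fmeasurable_def em top.not_eq_extremum)
  have "(\<lambda>x. \<bar>det (matrix (g' x))\<bar>) integrable_on S"
    using measurable_differentiable_image_eq[OF _ der inj] lmeas openS by simp
  moreover have "measure lebesgue (g ` S) = integral S (\<lambda>x. \<bar>det (matrix (g' x))\<bar>)"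
    using measure_differentiable_image_eq[OF _ der inj calculation] openS by simp
  ultimately have "((\<lambda>x. (cmod (deriv G (complex_of_vec x)))\<^sup>2) has_integral measure lebesgue (g ` S)) S"
    unfolding det by (simp add: has_integral_integrable_integral)
  then have "(\<integral>\<^sup>+x. indicator S x * (cmod (deriv G (complex_of_vec x)))\<^sup>2 \<partial>lborel) = measure lebesgue (g ` S)"
    by (intro nn_integral_has_integral_lebesgue) auto
  also have "(\<lambda>x. ennreal (indicator S x * (cmod (deriv G (complex_of_vec x)))\<^sup>2)) =
      (\<lambda>x. indicator \<Omega> (complex_of_vec x) * ennreal ((cmod (deriv G (complex_of_vec x)))\<^sup>2))"
    by (auto simp: S_def indicator_def)
  also have "(\<integral>\<^sup>+x. indicator \<Omega> (complex_of_vec x) * ennreal ((cmod (deriv G (complex_of_vec x)))\<^sup>2) \<partial>lborel) =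
      (\<integral>\<^sup>+z. indicator \<Omega> z * ennreal ((cmod (deriv G z))\<^sup>2) \<partial>lborel)"
  proof -
    have "continuous_on \<Omega> (deriv G)"
      using assms by (intro holomorphic_on_imp_continuous_on holomorphic_deriv)
    then have "(\<lambda>z. indicator \<Omega> z *\<^sub>R (cmod (deriv G z))\<^sup>2) \<in> borel_measurable borel"
      using assms(1) by (intro borel_measurable_continuous_on_indicator continuous_intros) auto
    then have "(\<lambda>z. ennreal (indicator \<Omega> z *\<^sub>R (cmod (deriv G z))\<^sup>2)) \<in> borel_measurable borel"
      by measurable
    also have "(\<lambda>z. ennreal (indicator \<Omega> z *\<^sub>R (cmod (deriv G z))\<^sup>2)) = (\<lambda>z. indicator \<Omega> z * ennreal ((cmod (deriv G z))\<^sup>2))"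
      by (auto simp: indicator_def)
    finally have "(\<integral>\<^sup>+z. indicator \<Omega> z * ennreal ((cmod (deriv G z))\<^sup>2) \<partial>distr lborel borel complex_of_vec) =
        (\<integral>\<^sup>+x. indicator \<Omega> (complex_of_vec x) * ennreal ((cmod (deriv G (complex_of_vec x)))\<^sup>2) \<partial>lborel)"
      by (intro nn_integral_distr) auto
    then show ?thesis
      by (simp add: distr_lborel_complex_of_vec)
  qed
  also have "ennreal (measure lebesgue (g ` S)) = emeasure lborel (G ` \<Omega>)"
    using openg False by (simp add: measure_completion em emeasure_eq_ennreal_measure flip: em)
  finally show ?thesis
    by simp
qed simp

lemma borel_measurable_indicator_deriv:
  assumes "open \<Omega>" "G holomorphic_on \<Omega>"
  shows "(\<lambda>z. indicator \<Omega> z * ennreal (cmod (deriv G z))) \<in> borel_measurable borel"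
proof -
  have "continuous_on \<Omega> (deriv G)"
    using assms by (intro holomorphic_on_imp_continuous_on holomorphic_deriv)
  then have "(\<lambda>z. indicator \<Omega> z *\<^sub>R (cmod (deriv G z))) \<in> borel_measurable borel"
    using assms(1) by (intro borel_measurable_continuous_on_indicator continuous_intros) auto
  then have "(\<lambda>z. ennreal (indicator \<Omega> z *\<^sub>R (cmod (deriv G z)))) \<in> borel_measurable borel"
    by measurable
  also have "(\<lambda>z. ennreal (indicator \<Omega> z *\<^sub>R (cmod (deriv G z)))) = (\<lambda>z. indicator \<Omega> z * ennreal (cmod (deriv G z)))"
    by (auto simp: indicator_def)
  finally show ?thesis .
qed

text \<open>The length-area inequality in additive form: in place of Cauchy-Schwarz, the pointwise
  bound x <= c/2 x^2 + 1/(2c) is integrated. The weight \<open>c\<close> stays free and is chosen at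
  each use to balance the two areas.\<close>

lemma length_area:
  fixes c :: real
  assumes "open \<Omega>" "G holomorphic_on \<Omega>" "inj_on G \<Omega>" "c > 0"
  shows "(\<integral>\<^sup>+s. \<integral>\<^sup>+\<theta>. indicator \<Omega> (Complex s \<theta>) * ennreal (cmod (deriv G (Complex s \<theta>))) \<partial>lborel \<partial>lborel)
    \<le> ennreal (c / 2) * emeasure lborel (G ` \<Omega>) + ennreal (1 / (2 * c)) * emeasure lborel \<Omega>"
proof -
  have "continuous_on \<Omega> (deriv G)"
    using assms by (intro holomorphic_on_imp_continuous_on holomorphic_deriv)
  then have "(\<lambda>z. indicator \<Omega> z *\<^sub>R (cmod (deriv G z))\<^sup>2) \<in> borel_measurable borel"
    using assms(1) by (intro borel_measurable_continuous_on_indicator continuous_intros) auto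
  then have "(\<lambda>z. ennreal (indicator \<Omega> z *\<^sub>R (cmod (deriv G z))\<^sup>2)) \<in> borel_measurable borel"
    by measurable
  also have "(\<lambda>z. ennreal (indicator \<Omega> z *\<^sub>R (cmod (deriv G z))\<^sup>2)) = (\<lambda>z. indicator \<Omega> z * ennreal ((cmod (deriv G z))\<^sup>2))"
    by (auto simp: indicator_def)
  finally have m [measurable]: "(\<lambda>z. indicator \<Omega> z * ennreal ((cmod (deriv G z))\<^sup>2)) \<in> borel_measurable borel" .
  have [measurable]: "\<Omega> \<in> sets borel"
    using assms by simp
  have amgm: "x \<le> c / 2 * x\<^sup>2 + 1 / (2 * c)" for x :: real
  proof -
    have "0 \<le> (c * x - 1)\<^sup>2 / (2 * c)"
      using assms by simp
    also have "\<dots> = c / 2 * x\<^sup>2 + 1 / (2 * c) - x"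
      using assms by (simp add: field_simps power2_eq_square)
    finally show ?thesis
      by simp
  qed
  have "(\<integral>\<^sup>+s. \<integral>\<^sup>+\<theta>. indicator \<Omega> (Complex s \<theta>) * ennreal (cmod (deriv G (Complex s \<theta>))) \<partial>lborel \<partial>lborel)
     = (\<integral>\<^sup>+z. indicator \<Omega> z * ennreal (cmod (deriv G z)) \<partial>lborel)"
    by (rule nn_integral_lborel_Complex[OF borel_measurable_indicator_deriv[OF assms(1,2)]])
  also have "\<dots> \<le> (\<integral>\<^sup>+z. ennreal (c / 2) * (indicator \<Omega> z * ennreal ((cmod (deriv G z))\<^sup>2)) + ennreal (1 / (2 * c)) * indicator \<Omega> z \<partial>lborel)"
  proof (rule nn_integral_mono)
    fix z
    show "indicator \<Omega> z * ennreal (cmod (deriv G z)) \<le>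
       ennreal (c / 2) * (indicator \<Omega> z * ennreal ((cmod (deriv G z))\<^sup>2)) + ennreal (1 / (2 * c)) * indicator \<Omega> z"
      using assms(4) amgm[of "cmod (deriv G z)"]
      by (auto simp: indicator_def simp flip: ennreal_mult ennreal_plus)
  qed
  also have "\<dots> = ennreal (c / 2) * (\<integral>\<^sup>+z. indicator \<Omega> z * ennreal ((cmod (deriv G z))\<^sup>2) \<partial>lborel)
      + ennreal (1 / (2 * c)) * emeasure lborel \<Omega>"
    by (subst nn_integral_add) (auto simp: nn_integral_cmult nn_integral_cmult_indicator)
  also have "\<dots> \<le> ennreal (c / 2) * emeasure lborel (G ` \<Omega>) + ennreal (1 / (2 * c)) * emeasure lborel \<Omega>"
    by (intro add_mono mult_left_mono nn_integral_deriv_le_image assms) auto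
  finally show ?thesis .
qed

lemma norm_diff_le_nn_integral:
  fixes h h' :: "real \<Rightarrow> complex"
  assumes "a \<le> b" "\<And>x. x \<in> {a..b} \<Longrightarrow> (h has_vector_derivative h' x) (at x within {a..b})"
    and "continuous_on {a..b} h'"
  shows "ennreal (norm (h b - h a)) \<le> (\<integral>\<^sup>+x. indicator {a<..<b} x * ennreal (norm (h' x)) \<partial>lborel)"
proof -
  have h: "(h' has_integral (h b - h a)) {a..b}"
    using assms by (intro fundamental_theorem_of_calculus) auto
  have n: "(\<lambda>x. norm (h' x)) integrable_on {a..b}"
    using assms(3) by (intro integrable_continuous_real continuous_intros)
  have "norm (h b - h a) \<le> integral {a..b} (\<lambda>x. norm (h' x))"
    using integral_norm_bound_integral[OF has_integral_integrable[OF h] n] h by (simp add: integral_unique)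
  moreover have "(\<integral>\<^sup>+x. indicator {a<..<b} x * norm (h' x) \<partial>lborel) = integral {a..b} (\<lambda>x. norm (h' x))"
    using integrable_integral[OF n] by (intro nn_integral_has_integral_lebesgue) (auto simp: has_integral_Icc_iff_Ioo)
  moreover have "(\<lambda>x. ennreal (indicator {a<..<b} x * norm (h' x))) = (\<lambda>x. indicator {a<..<b} x * ennreal (norm (h' x)))"
    by (auto simp: indicator_def)
  ultimately show ?thesis
    by (simp add: ennreal_leI)
qed

text \<open>Between the last parameter outside the disc of radius \<open>R\<close> about
  \<open>q\<close> (or the first, if the curve runs the other way) and the end within
  \<open>R / 2\<close>, the curve stays in the disc and moves by at least \<open>R / 2\<close>. Its
  length in the disc is at least that.\<close>

lemma crossing_length:
  fixes h h' :: "real \<Rightarrow> complex"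
  assumes "a \<le> b" and der: "\<And>x. x \<in> {a..b} \<Longrightarrow> (h has_vector_derivative h' x) (at x within {a..b})"
    and cont: "continuous_on {a..b} h'"
    and ends: "dist (h a) q \<ge> R \<and> dist (h b) q \<le> R / 2 \<or> dist (h b) q \<ge> R \<and> dist (h a) q \<le> R / 2"
    and A: "\<And>x. x \<in> {a..b} \<Longrightarrow> dist (h x) q < R \<Longrightarrow> x \<in> A"
  shows "ennreal (R / 2) \<le> (\<integral>\<^sup>+x. indicator A x * ennreal (norm (h' x)) \<partial>lborel)"
proof -
  have ch: "continuous_on {a..b} h"
    unfolding continuous_on_eq_continuous_within using der has_vector_derivative_continuous by blast
  define K where "K = {x \<in> {a..b}. dist (h x) q \<ge> R}"
  have "closed K"
    unfolding K_def by (intro continuous_on_closed_Collect_le continuous_intros ch)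
  then have cK: "compact K"
    using compact_Int_closed[of "{a..b}" K] by (simp add: K_def Int_absorb1 subset_iff)
  have "\<exists>c d. a \<le> c \<and> c \<le> d \<and> d \<le> b \<and> (\<forall>x\<in>{c<..<d}. dist (h x) q < R) \<and> R / 2 \<le> norm (h d - h c)"
    using ends
  proof
    assume e: "dist (h a) q \<ge> R \<and> dist (h b) q \<le> R / 2"
    then have "K \<noteq> {}"
      using assms(1) by (auto simp: K_def)
    then obtain c where c: "c \<in> K" "\<And>x. x \<in> K \<Longrightarrow> x \<le> c"
      using compact_attains_sup[OF cK] by blast
    have "R / 2 \<le> norm (h b - h c)"
      using c(1) e dist_triangle[of "h c" q "h b"] by (auto simp: K_def dist_norm norm_minus_commute)
    moreover have "dist (h x) q < R" if "x \<in> {c<..<b}" for x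
      using c(1) c(2)[of x] that by (fastforce simp: K_def)
    ultimately show ?thesis
      using c(1) by (intro exI[of _ c] exI[of _ b]) (auto simp: K_def)
  next
    assume e: "dist (h b) q \<ge> R \<and> dist (h a) q \<le> R / 2"
    then have "K \<noteq> {}"
      using assms(1) by (auto simp: K_def)
    then obtain c where c: "c \<in> K" "\<And>x. x \<in> K \<Longrightarrow> c \<le> x"
      using compact_attains_inf[OF cK] by blast
    have "R / 2 \<le> norm (h c - h a)"
      using c(1) e dist_triangle[of "h c" q "h a"] by (auto simp: K_def dist_norm norm_minus_commute)
    moreover have "dist (h x) q < R" if "x \<in> {a<..<c}" for x
      using c(1) c(2)[of x] that by (fastforce simp: K_def)
    ultimately show ?thesis
      using c(1) by (intro exI[of _ a] exI[of _ c]) (auto simp: K_def)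
  qed
  then obtain c d where cd: "a \<le> c" "c \<le> d" "d \<le> b" "\<And>x. x \<in> {c<..<d} \<Longrightarrow> dist (h x) q < R" "R / 2 \<le> norm (h d - h c)"
    by blast
  have "ennreal (R / 2) \<le> ennreal (norm (h d - h c))"
    using cd(5) by (rule ennreal_leI)
  also have "\<dots> \<le> (\<integral>\<^sup>+x. indicator {c<..<d} x * ennreal (norm (h' x)) \<partial>lborel)"
    using cd by (intro norm_diff_le_nn_integral has_vector_derivative_within_subset[OF der] continuous_on_subset[OF cont]) auto
  also have "\<dots> \<le> (\<integral>\<^sup>+x. indicator A x * ennreal (norm (h' x)) \<partial>lborel)"
    using cd A by (intro nn_integral_mono) (auto simp: indicator_def)
  finally show ?thesis .
qed

text \<open>A square around the disc suffices, since only the order of the bound in \<open>R\<close>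
  matters; the next lemma uses a square inside the disc in the same way.\<close>

lemma emeasure_lborel_ball_le:
  fixes q :: complex
  assumes "R \<ge> 0"
  shows "emeasure lborel (ball q R) \<le> ennreal ((2 * R)\<^sup>2)"
proof -
  have "ball q R \<subseteq> cbox (q - Complex R R) (q + Complex R R)"
  proof
    fix z assume "z \<in> ball q R"
    then have "\<bar>Re (z - q)\<bar> < R" "\<bar>Im (z - q)\<bar> < R"
      using abs_Re_le_cmod[of "z - q"] abs_Im_le_cmod[of "z - q"] by (auto simp: dist_norm norm_minus_commute)
    then show "z \<in> cbox (q - Complex R R) (q + Complex R R)"
      by (auto simp: in_cbox_complex_iff)
  qed
  then have "emeasure lborel (ball q R) \<le> emeasure lborel (cbox (q - Complex R R) (q + Complex R R))"
    by (intro emeasure_mono) auto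
  also have "\<dots> = ennreal ((2 * R)\<^sup>2)"
    using assms by (auto simp: emeasure_lborel_cbox_eq Basis_complex_def power2_eq_square algebra_simps)
  finally show ?thesis .
qed

lemma emeasure_lborel_ball_ge:
  fixes q :: complex
  assumes "R \<ge> 0"
  shows "ennreal (R\<^sup>2) \<le> emeasure lborel (ball q R)"
proof -
  have "box (q - Complex (R/2) (R/2)) (q + Complex (R/2) (R/2)) \<subseteq> ball q R"
  proof
    fix z assume "z \<in> box (q - Complex (R/2) (R/2)) (q + Complex (R/2) (R/2))"
    then have "\<bar>Re (z - q)\<bar> < R / 2" "\<bar>Im (z - q)\<bar> < R / 2"
      unfolding in_box_complex_iff abs_less_iff by auto
    then show "z \<in> ball q R"
      using cmod_le[of "z - q"] by (simp add: dist_norm norm_minus_commute)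
  qed
  then have "emeasure lborel (box (q - Complex (R/2) (R/2)) (q + Complex (R/2) (R/2))) \<le> emeasure lborel (ball q R)"
    by (intro emeasure_mono) auto
  also have "emeasure lborel (box (q - Complex (R/2) (R/2)) (q + Complex (R/2) (R/2))) = ennreal (R\<^sup>2)"
    using assms by (auto simp: emeasure_lborel_box_eq Basis_complex_def power2_eq_square algebra_simps)
  finally show ?thesis .
qed

lemma has_vector_derivative_vertical:
  assumes "open \<Omega>" "G holomorphic_on \<Omega>" "Complex s x \<in> \<Omega>"
  shows "((\<lambda>\<theta>. G (Complex s \<theta>)) has_vector_derivative \<i> * deriv G (Complex s x)) (at x within S)"
proof -
  have "((\<lambda>\<theta>. of_real s + of_real \<theta> * \<i>) has_vector_derivative \<i>) (at x within S)"
    by (auto intro!: derivative_eq_intros)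
  then have 1: "(Complex s has_vector_derivative \<i>) (at x within S)"
    unfolding Complex_eq mult.commute[of \<i>] .
  have "(G has_field_derivative deriv G (Complex s x)) (at (Complex s x))"
    using assms by (intro holomorphic_derivI)
  from field_vector_diff_chain_within[OF 1 has_field_derivative_at_within[OF this]] show ?thesis
    by (simp add: o_def)
qed

lemma continuous_on_vertical:
  assumes "continuous_on \<Omega> h" "\<And>x. x \<in> S \<Longrightarrow> Complex s x \<in> \<Omega>"
  shows "continuous_on S (\<lambda>\<theta>. h (Complex s \<theta>))"
proof (rule continuous_on_compose2[OF assms(1)])
  show "continuous_on S (Complex s)"
    unfolding Complex_eq by (intro continuous_intros)
qed (use assms(2) in auto)

text \<open>A slice that comes arbitrarily near \<open>q\<close> has length at least
  \<open>(1/2) ^ n / 2\<close> in the part \<open>A n\<close> of \<Omega> mapped into the disc of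
  radius \<open>(1/2) ^ n\<close>, for all large \<open>n\<close>. By the length-area inequality the
  set of such \<open>s\<close> has measure at most 4 k plus 1/k times the area of
  \<open>A n\<close>. That area tends to 0, because no point of \<Omega> is mapped to
  \<open>q\<close>, and \<open>k\<close> is arbitrary. The point of the slice on the real axis,
  whose image is at distance at least \<open>d0\<close> from \<open>q\<close>, is the far end from
  which the slice has to cross.\<close>

lemma AE_vertical_avoids:
  assumes "open \<Omega>" and hol: "G holomorphic_on \<Omega>" and inj: "inj_on G \<Omega>" and q: "q \<notin> G ` \<Omega>"
    and fin: "emeasure lborel \<Omega> < \<infinity>"
    and conv: "\<And>s. convex {\<theta>. Complex s \<theta> \<in> \<Omega>}"
    and d0: "d0 > 0" "\<And>s. s \<in> I \<Longrightarrow> Complex s 0 \<in> \<Omega> \<and> d0 \<le> dist (G (Complex s 0)) q"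
  shows "AE s in lborel. s \<in> I \<longrightarrow> (\<exists>d>0. \<forall>\<theta>. Complex s \<theta> \<in> \<Omega> \<longrightarrow> d \<le> dist (G (Complex s \<theta>)) q)"
proof -
  define A where "A n = \<Omega> \<inter> G -` ball q ((1/2) ^ n)" for n :: nat
  have openA: "open (A n)" for n
    unfolding A_def by (intro continuous_open_preimage holomorphic_on_imp_continuous_on hol assms(1)) auto
  have Asub: "A n \<subseteq> \<Omega>" for n
    by (auto simp: A_def)
  have "(\<lambda>n. emeasure lborel (A n)) \<longlonglongrightarrow> emeasure lborel (\<Inter>n. A n)"
  proof (rule Lim_emeasure_decseq)
    show "decseq A"
      unfolding decseq_def
    proof (intro allI impI)
      fix m n :: nat assume "m \<le> n"
      then have "(1/2::real) ^ n \<le> (1/2) ^ m"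
        by (intro power_decreasing) auto
      then show "A n \<subseteq> A m"
        unfolding A_def by (intro Int_mono vimage_mono subset_ball order_refl)
    qed
    show "emeasure lborel (A n) \<noteq> \<infinity>" for n
      using emeasure_mono[OF Asub, of lborel n] fin assms(1) by (auto simp: top.not_eq_extremum)
  qed (use openA in auto)
  moreover have "(\<Inter>n. A n) = {}"
  proof -
    have False if "\<And>n. z \<in> A n" for z
    proof -
      have "dist q (G z) < (1/2) ^ n" for n
        using that by (simp add: A_def)
      moreover have "dist q (G z) > 0"
        using that q by (auto simp: A_def)
      ultimately show False
        using real_arch_pow_inv[of "dist q (G z)" "1/2"] by (auto dest: less_asym)
    qed
    then show ?thesis
      by blast
  qed
  ultimately have limA: "(\<lambda>n. emeasure lborel (A n)) \<longlonglongrightarrow> 0"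
    by simp
  define L where "L n s = (\<integral>\<^sup>+\<theta>. indicator (A n) (Complex s \<theta>) * ennreal (cmod (deriv G (Complex s \<theta>))) \<partial>lborel)" for n s
  have holA: "G holomorphic_on A n" and injA: "inj_on G (A n)" for n
    using hol inj Asub by (auto intro: holomorphic_on_subset inj_on_subset)
  have mL [measurable]: "L n \<in> borel_measurable borel" for n
    unfolding L_def by (rule borel_measurable_nn_integral_Complex[OF borel_measurable_indicator_deriv[OF openA holA]])
  define B where "B n = {s. ennreal ((1/2) ^ n / 2) \<le> L n s}" for n
  have mB [measurable]: "B n \<in> sets borel" for n
    unfolding B_def by measurable
  have B_le: "emeasure lborel (B n) \<le> ennreal (4 * k) + ennreal (1 / k) * emeasure lborel (A n)" if k: "k > 0" for k n
  proof -
    have "ennreal ((1/2) ^ n / 2) * emeasure lborel (B n) = (\<integral>\<^sup>+s. ennreal ((1/2) ^ n / 2) * indicator (B n) s \<partial>lborel)"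
      by (simp add: nn_integral_cmult_indicator)
    also have "\<dots> \<le> (\<integral>\<^sup>+s. L n s \<partial>lborel)"
      by (intro nn_integral_mono) (auto simp: B_def indicator_def)
    \<comment> \<open>The weight \<open>2 ^ n * k\<close> makes both terms multiples of
      \<open>(1/2) ^ n / 2\<close>, which then cancels.\<close>
    also have "\<dots> \<le> ennreal (2 ^ n * k / 2) * emeasure lborel (G ` A n) + ennreal (1 / (2 * (2 ^ n * k))) * emeasure lborel (A n)"
      unfolding L_def using k by (intro length_area openA holA injA) auto
    also have "\<dots> \<le> ennreal (2 ^ n * k / 2) * ennreal ((2 * (1/2) ^ n)\<^sup>2) + ennreal (1 / (2 * (2 ^ n * k))) * emeasure lborel (A n)"
    proof (intro add_mono mult_left_mono order_refl)
      have "emeasure lborel (G ` A n) \<le> emeasure lborel (ball q ((1/2) ^ n))"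
        by (intro emeasure_mono) (auto simp: A_def)
      also have "\<dots> \<le> ennreal ((2 * (1/2) ^ n)\<^sup>2)"
        by (rule emeasure_lborel_ball_le) auto
      finally show "emeasure lborel (G ` A n) \<le> ennreal ((2 * (1/2) ^ n)\<^sup>2)" .
    qed auto
    also have "ennreal (2 ^ n * k / 2) * ennreal ((2 * (1/2) ^ n)\<^sup>2) = ennreal ((1/2) ^ n / 2) * ennreal (4 * k)"
      using k by (simp flip: ennreal_mult) (simp add: power2_eq_square field_simps flip: power_mult_distrib)
    also have "ennreal (1 / (2 * (2 ^ n * k))) = ennreal ((1/2) ^ n / 2) * ennreal (1 / k)"
      using k by (simp flip: ennreal_mult) (simp add: field_simps flip: power_mult_distrib)
    finally have "ennreal ((1/2) ^ n / 2) * emeasure lborel (B n) \<le>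
        ennreal ((1/2) ^ n / 2) * (ennreal (4 * k) + ennreal (1 / k) * emeasure lborel (A n))"
      by (simp add: distrib_left mult.assoc)
    then show ?thesis
      by (subst (asm) ennreal_mult_le_mult_iff) auto
  qed
  \<comment> \<open>From \<open>n0\<close> on the disc of radius \<open>(1/2) ^ n\<close> about
    \<open>q\<close> excludes the image of the base point \<open>Complex s 0\<close>, so that a
    crossing is forced.\<close>
  obtain n0 where n0: "(1/2) ^ n0 < d0"
    using real_arch_pow_inv[OF d0(1), of "1/2"] by auto
  define N where "N = (\<Inter>n\<in>{n0..}. B n)"
  have mN [measurable]: "N \<in> sets borel"
    unfolding N_def by (intro sets.countable_INT'') auto
  have N_le: "emeasure lborel N \<le> ennreal (4 * k)" if k: "k > 0" for k
  proof (rule tendsto_lowerbound)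
    have "(\<lambda>n. ennreal (4 * k) + ennreal (1 / k) * emeasure lborel (A n)) \<longlonglongrightarrow> ennreal (4 * k) + ennreal (1 / k) * 0"
      by (intro tendsto_add tendsto_const ennreal_tendsto_cmult limA) auto
    then show "(\<lambda>n. ennreal (4 * k) + ennreal (1 / k) * emeasure lborel (A n)) \<longlonglongrightarrow> ennreal (4 * k)"
      by simp
    show "\<forall>\<^sub>F n in sequentially. emeasure lborel N \<le> ennreal (4 * k) + ennreal (1 / k) * emeasure lborel (A n)"
      using eventually_ge_at_top[of n0]
    proof eventually_elim
      case (elim n)
      then have "emeasure lborel N \<le> emeasure lborel (B n)"
        by (intro emeasure_mono) (auto simp: N_def)
      with B_le[OF k, of n] show ?case
        by (rule order_trans[rotated])
    qed
  qed auto
  have "emeasure lborel N \<le> 0"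
  proof (rule ennreal_le_epsilon)
    fix e :: real assume "e > 0"
    then show "emeasure lborel N \<le> 0 + ennreal e"
      using N_le[of "e / 4"] by simp
  qed
  then have "N \<in> null_sets lborel"
    by (simp add: null_sets_def)
  then show ?thesis
  proof (rule AE_I')
    show "{s \<in> space lborel. \<not> (s \<in> I \<longrightarrow> (\<exists>d>0. \<forall>\<theta>. Complex s \<theta> \<in> \<Omega> \<longrightarrow> d \<le> dist (G (Complex s \<theta>)) q))} \<subseteq> N"
    proof (rule subsetI)
      fix s assume "s \<in> {s \<in> space lborel. \<not> (s \<in> I \<longrightarrow> (\<exists>d>0. \<forall>\<theta>. Complex s \<theta> \<in> \<Omega> \<longrightarrow> d \<le> dist (G (Complex s \<theta>)) q))}"
      then have s: "s \<in> I" "\<not> (\<exists>d>0. \<forall>\<theta>. Complex s \<theta> \<in> \<Omega> \<longrightarrow> d \<le> dist (G (Complex s \<theta>)) q)"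
        by blast+
      have "s \<in> B n" if n: "n \<ge> n0" for n
      proof -
        define R :: real where "R = (1/2) ^ n"
        have "R > 0"
          by (simp add: R_def)
        then obtain x where x: "Complex s x \<in> \<Omega>" "dist (G (Complex s x)) q < R / 2"
          using s(2) by (meson half_gt_zero not_le)
        have "R \<le> (1/2) ^ n0"
          unfolding R_def using n by (intro power_decreasing) auto
        then have R0: "R \<le> dist (G (Complex s 0)) q" "Complex s 0 \<in> \<Omega>"
          using d0(2)[OF s(1)] n0 by auto
        have sl: "Complex s y \<in> \<Omega>" if "y \<in> {min 0 x..max 0 x}" for y
        proof -
          have "closed_segment 0 x \<subseteq> {\<theta>. Complex s \<theta> \<in> \<Omega>}"
            using conv R0 x by (intro closed_segment_subset) auto
          then show ?thesis
            using that by (auto simp: closed_segment_eq_real_ivl split: if_splits)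
        qed
        have "ennreal (R / 2) \<le> (\<integral>\<^sup>+\<theta>. indicator {\<theta>. Complex s \<theta> \<in> A n} \<theta> * ennreal (norm (\<i> * deriv G (Complex s \<theta>))) \<partial>lborel)"
        proof (rule crossing_length)
          show "((\<lambda>\<theta>. G (Complex s \<theta>)) has_vector_derivative \<i> * deriv G (Complex s y)) (at y within {min 0 x..max 0 x})"
            if "y \<in> {min 0 x..max 0 x}" for y
            using sl[OF that] by (intro has_vector_derivative_vertical[OF assms(1) hol])
          have "continuous_on \<Omega> (deriv G)"
            using assms hol by (intro holomorphic_on_imp_continuous_on holomorphic_deriv)
          then show "continuous_on {min 0 x..max 0 x} (\<lambda>\<theta>. \<i> * deriv G (Complex s \<theta>))"
            using sl by (intro continuous_intros continuous_on_vertical[of \<Omega>])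
          show "R \<le> dist (G (Complex s (min 0 x))) q \<and> dist (G (Complex s (max 0 x))) q \<le> R / 2 \<or>
              R \<le> dist (G (Complex s (max 0 x))) q \<and> dist (G (Complex s (min 0 x))) q \<le> R / 2"
            using x R0 by (auto simp: min_def max_def)
          show "y \<in> {\<theta>. Complex s \<theta> \<in> A n}" if "y \<in> {min 0 x..max 0 x}" "dist (G (Complex s y)) q < R" for y
            using that sl by (auto simp: A_def R_def dist_commute)
        qed auto
        also have "\<dots> = L n s"
          unfolding L_def by (intro nn_integral_cong) (auto simp: indicator_def norm_mult)
        finally show ?thesis
          by (simp add: B_def R_def)
      qed
      then show "s \<in> N"
        by (auto simp: N_def)
    qed
  qed
qed

section \<open>Circular arcs around a boundary point\<close>

text \<open>The circle of radius \<rho> about \<zeta> leaves the unit disc where the angle measured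
  from the radius is plus or minus \<open>arccos (\<rho> / 2)\<close>. The arc inside the disc
  belongs to \<open>u\<close> in (0,1), and \<open>u = 1/2\<close> gives the point on the
  radius.\<close>

definition circ_arc :: "complex \<Rightarrow> real \<Rightarrow> real \<Rightarrow> complex" where
  "circ_arc \<zeta> \<rho> u = \<zeta> * (1 - of_real \<rho> * cis ((2 * u - 1) * arccos (\<rho> / 2)))"

lemma norm_one_minus_cis: "(cmod (1 - of_real \<rho> * cis \<theta>))\<^sup>2 = 1 - 2 * \<rho> * cos \<theta> + \<rho>\<^sup>2"
proof -
  have "(cmod (1 - of_real \<rho> * cis \<theta>))\<^sup>2 = (1 - \<rho> * cos \<theta>)\<^sup>2 + (\<rho> * sin \<theta>)\<^sup>2"
    by (simp add: cmod_power2)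
  also have "\<dots> = 1 - 2 * \<rho> * cos \<theta> + \<rho>\<^sup>2 * ((cos \<theta>)\<^sup>2 + (sin \<theta>)\<^sup>2)"
    by (simp only: power2_diff power_mult_distrib distrib_left) simp
  finally show ?thesis
    by simp
qed

lemma arccos_half_bounds:
  assumes "0 < \<rho>" "\<rho> \<le> 1"
  shows "0 < arccos (\<rho> / 2)" "arccos (\<rho> / 2) < pi / 2" "cos (arccos (\<rho> / 2)) = \<rho> / 2"
  using assms arccos_lt_bounded[of "\<rho> / 2"] arccos_less_arccos[of 0 "\<rho> / 2"] by (auto simp: cos_arccos)

text \<open>Squaring reduces the condition to \<rho> < 2 cos \<theta>, and \<open>cos\<close> is
  decreasing on [0, pi].\<close>

lemma norm_one_minus_cis_less_iff:
  assumes "0 < \<rho>" "\<rho> \<le> 1" "\<bar>\<theta>\<bar> \<le> pi"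
  shows "cmod (1 - of_real \<rho> * cis \<theta>) < 1 \<longleftrightarrow> \<bar>\<theta>\<bar> < arccos (\<rho> / 2)"
proof -
  have "cmod (1 - of_real \<rho> * cis \<theta>) < 1 \<longleftrightarrow> (cmod (1 - of_real \<rho> * cis \<theta>))\<^sup>2 < 1"
    by (simp add: power_less_one_iff)
  also have "\<dots> \<longleftrightarrow> \<rho> * \<rho> < \<rho> * (2 * cos \<theta>)"
    unfolding norm_one_minus_cis by (auto simp: power2_eq_square)
  also have "\<dots> \<longleftrightarrow> cos (arccos (\<rho> / 2)) < cos \<bar>\<theta>\<bar>"
    using assms by (auto simp: arccos_half_bounds)
  also have "\<dots> \<longleftrightarrow> \<bar>\<theta>\<bar> < arccos (\<rho> / 2)"
    using assms arccos_half_bounds[of \<rho>] by (intro cos_mono_less_eq) auto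
  finally show ?thesis .
qed

lemma dist_circ_arc:
  assumes "cmod \<zeta> = 1" "0 < \<rho>"
  shows "dist (circ_arc \<zeta> \<rho> u) \<zeta> = \<rho>"
proof -
  have "circ_arc \<zeta> \<rho> u - \<zeta> = - (\<zeta> * of_real \<rho> * cis ((2 * u - 1) * arccos (\<rho> / 2)))"
    by (simp add: circ_arc_def algebra_simps)
  then show ?thesis
    using assms by (simp add: dist_norm norm_mult)
qed

lemma circ_arc_in_ball:
  assumes "cmod \<zeta> = 1" "0 < \<rho>" "\<rho> \<le> 1" "0 < u" "u < 1"
  shows "circ_arc \<zeta> \<rho> u \<in> ball 0 1"
proof -
  have a: "\<bar>(2 * u - 1) * arccos (\<rho> / 2)\<bar> < arccos (\<rho> / 2)"
    using assms arccos_half_bounds[of \<rho>] by (auto simp: abs_mult)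
  then have "cmod (1 - of_real \<rho> * cis ((2 * u - 1) * arccos (\<rho> / 2))) < 1"
    using assms arccos_half_bounds[of \<rho>] by (subst norm_one_minus_cis_less_iff) auto
  then show ?thesis
    using assms by (simp add: circ_arc_def norm_mult)
qed

lemma norm_circ_arc_ends:
  assumes "cmod \<zeta> = 1" "0 < \<rho>" "\<rho> \<le> 1"
  shows "cmod (circ_arc \<zeta> \<rho> 0) = 1" "cmod (circ_arc \<zeta> \<rho> 1) = 1"
proof -
  have "(cmod (1 - of_real \<rho> * cis (t * arccos (\<rho> / 2))))\<^sup>2 = 1" if "t = 1 \<or> t = -1" for t
    unfolding norm_one_minus_cis using that assms arccos_half_bounds[of \<rho>] by (auto simp: power2_eq_square)
  then have "cmod (1 - of_real \<rho> * cis (t * arccos (\<rho> / 2))) = 1" if "t = 1 \<or> t = -1" for t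
    using that power2_eq_imp_eq[of _ "1::real"] by simp
  from this[of 1] this[of "-1"] show "cmod (circ_arc \<zeta> \<rho> 0) = 1" "cmod (circ_arc \<zeta> \<rho> 1) = 1"
    using assms by (simp_all add: circ_arc_def norm_mult)
qed

lemma circ_arc_half: "circ_arc \<zeta> \<rho> (1/2) = of_real (1 - \<rho>) * \<zeta>"
  by (simp add: circ_arc_def)

lemma continuous_on_circ_arc: "continuous_on S (circ_arc \<zeta> \<rho>)"
  unfolding circ_arc_def by (intro continuous_intros)

text \<open>Lets a set that crosses the circle be caught on the arc, where the map is under control.
  The parameter is read off from the argument of 1 - z / \<zeta>.\<close>

lemma circ_arc_cover:
  assumes "cmod \<zeta> = 1" "0 < \<rho>" "\<rho> \<le> 1" "z \<in> ball 0 1" "dist z \<zeta> = \<rho>"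
  obtains u where "0 < u" "u < 1" "z = circ_arc \<zeta> \<rho> u"
proof -
  define w where "w = 1 - z / \<zeta>"
  have z: "z = \<zeta> * (1 - w)"
    using assms by (auto simp: w_def field_simps)
  then have "z - \<zeta> = - (\<zeta> * w)"
    by (simp add: algebra_simps)
  with assms have cw: "cmod w = \<rho>"
    by (simp add: dist_norm norm_mult)
  then have w: "w = of_real \<rho> * cis (Arg w)"
    using Arg_eq[of w] assms by (auto simp: cis_conv_exp)
  define \<alpha> where "\<alpha> = arccos (\<rho> / 2)"
  have \<alpha>: "\<alpha> > 0"
    using assms arccos_half_bounds[of \<rho>] by (simp add: \<alpha>_def)
  have "cmod (1 - w) < 1"
    using assms z by (simp add: norm_mult)
  then have "\<bar>Arg w\<bar> < \<alpha>"
    using norm_one_minus_cis_less_iff[of \<rho> "Arg w"] w assms mpi_less_Arg[of w] Arg_le_pi[of w] by (auto simp: \<alpha>_def)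
  then have "- \<alpha> < Arg w" "Arg w < \<alpha>"
    by auto
  show ?thesis
  proof
    show "0 < (Arg w / \<alpha> + 1) / 2" "(Arg w / \<alpha> + 1) / 2 < 1"
      using \<open>- \<alpha> < Arg w\<close> \<open>Arg w < \<alpha>\<close> \<alpha> by (simp_all add: field_simps)
    show "z = circ_arc \<zeta> \<rho> ((Arg w / \<alpha> + 1) / 2)"
    proof -
      have "(2 * ((Arg w / \<alpha> + 1) / 2) - 1) * \<alpha> = Arg w"
        using \<alpha> by (simp add: field_simps)
      then show ?thesis
        unfolding circ_arc_def \<alpha>_def[symmetric] using z w by metis
    qed
  qed
qed

text \<open>All angles on the arc lie strictly between -pi/2 and pi/2, where the sine already
  determines them.\<close>

lemma inj_on_circ_arc:
  assumes "cmod \<zeta> = 1" "0 < \<rho>" "\<rho> \<le> 1"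
  shows "inj_on (circ_arc \<zeta> \<rho>) {0<..<1}"
proof (rule inj_onI)
  fix u v :: real assume uv: "u \<in> {0<..<1}" "v \<in> {0<..<1}" "circ_arc \<zeta> \<rho> u = circ_arc \<zeta> \<rho> v"
  define \<alpha> where "\<alpha> = arccos (\<rho> / 2)"
  have \<alpha>: "\<alpha> > 0" "\<alpha> < pi / 2"
    using assms arccos_half_bounds[of \<rho>] by (simp_all add: \<alpha>_def)
  have b: "\<bar>(2 * x - 1) * \<alpha>\<bar> < pi / 2" if "x \<in> {0<..<1}" for x
  proof -
    have "\<bar>(2 * x - 1) * \<alpha>\<bar> = \<bar>2 * x - 1\<bar> * \<alpha>"
      using \<alpha> by (simp add: abs_mult)
    also have "\<dots> \<le> 1 * \<alpha>"
      using that \<alpha> by (intro mult_right_mono) auto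
    finally show ?thesis
      using \<alpha> by simp
  qed
  have "cis ((2 * u - 1) * \<alpha>) = cis ((2 * v - 1) * \<alpha>)"
    using uv(3) assms by (auto simp: circ_arc_def \<alpha>_def)
  then have "sin ((2 * u - 1) * \<alpha>) = sin ((2 * v - 1) * \<alpha>)"
    by (metis cis.simps(2))
  then have "(2 * u - 1) * \<alpha> = (2 * v - 1) * \<alpha>"
    using b[OF uv(1)] b[OF uv(2)] by (intro sin_inj_pi[of "(2 * u - 1) * \<alpha>"]) auto
  then show "u = v"
    using \<alpha> by auto
qed

text \<open>The half disc near the boundary point, in the logarithmic coordinate
  \<open>z = \<zeta> * (1 - exp w)\<close>, in which circular arcs around \<open>\<zeta>\<close> are vertical segments.\<close>

definition log_strip :: "real \<Rightarrow> real \<Rightarrow> complex set" where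
  "log_strip a b = {w. a < Re w \<and> Re w < b \<and> \<bar>Im w\<bar> < pi / 2 \<and> cmod (1 - exp w) < 1}"

lemma open_log_strip: "open (log_strip a b)"
  unfolding log_strip_def by (intro open_Collect_conj open_Collect_less continuous_intros)

lemma exp_Complex: "exp (Complex s \<theta>) = of_real (exp s) * cis \<theta>"
  by (simp add: exp_eq_polar)

lemma Complex_in_log_strip_iff:
  assumes "b \<le> 0"
  shows "Complex s \<theta> \<in> log_strip a b \<longleftrightarrow> a < s \<and> s < b \<and> \<bar>\<theta>\<bar> < arccos (exp s / 2)"
proof (cases "s < b")
  case True
  then have s: "0 < exp s" "exp s \<le> 1"
    using assms by auto
  have "cmod (1 - exp (Complex s \<theta>)) < 1 \<longleftrightarrow> \<bar>\<theta>\<bar> < arccos (exp s / 2)" if "\<bar>\<theta>\<bar> \<le> pi"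
    unfolding exp_Complex using norm_one_minus_cis_less_iff[OF s that] .
  then show ?thesis
    using arccos_half_bounds[OF s] unfolding log_strip_def by auto
qed (auto simp: log_strip_def)

lemma convex_log_strip_slice:
  assumes "b \<le> 0"
  shows "convex {\<theta>. Complex s \<theta> \<in> log_strip a b}"
proof (cases "a < s \<and> s < b")
  case True
  then have "{\<theta>. Complex s \<theta> \<in> log_strip a b} = {- arccos (exp s / 2)<..<arccos (exp s / 2)}"
    using Complex_in_log_strip_iff[OF assms] by auto
  then show ?thesis
    by simp
qed (auto simp: Complex_in_log_strip_iff[OF assms])

lemma emeasure_log_strip_le:
  assumes "a \<le> b"
  shows "emeasure lborel (log_strip a b) \<le> ennreal ((b - a) * pi)"
proof -
  have "log_strip a b \<subseteq> box (Complex a (- (pi / 2))) (Complex b (pi / 2))"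
    by (auto simp: log_strip_def in_box_complex_iff)
  then have "emeasure lborel (log_strip a b) \<le> emeasure lborel (box (Complex a (- (pi / 2))) (Complex b (pi / 2)))"
    by (intro emeasure_mono) auto
  also have "\<dots> = ennreal ((b - a) * pi)"
    using assms by (auto simp: emeasure_lborel_box_eq Basis_complex_def)
  finally show ?thesis .
qed

text \<open>Since the derivative is integrable, its indefinite integral is continuous up to both
  ends, and it differs from \<open>h\<close> by a constant, which is fixed at the midpoint. This
  supplies the end points of image arcs from their finite length alone.\<close>

lemma finite_length_extension:
  fixes h h' :: "real \<Rightarrow> complex"
  assumes "a < b" and der: "\<And>x S. x \<in> {a<..<b} \<Longrightarrow> (h has_vector_derivative h' x) (at x within S)"
    and cont: "continuous_on {a<..<b} h'"
    and len: "(\<integral>\<^sup>+x. indicator {a<..<b} x * ennreal (norm (h' x)) \<partial>lborel) < ennreal e"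
  shows "\<exists>g. continuous_on {a..b} g \<and> (\<forall>x\<in>{a<..<b}. g x = h x) \<and>
    (\<forall>x\<in>{a<..<b}. \<forall>y\<in>{a<..<b}. dist (h x) (h y) < e)"
proof -
  have d: "dist (h x) (h y) < e" if xy: "x \<in> {a<..<b}" "y \<in> {a<..<b}" "x \<le> y" for x y
  proof -
    have "ennreal (norm (h y - h x)) \<le> (\<integral>\<^sup>+t. indicator {x<..<y} t * ennreal (norm (h' t)) \<partial>lborel)"
      using xy by (intro norm_diff_le_nn_integral der continuous_on_subset[OF cont]) auto
    also have "\<dots> \<le> (\<integral>\<^sup>+t. indicator {a<..<b} t * ennreal (norm (h' t)) \<partial>lborel)"
      using xy by (intro nn_integral_mono) (auto simp: indicator_def)
    also note len
    finally show ?thesis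
      by (simp add: dist_norm norm_minus_commute ennreal_less_iff)
  qed
  have m: "(\<lambda>x. indicator {a<..<b} x *\<^sub>R h' x) \<in> borel_measurable borel"
    using cont by (intro borel_measurable_continuous_on_indicator) auto
  have "integrable lborel (\<lambda>x. indicator {a<..<b} x *\<^sub>R h' x)"
  proof (rule integrableI_bounded)
    have "(\<integral>\<^sup>+x. ennreal (norm (indicator {a<..<b} x *\<^sub>R h' x)) \<partial>lborel) = 
      (\<integral>\<^sup>+x. indicator {a<..<b} x * ennreal (norm (h' x)) \<partial>lborel)"
      by (intro nn_integral_cong) (auto simp: indicator_def)
    also have "\<dots> < \<infinity>"
      using len by (rule order.strict_trans) simp
    finally show "(\<integral>\<^sup>+x. ennreal (norm (indicator {a<..<b} x *\<^sub>R h' x)) \<partial>lborel) < \<infinity>" .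
  qed (use m in simp)
  then have "(\<lambda>x. indicator {a<..<b} x *\<^sub>R h' x) integrable_on UNIV"
    by (rule integrable_on_lborel)
  also have "(\<lambda>x. indicator {a<..<b} x *\<^sub>R h' x) = (\<lambda>x. if x \<in> {a<..<b} then h' x else 0)"
    by (auto simp: indicator_def)
  finally have "h' integrable_on {a<..<b}"
    by (simp only: integrable_restrict_UNIV)
  then have int: "h' integrable_on {a..b}"
    by (simp add: integrable_on_Icc_iff_Ioo)
  define c where "c = (a + b) / 2"
  have c: "c \<in> {a<..<b}"
    using assms(1) by (simp add: c_def)
  define J where "J x = integral {a..x} h'" for x
  have J: "J y - J x = h y - h x" if xy: "x \<in> {a<..<b}" "y \<in> {a<..<b}" "x \<le> y" for x y
  proof -
    have "J x + integral {x..y} h' = J y"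
      unfolding J_def using xy by (intro Henstock_Kurzweil_Integration.integral_combine integrable_on_subinterval[OF int]) auto
    moreover have "(h' has_integral (h y - h x)) {x..y}"
      using xy by (intro fundamental_theorem_of_calculus der) auto
    ultimately show ?thesis
      by (auto simp: integral_unique algebra_simps)
  qed
  have "continuous_on {a..b} (\<lambda>x. J x + (h c - J c))"
    unfolding J_def by (intro continuous_intros indefinite_integral_continuous_1 int)
  moreover have "J x + (h c - J c) = h x" if "x \<in> {a<..<b}" for x
    using J[OF that c] J[OF c that] by (cases "x \<le> c") (auto simp: algebra_simps)
  moreover have "dist (h x) (h y) < e" if "x \<in> {a<..<b}" "y \<in> {a<..<b}" for x y
    using d[of x y] d[of y x] that by (cases "x \<le> y") (auto simp: dist_commute)
  ultimately show ?thesis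
    by (intro exI[of _ "\<lambda>x. J x + (h c - J c)"]) simp
qed

text \<open>The images decrease to the empty set: by injectivity a common value would have a single
  preimage arbitrarily close to \<zeta>, yet \<zeta> is outside the disc. Boundedness makes the
  areas finite, so they tend to 0.\<close>

lemma emeasure_image_shrinking:
  fixes f :: "complex \<Rightarrow> complex"
  assumes hol: "f holomorphic_on ball 0 1" and inj: "inj_on f (ball 0 1)" and bdd: "bounded (f ` ball 0 1)"
    and \<zeta>: "cmod \<zeta> = 1" and "c > 0"
  shows "\<exists>t>0. emeasure lborel (f ` (ball 0 1 \<inter> ball \<zeta> t)) < ennreal c"
proof -
  define A where "A n = f ` (ball 0 1 \<inter> ball \<zeta> (1 / real (Suc n)))" for n
  have openA: "open (A n)" for n
    unfolding A_def using hol inj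
    by (intro open_mapping_thm3) (auto intro: holomorphic_on_subset inj_on_subset)
  have Asub: "A n \<subseteq> f ` ball 0 1" for n
    by (auto simp: A_def)
  have "(\<lambda>n. emeasure lborel (A n)) \<longlonglongrightarrow> emeasure lborel (\<Inter>n. A n)"
  proof (rule Lim_emeasure_decseq)
    show "decseq A"
      unfolding decseq_def A_def by (intro allI impI image_mono Int_mono subset_ball order_refl) (auto simp: field_simps)
    show "emeasure lborel (A n) \<noteq> \<infinity>" for n
      using emeasure_bounded_finite[OF bounded_subset[OF bdd Asub]] by (auto simp: top.not_eq_extremum)
  qed (use openA in auto)
  moreover have "(\<Inter>n. A n) = {}"
  proof -
    have False if y: "\<And>n. y \<in> A n" for y
    proof -
      obtain z where z: "z \<in> ball 0 1" "y = f z"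
        using y[of 0] by (auto simp: A_def)
      then have "z \<in> ball \<zeta> (1 / real (Suc n))" for n
      proof -
        obtain x where x: "x \<in> ball 0 1" "x \<in> ball \<zeta> (1 / real (Suc n))" "y = f x"
          using y[of n] by (auto simp: A_def)
        then have "x = z"
          using z inj by (auto dest: inj_onD)
        with x show ?thesis
          by simp
      qed
      moreover have "dist \<zeta> z > 0"
        using z \<zeta> by auto
      then obtain n where "1 / real (Suc n) < dist \<zeta> z"
        using nat_approx_posE by blast
      ultimately show False
        by (metis less_asym mem_ball)
    qed
    then show ?thesis
      by blast
  qed
  ultimately have "(\<lambda>n. emeasure lborel (A n)) \<longlonglongrightarrow> 0"
    by simp
  then have "\<forall>\<^sub>F n in sequentially. emeasure lborel (A n) < ennreal c"
    using \<open>c > 0\<close> by (intro order_tendstoD) auto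
  then obtain n where "emeasure lborel (A n) < ennreal c"
    by (auto simp: eventually_sequentially)
  then show ?thesis
    unfolding A_def by (intro exI[of _ "1 / real (Suc n)"]) auto
qed

text \<open>Bloch's theorem bounds the derivative by the area of the image of a disc.\<close>

lemma radial_oscillation:
  fixes f :: "complex \<Rightarrow> complex"
  assumes hol: "f holomorphic_on ball 0 1" and inj: "inj_on f (ball 0 1)" and \<zeta>: "cmod \<zeta> = 1" and "e > 0"
    and r: "0 < r" "r < 1"
    and small: "emeasure lborel (f ` (ball 0 1 \<inter> ball \<zeta> (2 * r))) < ennreal ((e / 13)\<^sup>2)"
    and \<rho>: "r / 2 \<le> \<rho>" "\<rho> \<le> r"
  shows "dist (f (of_real (1 - \<rho>) * \<zeta>)) (f (of_real (1 - r) * \<zeta>)) < e"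
proof -
  define p where "p t = of_real (1 - t) * \<zeta>" for t :: real
  have "p t - \<zeta> = - (of_real t * \<zeta>)" for t
    by (simp add: p_def algebra_simps)
  then have pd: "dist (p t) \<zeta> = \<bar>t\<bar>" "cmod (p t) = \<bar>1 - t\<bar>" for t
    using \<zeta> by (simp_all add: dist_norm norm_mult p_def del: of_real_diff)
  \<comment> \<open>The disc of radius \<open>t\<close> about \<open>p t\<close> lies in the unit
    disc and within \<open>2 * r\<close> of \<zeta>. Bloch's theorem puts a disc of radius t |f'| /
    12 into its image, and the area hypothesis makes this radius less than \<open>e / 13\<close>; as
    \<open>t\<close> is at least \<open>r / 2\<close>, the bound follows. Over a segment of length
    at most \<open>r / 2\<close> it adds up to \<open>12 / 13 * e\<close>, which leaves room for a
    strict inequality.\<close>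
  have bnd: "norm (deriv f z) \<le> 24 / 13 * e / r" if zin: "z \<in> closed_segment (p r) (p \<rho>)" for z
  proof -
    obtain u where u: "0 \<le> u" "u \<le> 1" "z = (1 - u) *\<^sub>R p r + u *\<^sub>R p \<rho>"
      using zin unfolding closed_segment_def by blast
    define t where "t = (1 - u) * r + u * \<rho>"
    have z: "z = p t"
    proof -
      have "of_real (1 - t) = (1 - of_real u) * of_real (1 - r) + of_real u * (of_real (1 - \<rho>) :: complex)"
        by (simp add: t_def ring_distribs)
      then show ?thesis
        unfolding u(3) p_def by (simp add: scaleR_conv_of_real distrib_right)
    qed
    have t1: "r / 2 \<le> t" "t \<le> r"
    proof -
      have "t - r / 2 = (1 - u) * (r / 2) + u * (\<rho> - r / 2)" "r - t = u * (r - \<rho>)"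
        by (simp_all add: t_def field_simps)
      moreover have "0 \<le> (1 - u) * (r / 2)" "0 \<le> u * (\<rho> - r / 2)" "0 \<le> u * (r - \<rho>)"
        using u \<rho> r by (auto intro!: mult_nonneg_nonneg)
      ultimately show "r / 2 \<le> t" "t \<le> r"
        by linarith+
    qed
    have sub: "ball (p t) t \<subseteq> ball 0 1 \<inter> ball \<zeta> (2 * r)"
    proof
      fix x assume x: "x \<in> ball (p t) t"
      have "cmod x \<le> cmod (p t) + dist (p t) x"
        by (metis dist_0_norm dist_triangle)
      moreover have "dist \<zeta> x \<le> dist (p t) \<zeta> + dist (p t) x"
        by (metis dist_commute dist_triangle)
      ultimately show "x \<in> ball 0 1 \<inter> ball \<zeta> (2 * r)"
        using x t1 r pd[of t] by auto
    qed
    have ball: "f holomorphic_on ball (p t) t" and "0 < t"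
      using hol sub t1 r by (auto intro: holomorphic_on_subset)
    obtain b where b: "ball b (t * norm (deriv f (p t)) / 12) \<subseteq> f ` ball (p t) t"
      by (rule Bloch[OF ball \<open>0 < t\<close> order_refl])
    define R where "R = t * norm (deriv f (p t)) / 12"
    have R0: "0 \<le> R"
      using \<open>0 < t\<close> by (simp add: R_def)
    have "ennreal (R\<^sup>2) \<le> emeasure lborel (ball b R)"
      by (rule emeasure_lborel_ball_ge[OF R0])
    also have "\<dots> \<le> emeasure lborel (f ` (ball 0 1 \<inter> ball \<zeta> (2 * r)))"
    proof (rule emeasure_mono)
      show "ball b R \<subseteq> f ` (ball 0 1 \<inter> ball \<zeta> (2 * r))"
        using b sub by (force simp: R_def)
      show "f ` (ball 0 1 \<inter> ball \<zeta> (2 * r)) \<in> sets lborel"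
        unfolding sets_lborel using hol inj
        by (intro borel_open open_mapping_thm3) (auto intro: holomorphic_on_subset inj_on_subset)
    qed
    also note small
    finally have "R\<^sup>2 < (e / 13)\<^sup>2"
      by (simp add: ennreal_less_iff)
    then have "R < e / 13"
      using \<open>e > 0\<close> by (intro power2_less_imp_less[of R]) auto
    then have "t * norm (deriv f z) < 12 / 13 * e"
      by (simp add: R_def z)
    moreover have "r / 2 * norm (deriv f z) \<le> t * norm (deriv f z)"
      using t1 by (intro mult_right_mono) auto
    ultimately show ?thesis
      using r by (simp add: field_simps)
  qed
  have seg: "closed_segment (p r) (p \<rho>) \<subseteq> ball 0 1"
    using pd(2)[of r] pd(2)[of \<rho>] r \<rho> by (intro closed_segment_subset) auto
  have "norm (f (p \<rho>) - f (p r)) \<le> 24 / 13 * e / r * norm (p \<rho> - p r)"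
  proof (rule field_differentiable_bound[where S = "closed_segment (p r) (p \<rho>)" and f' = "deriv f"])
    show "(f has_field_derivative deriv f z) (at z within closed_segment (p r) (p \<rho>))"
      if "z \<in> closed_segment (p r) (p \<rho>)" for z
      using that seg by (intro has_field_derivative_at_within[OF holomorphic_derivI[OF hol]]) auto
    show "norm (deriv f z) \<le> 24 / 13 * e / r" if "z \<in> closed_segment (p r) (p \<rho>)" for z
      using bnd[OF that] .
  qed auto
  also have "norm (p \<rho> - p r) = r - \<rho>"
  proof -
    have "p \<rho> - p r = of_real (r - \<rho>) * \<zeta>"
      by (simp add: p_def algebra_simps)
    then show ?thesis
      using \<zeta> \<rho> by (simp add: norm_mult del: of_real_diff)
  qed
  also have "24 / 13 * e / r * (r - \<rho>) \<le> 24 / 13 * e / r * (r / 2)"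
    using r \<rho> \<open>e > 0\<close> by (intro mult_left_mono) auto
  also have "\<dots> = 12 / 13 * e"
    using r by simp
  finally have "dist (f (p \<rho>)) (f (p r)) \<le> 12 / 13 * e"
    by (simp add: dist_norm)
  then show ?thesis
    using \<open>e > 0\<close> unfolding p_def by linarith
qed

text \<open>In the logarithmic coordinate the radii between \<open>r / 2\<close> and
  \<open>r\<close> fill an interval of length ln 2, whatever \<open>r\<close> is, so the mean length
  of the image arcs is small once the image near \<zeta> has small area. Almost every radius also
  avoids \<open>F\<close>, so some radius has both properties.\<close>

theorem arcs_with_small_image:
  fixes f :: "complex \<Rightarrow> complex"
  assumes hol: "f holomorphic_on ball 0 1" and inj: "inj_on f (ball 0 1)" and bdd: "bounded (f ` ball 0 1)"
    and \<zeta>: "cmod \<zeta> = 1" and e: "e > 0"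
  obtains \<delta> where "0 < \<delta>" "\<delta> \<le> 1"
    "\<And>r F. \<lbrakk>0 < r; r < \<delta>; finite F; F \<inter> f ` ball 0 1 = {}\<rbrakk> \<Longrightarrow>
      \<exists>\<rho> g. r / 2 \<le> \<rho> \<and> \<rho> \<le> r \<and> continuous_on {0..1} g \<and>
        (\<forall>u\<in>{0<..<1}. g u = f (circ_arc \<zeta> \<rho> u)) \<and>
        (\<forall>u\<in>{0<..<1}. \<forall>v\<in>{0<..<1}. dist (g u) (g v) < e) \<and>
        (\<forall>q\<in>F. \<exists>d>0. \<forall>u\<in>{0<..<1}. d \<le> dist (g u) q) \<and>
        dist (f (of_real (1 - \<rho>) * \<zeta>)) (f (of_real (1 - r) * \<zeta>)) < e"
proof -
  \<comment> \<open>The number 13 comes from \<open>radial_oscillation\<close>, where it has to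
    exceed the 12 in Bloch's theorem; the length estimate has ample room.\<close>
  define c where "c = (e / 13)\<^sup>2"
  have "c > 0"
    using e by (simp add: c_def)
  then obtain t where t: "t > 0" "emeasure lborel (f ` (ball 0 1 \<inter> ball \<zeta> t)) < ennreal c"
    using emeasure_image_shrinking[OF hol inj bdd \<zeta>] by blast
  \<comment> \<open>Half of \<open>t\<close>, because the radial estimate looks at the disc of
    radius \<open>2 * r\<close> about \<zeta>.\<close>
  define \<delta> where "\<delta> = min (t / 2) 1"
  have main: "\<exists>\<rho> g. r / 2 \<le> \<rho> \<and> \<rho> \<le> r \<and> continuous_on {0..1} g \<and>
        (\<forall>u\<in>{0<..<1}. g u = f (circ_arc \<zeta> \<rho> u)) \<and>
        (\<forall>u\<in>{0<..<1}. \<forall>v\<in>{0<..<1}. dist (g u) (g v) < e) \<and>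
        (\<forall>q\<in>F. \<exists>d>0. \<forall>u\<in>{0<..<1}. d \<le> dist (g u) q) \<and>
        dist (f (of_real (1 - \<rho>) * \<zeta>)) (f (of_real (1 - r) * \<zeta>)) < e"
    if r: "0 < r" "r < \<delta>" and F: "finite F" "F \<inter> f ` ball 0 1 = {}" for r F
  proof -
    have r1: "r < 1" "2 * r \<le> t"
      using r by (auto simp: \<delta>_def)
    have meas: "f ` (ball 0 1 \<inter> ball \<zeta> x) \<in> sets lborel" for x
      unfolding sets_lborel using hol inj
      by (intro borel_open open_mapping_thm3) (auto intro: holomorphic_on_subset inj_on_subset)
    have small: "emeasure lborel (f ` (ball 0 1 \<inter> ball \<zeta> x)) < ennreal c" if "x \<le> t" for x
    proof -
      have "emeasure lborel (f ` (ball 0 1 \<inter> ball \<zeta> x)) \<le> emeasure lborel (f ` (ball 0 1 \<inter> ball \<zeta> t))"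
        using that by (intro emeasure_mono meas image_mono Int_mono subset_ball order_refl)
      with t(2) show ?thesis
        by (rule order.strict_trans1[rotated])
    qed
    define a b where "a = ln (r / 2)" and "b = ln r"
    have ab: "a < b" "b \<le> 0" "b - a = ln 2"
      using r r1 by (auto simp: a_def b_def ln_div)
    define \<Omega> where "\<Omega> = log_strip a b"
    define \<Psi> where "\<Psi> w = \<zeta> * (1 - exp w)" for w
    define G where "G = f \<circ> \<Psi>"
    have op: "open \<Omega>"
      by (simp add: \<Omega>_def open_log_strip)
    have \<Psi>_sub: "\<Psi> w \<in> ball 0 1 \<inter> ball \<zeta> r" if "w \<in> \<Omega>" for w
    proof -
      have "dist \<zeta> (\<Psi> w) = cmod (\<zeta> * exp w)"
        by (simp add: dist_norm \<Psi>_def algebra_simps)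
      also have "\<dots> = exp (Re w)"
        using \<zeta> by (simp add: norm_mult)
      also have "\<dots> < exp b"
        using that by (simp add: \<Omega>_def log_strip_def)
      finally show ?thesis
        using that \<zeta> r by (auto simp: \<Omega>_def log_strip_def \<Psi>_def norm_mult b_def)
    qed
    have hG: "G holomorphic_on \<Omega>"
      unfolding G_def
    proof (rule holomorphic_on_compose)
      show "\<Psi> holomorphic_on \<Omega>"
        unfolding \<Psi>_def by (intro holomorphic_intros)
      show "f holomorphic_on \<Psi> ` \<Omega>"
        using hol by (rule holomorphic_on_subset) (use \<Psi>_sub in auto)
    qed
    \<comment> \<open>The strip has height at most pi, less than the period of
      \<open>exp\<close>.\<close>
    have iG: "inj_on G \<Omega>"
    proof (rule inj_onI)
      fix w w' assume w: "w \<in> \<Omega>" "w' \<in> \<Omega>" "G w = G w'"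
      have "f (\<Psi> w) = f (\<Psi> w')"
        using w(3) by (simp add: G_def)
      then have "\<Psi> w = \<Psi> w'"
        using inj \<Psi>_sub[OF w(1)] \<Psi>_sub[OF w(2)] by (auto dest: inj_onD)
      then have "exp w = exp w'"
        using \<zeta> by (auto simp: \<Psi>_def)
      have "\<bar>Im w\<bar> < pi" "\<bar>Im w'\<bar> < pi"
        using w(1,2) pi_gt_zero by (auto simp: \<Omega>_def log_strip_def)
      then have "\<bar>Im w - Im w'\<bar> < 2 * pi"
        by linarith
      then show "w = w'"
        using \<open>exp w = exp w'\<close> by (rule exp_complex_eqI)
    qed
    have m\<Omega>: "emeasure lborel \<Omega> \<le> ennreal (ln 2 * pi)"
      using emeasure_log_strip_le[of a b] ab by (simp add: \<Omega>_def)
    have avoid: "AE s in lborel. s \<in> {a<..<b} \<longrightarrow> (\<exists>d>0. \<forall>\<theta>. Complex s \<theta> \<in> \<Omega> \<longrightarrow> d \<le> dist (G (Complex s \<theta>)) q)"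
      if "q \<in> F" for q
    proof -
      have q: "q \<notin> f ` ball 0 1"
        using F that by auto
      have rad: "\<Psi> (Complex s 0) \<in> ball 0 1" if "s \<in> {a..b}" for s
      proof -
        have "exp s \<le> r"
          using that r by (simp add: b_def ln_ge_iff)
        moreover have "\<Psi> (Complex s 0) = \<zeta> * of_real (1 - exp s)"
          by (simp add: \<Psi>_def exp_Complex)
        ultimately show ?thesis
          using \<zeta> r1 by (simp add: norm_mult abs_less_iff del: of_real_diff)
      qed
      \<comment> \<open>The image of a closed piece of the radius is compact and omits
        \<open>q\<close>; its distance from \<open>q\<close> is the constant required by
        \<open>AE_vertical_avoids\<close>.\<close>
      have "continuous_on {a..b} (\<lambda>s. f (\<Psi> (Complex s 0)))"
      proof (rule continuous_on_compose2[OF holomorphic_on_imp_continuous_on[OF hol]])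
        show "continuous_on {a..b} (\<lambda>s. \<Psi> (Complex s 0))"
          unfolding \<Psi>_def Complex_eq by (intro continuous_intros)
      qed (use rad in auto)
      then have "continuous_on {a..b} (\<lambda>s. dist (f (\<Psi> (Complex s 0))) q)"
        by (intro continuous_intros)
      then obtain s0 where s0: "s0 \<in> {a..b}" "\<And>s. s \<in> {a..b} \<Longrightarrow> dist (f (\<Psi> (Complex s0 0))) q \<le> dist (f (\<Psi> (Complex s 0))) q"
        using continuous_attains_inf[of "{a..b}" "\<lambda>s. dist (f (\<Psi> (Complex s 0))) q"] ab by auto
      show ?thesis
      proof (rule AE_vertical_avoids[OF op hG iG])
        show "q \<notin> G ` \<Omega>"
          using q \<Psi>_sub by (auto simp: G_def)
        show "emeasure lborel \<Omega> < \<infinity>"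
          using m\<Omega> by (rule order.strict_trans1) simp
        show "convex {\<theta>. Complex s \<theta> \<in> \<Omega>}" for s
          unfolding \<Omega>_def using ab by (intro convex_log_strip_slice)
        show "0 < dist (f (\<Psi> (Complex s0 0))) q"
          using q rad[OF s0(1)] by auto
        show "Complex s 0 \<in> \<Omega> \<and> dist (f (\<Psi> (Complex s0 0))) q \<le> dist (G (Complex s 0)) q" if "s \<in> {a<..<b}" for s
        proof -
          have "0 < exp s" "exp s \<le> 1"
            using that ab by auto
          then show ?thesis
            using that s0(2)[of s] ab arccos_half_bounds[of "exp s"]
            by (auto simp: \<Omega>_def Complex_in_log_strip_iff G_def)
        qed
      qed
    qed
    define L where "L s = (\<integral>\<^sup>+\<theta>. indicator \<Omega> (Complex s \<theta>) * ennreal (cmod (deriv G (Complex s \<theta>))) \<partial>lborel)" for s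
    have "(\<integral>\<^sup>+s. L s \<partial>lborel) \<le> ennreal (pi / e / 2) * emeasure lborel (G ` \<Omega>) + ennreal (1 / (2 * (pi / e))) * emeasure lborel \<Omega>"
      unfolding L_def using e by (intro length_area op hG iG) auto
    also have "\<dots> \<le> ennreal (pi / e / 2) * ennreal c + ennreal (1 / (2 * (pi / e))) * ennreal (ln 2 * pi)"
    proof (intro add_mono mult_left_mono m\<Omega>)
      have "emeasure lborel (G ` \<Omega>) \<le> emeasure lborel (f ` (ball 0 1 \<inter> ball \<zeta> r))"
        using \<Psi>_sub by (intro emeasure_mono meas) (auto simp: G_def)
      with small[of r] r1 r show "emeasure lborel (G ` \<Omega>) \<le> ennreal c"
        by (auto dest: order.strict_trans1)
    qed auto
    also have "\<dots> = ennreal (pi / e / 2 * c + 1 / (2 * (pi / e)) * (ln 2 * pi))"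
      using e \<open>c > 0\<close> by (simp flip: ennreal_mult ennreal_plus)
    \<comment> \<open>The weight pi / e was chosen so that the strip, of area at most pi ln 2,
      contributes e ln 2 / 2. The image then contributes at most pi e / 338, well below the
      remaining half.\<close>
    also have "\<dots> < ennreal (e * ln 2)"
    proof -
      have "pi < 4"
        using pi_less_4 .
      then have "pi * e < 4 * e"
        using e by simp
      moreover have "e * (2/3) \<le> e * ln 2"
        using e ln2_ge_two_thirds by (intro mult_left_mono) auto
      moreover have "pi / e / 2 * c + 1 / (2 * (pi / e)) * (ln 2 * pi) = pi * e / 338 + e * ln 2 / 2"
        unfolding c_def using e by (simp add: field_simps power2_eq_square)
      moreover have "4 * e / 338 < e * (2/3) / 2"
        using e by simp
      ultimately have "pi / e / 2 * c + 1 / (2 * (pi / e)) * (ln 2 * pi) < e * ln 2"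
        by linarith
      then show ?thesis
        using e by (intro ennreal_lessI) auto
    qed
    finally have L_less: "(\<integral>\<^sup>+s. L s \<partial>lborel) < ennreal (e * ln 2)" .
    have "AE s in lborel. \<forall>q\<in>F. s \<in> {a<..<b} \<longrightarrow> (\<exists>d>0. \<forall>\<theta>. Complex s \<theta> \<in> \<Omega> \<longrightarrow> d \<le> dist (G (Complex s \<theta>)) q)"
      using F avoid by (intro AE_finite_allI) auto
    then have AEF: "AE s in lborel. s \<in> {a<..<b} \<longrightarrow> (\<forall>q\<in>F. \<exists>d>0. \<forall>\<theta>. Complex s \<theta> \<in> \<Omega> \<longrightarrow> d \<le> dist (G (Complex s \<theta>)) q)"
      by eventually_elim blast
    \<comment> \<open>If every radius failed, almost all slices over an interval of length ln 2
      would have length at least \<open>e\<close>, against the bound just found.\<close>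
    have "\<exists>s\<in>{a<..<b}. L s < ennreal e \<and> (\<forall>q\<in>F. \<exists>d>0. \<forall>\<theta>. Complex s \<theta> \<in> \<Omega> \<longrightarrow> d \<le> dist (G (Complex s \<theta>)) q)"
    proof (rule ccontr)
      assume no: "\<not> ?thesis"
      have "ennreal (e * ln 2) = (\<integral>\<^sup>+s. ennreal e * indicator {a<..<b} s \<partial>lborel)"
        using ab e by (simp add: nn_integral_cmult_indicator ennreal_mult)
      also have "\<dots> \<le> (\<integral>\<^sup>+s. L s \<partial>lborel)"
      proof (rule nn_integral_mono_AE)
        show "AE s in lborel. ennreal e * indicator {a<..<b} s \<le> L s"
          using AEF
        proof (rule AE_mp, intro AE_I2 impI)
          fix s assume s: "s \<in> {a<..<b} \<longrightarrow> (\<forall>q\<in>F. \<exists>d>0. \<forall>\<theta>. Complex s \<theta> \<in> \<Omega> \<longrightarrow> d \<le> dist (G (Complex s \<theta>)) q)"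
          show "ennreal e * indicator {a<..<b} s \<le> L s"
          proof (cases "s \<in> {a<..<b}")
            case True
            with s no have "\<not> L s < ennreal e"
              by blast
            with True show ?thesis
              by simp
          qed simp
        qed
      qed
      finally show False
        using L_less by simp
    qed
    then obtain s where s: "s \<in> {a<..<b}" "L s < ennreal e"
      "\<And>q. q \<in> F \<Longrightarrow> \<exists>d>0. \<forall>\<theta>. Complex s \<theta> \<in> \<Omega> \<longrightarrow> d \<le> dist (G (Complex s \<theta>)) q"
      by blast
    define \<rho> where "\<rho> = exp s"
    have "exp a < \<rho>" "\<rho> < exp b"
      using s(1) by (auto simp: \<rho>_def)
    then have \<rho>: "r / 2 < \<rho>" "\<rho> < r"
      using r by (auto simp: a_def b_def)
    define \<alpha> where "\<alpha> = arccos (\<rho> / 2)"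
    have \<alpha>: "0 < \<alpha>"
      using arccos_half_bounds[of \<rho>] \<rho> r r1 by (simp add: \<alpha>_def)
    have in\<Omega>: "Complex s \<theta> \<in> \<Omega> \<longleftrightarrow> \<theta> \<in> {-\<alpha><..<\<alpha>}" for \<theta>
      using s(1) ab by (auto simp: \<Omega>_def Complex_in_log_strip_iff \<alpha>_def \<rho>_def)
    have len: "(\<integral>\<^sup>+\<theta>. indicator {-\<alpha><..<\<alpha>} \<theta> * ennreal (norm (\<i> * deriv G (Complex s \<theta>))) \<partial>lborel) < ennreal e"
    proof -
      have "(\<integral>\<^sup>+\<theta>. indicator {-\<alpha><..<\<alpha>} \<theta> * ennreal (norm (\<i> * deriv G (Complex s \<theta>))) \<partial>lborel) = L s"
        unfolding L_def by (intro nn_integral_cong) (simp add: indicator_def in\<Omega> norm_mult)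
      with s(2) show ?thesis
        by simp
    qed
    have \<alpha>\<alpha>: "-\<alpha> < \<alpha>"
      using \<alpha> by simp
    have der: "((\<lambda>\<theta>. G (Complex s \<theta>)) has_vector_derivative \<i> * deriv G (Complex s x)) (at x within S)"
      if "x \<in> {-\<alpha><..<\<alpha>}" for x S
      using that in\<Omega> by (intro has_vector_derivative_vertical[OF op hG]) auto
    have con: "continuous_on {-\<alpha><..<\<alpha>} (\<lambda>\<theta>. \<i> * deriv G (Complex s \<theta>))"
      using holomorphic_on_imp_continuous_on[OF holomorphic_deriv[OF hG op]] in\<Omega>
      by (intro continuous_intros continuous_on_vertical[of \<Omega>]) auto
    obtain g where g: "continuous_on {-\<alpha>..\<alpha>} g"
      "\<And>x. x \<in> {-\<alpha><..<\<alpha>} \<Longrightarrow> g x = G (Complex s x)"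
      "\<And>x y. x \<in> {-\<alpha><..<\<alpha>} \<Longrightarrow> y \<in> {-\<alpha><..<\<alpha>} \<Longrightarrow> dist (G (Complex s x)) (G (Complex s y)) < e"
      using finite_length_extension[OF \<alpha>\<alpha> der con len] by blast
    have par: "(2 * u - 1) * \<alpha> \<in> {-\<alpha><..<\<alpha>}" if "u \<in> {0<..<1}" for u
      using that \<alpha> by (auto simp: algebra_simps)
    have Garc: "G (Complex s ((2 * u - 1) * \<alpha>)) = f (circ_arc \<zeta> \<rho> u)" for u
      by (simp add: G_def \<Psi>_def exp_Complex circ_arc_def \<alpha>_def \<rho>_def)
    have 1: "continuous_on {0..1} (\<lambda>u. g ((2 * u - 1) * \<alpha>))"
    proof (rule continuous_on_compose2[OF g(1)])
      have "(2 * u - 1) * \<alpha> \<in> {-\<alpha>..\<alpha>}" if "u \<in> {0..1}" for u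
      proof -
        have "0 \<le> u * \<alpha>" "u * \<alpha> \<le> 1 * \<alpha>"
          using that \<alpha> by (auto intro: mult_right_mono)
        then show ?thesis
          by (simp add: algebra_simps)
      qed
      then show "(\<lambda>u. (2 * u - 1) * \<alpha>) ` {0..1} \<subseteq> {-\<alpha>..\<alpha>}"
        by blast
    qed (intro continuous_intros)
    have 2: "g ((2 * u - 1) * \<alpha>) = f (circ_arc \<zeta> \<rho> u)" if "u \<in> {0<..<1}" for u
      using g(2)[OF par[OF that]] Garc by simp
    have 3: "dist (g ((2 * u - 1) * \<alpha>)) (g ((2 * v - 1) * \<alpha>)) < e" if "u \<in> {0<..<1}" "v \<in> {0<..<1}" for u v
      using g(3)[OF par[OF that(1)] par[OF that(2)]] g(2)[OF par[OF that(1)]] g(2)[OF par[OF that(2)]] by simp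
    have 4: "\<exists>d>0. \<forall>u\<in>{0<..<1}. d \<le> dist (g ((2 * u - 1) * \<alpha>)) q" if qF: "q \<in> F" for q
    proof -
      obtain d where d: "d > 0" "\<And>\<theta>. Complex s \<theta> \<in> \<Omega> \<Longrightarrow> d \<le> dist (G (Complex s \<theta>)) q"
        using s(3)[OF qF] by blast
      have "d \<le> dist (g ((2 * u - 1) * \<alpha>)) q" if "u \<in> {0<..<1}" for u
        using g(2)[OF par[OF that]] d(2) par[OF that] in\<Omega> by simp
      with d(1) show ?thesis
        by blast
    qed
    have 5: "dist (f (of_real (1 - \<rho>) * \<zeta>)) (f (of_real (1 - r) * \<zeta>)) < e"
      using \<rho> r r1 e small[of "2 * r"] by (intro radial_oscillation hol inj \<zeta>) (auto simp: c_def)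
    show ?thesis
      by (rule exI[of _ \<rho>], rule exI[of _ "\<lambda>u. g ((2 * u - 1) * \<alpha>)"]) (use \<rho> 1 2 3 4 5 in \<open>simp del: of_real_diff\<close>)
  qed
  show ?thesis
    using main t(1) by (intro that[of \<delta>]) (auto simp: \<delta>_def)
qed

section \<open>Crossing circles, and the bounded model\<close>

lemma connected_dist_ivt:
  fixes a :: "'a::metric_space"
  assumes "connected S" "x \<in> S" "y \<in> S" "dist x a \<le> \<rho>" "\<rho> \<le> dist y a"
  obtains z where "z \<in> S" "dist z a = \<rho>"
proof -
  have "connected ((\<lambda>z. dist z a) ` S)"
    using assms(1) by (intro connected_continuous_image continuous_intros)
  then have "is_interval ((\<lambda>z. dist z a) ` S)"
    by (simp add: is_interval_connected_1)
  then have "\<rho> \<in> (\<lambda>z. dist z a) ` S"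
    by (rule mem_is_interval_1_I[of _ "dist x a" "dist y a"]) (use assms in auto)
  then show ?thesis
    using that by blast
qed

lemma curve_crosses_circle:
  fixes \<eta> :: "real \<Rightarrow> 'a::metric_space"
  assumes cont: "continuous_on {0..<1} \<eta>" and lim: "(\<eta> \<longlongrightarrow> \<zeta>) (at_left 1)"
    and t1: "0 \<le> t1" "t1 < 1" and \<rho>: "0 < \<rho>" "\<rho> < dist (\<eta> t1) \<zeta>"
  obtains t where "t1 < t" "t < 1" "dist (\<eta> t) \<zeta> = \<rho>"
proof -
  have "\<forall>\<^sub>F t in at_left 1. dist (\<eta> t) \<zeta> < \<rho>"
    using lim \<rho>(1) by (rule tendstoD)
  moreover have "\<forall>\<^sub>F t in at_left 1. t \<in> {t1<..<1}"
    using t1 by (intro eventually_at_left_real) auto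
  ultimately have "\<forall>\<^sub>F t in at_left 1. dist (\<eta> t) \<zeta> < \<rho> \<and> t \<in> {t1<..<1}"
    by eventually_elim auto
  then obtain t2 where t2: "dist (\<eta> t2) \<zeta> < \<rho>" "t1 < t2" "t2 < 1"
    using eventually_happens trivial_limit_at_left_real by fastforce
  have "connected (\<eta> ` {t1..t2})"
    using t1 t2 by (intro connected_continuous_image continuous_on_subset[OF cont]) auto
  then obtain t where t: "t \<in> {t1..t2}" "dist (\<eta> t) \<zeta> = \<rho>"
  proof (rule connected_dist_ivt)
    show "\<eta> t2 \<in> \<eta> ` {t1..t2}" "\<eta> t1 \<in> \<eta> ` {t1..t2}" "dist (\<eta> t2) \<zeta> \<le> \<rho>" "\<rho> \<le> dist (\<eta> t1) \<zeta>"
      using t2 \<rho> by auto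
  qed blast
  then have "t1 \<noteq> t"
    using \<rho> by auto
  with t(1) have "t1 < t" "t < 1"
    using t2 by auto
  then show ?thesis
    using t(2) that by blast
qed

text \<open>A branch of \<open>1 / (sqrt (\<phi> - a) + const)\<close> is bounded, and \<open>\<phi>\<close> is recovered from it by a
  rational map of the sphere, of degree two.\<close>

lemma bounded_model:
  fixes \<phi> :: "complex \<Rightarrow> complex"
  assumes hol: "\<phi> holomorphic_on ball 0 1" and inj: "inj_on \<phi> (ball 0 1)" and a: "a \<notin> \<phi> ` ball 0 1"
  obtains f R where "f holomorphic_on ball 0 1" "inj_on f (ball 0 1)" "bounded (f ` ball 0 1)"
    "continuous_on UNIV (\<lambda>w. stereo (R w))" "\<And>p. finite (R -` {p})" "\<And>z. z \<in> ball 0 1 \<Longrightarrow> R (f z) = Some (\<phi> z)"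
proof -
  have "(\<lambda>z. \<phi> z - a) holomorphic_on ball 0 1"
    by (intro holomorphic_intros hol)
  then obtain h where h: "h holomorphic_on ball 0 1" "\<And>z. z \<in> ball 0 1 \<Longrightarrow> \<phi> z - a = (h z)\<^sup>2"
    by (rule contractible_imp_holomorphic_sqrt[of _ "ball 0 1"]) (use a in \<open>auto simp: convex_imp_contractible\<close>)
  have injh: "inj_on h (ball 0 1)"
  proof (rule inj_onI)
    fix z w assume "z \<in> ball 0 1" "w \<in> ball 0 1" "h z = h w"
    then show "z = w"
      using h(2)[of z] h(2)[of w] inj_onD[OF inj, of z w] by (metis diff_add_cancel)
  qed
  have "open (h ` ball 0 1)"
    using h(1) injh by (intro open_mapping_thm3) auto
  \<comment> \<open>The image of \<open>h\<close> is disjoint from its negative, because h^2 =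
    \<phi> - a is injective and \<open>h\<close> has no zero. Hence -h avoids a disc about
    \<open>h 0\<close>, which keeps h + h 0 away from 0.\<close>
  then obtain d where d: "d > 0" "ball (h 0) d \<subseteq> h ` ball 0 1"
    using open_contains_ball[of "h ` ball 0 1"] by force
  have ge: "d \<le> cmod (h z + h 0)" if z: "z \<in> ball 0 1" for z
  proof (rule ccontr)
    assume "\<not> d \<le> cmod (h z + h 0)"
    then have "- h z \<in> ball (h 0) d"
      by (simp add: dist_norm add.commute)
    then obtain w where w: "w \<in> ball 0 1" "h w = - h z"
      using d(2) by force
    then have "\<phi> w = \<phi> z"
      using h(2)[OF z] h(2)[of w] by (metis diff_add_cancel power2_minus)
    then have "w = z"
      using w(1) z inj by (auto dest: inj_onD)
    then have "h z = 0"
      using w(2) by simp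
    then have "\<phi> z = a"
      using h(2)[OF z] by simp
    then show False
      using a z by blast
  qed
  then have nz: "h z + h 0 \<noteq> 0" if "z \<in> ball 0 1" for z
    using d(1) that by force
  define f where "f z = 1 / (h z + h 0)" for z
  \<comment> \<open>Solving f = 1 / (h + h 0) for \<open>h\<close> and squaring recovers \<phi>; the
    value 0, which \<open>f\<close> omits on the disc, is sent to infinity.\<close>
  define R where "R w = (if w = 0 then None else Some (a + (1 / w - h 0)\<^sup>2))" for w
  show ?thesis
  proof
    show "f holomorphic_on ball 0 1"
      unfolding f_def using nz by (intro holomorphic_intros h(1)) auto
    show "inj_on f (ball 0 1)"
    proof (rule inj_onI)
      fix z w assume "z \<in> ball 0 1" "w \<in> ball 0 1" "f z = f w"
      then show "z = w"
        using injh by (auto simp: f_def inj_on_def)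
    qed
    show "bounded (f ` ball 0 1)"
    proof (rule boundedI[of _ "1 / d"])
      fix x assume "x \<in> f ` ball 0 1"
      then obtain z where z: "z \<in> ball 0 1" "x = f z"
        by blast
      then show "norm x \<le> 1 / d"
        using ge[OF z(1)] d(1) by (simp add: f_def norm_divide frac_le)
    qed
    show "continuous_on UNIV (\<lambda>w. stereo (R w))"
      unfolding continuous_on_eq_continuous_at[OF open_UNIV]
    proof
      fix w :: complex
      show "isCont (\<lambda>w. stereo (R w)) w"
      proof (cases "w = 0")
        case False
        have "isCont (\<lambda>w. stereo (Some (a + (1 / w - h 0)\<^sup>2))) w"
          using False by (intro isCont_o2[OF _ continuous_on_stereo_Some[of UNIV, unfolded continuous_on_eq_continuous_at[OF open_UNIV], rule_format]] continuous_intros) auto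
        moreover have ev: "\<forall>\<^sub>F x in nhds w. stereo (R x) = stereo (Some (a + (1 / x - h 0)\<^sup>2))"
          using t1_space_nhds[OF False] by eventually_elim (simp add: R_def)
        ultimately show ?thesis
          by (simp only: isCont_cong[OF ev])
      next
        case True
        have "filterlim (\<lambda>w. 1 / w) at_infinity (at (0::complex))"
          using filterlim_inverse_at_infinity[where ?'a = complex] by (simp add: inverse_eq_divide[abs_def])
        then have 1: "filterlim (\<lambda>w. - h 0 + 1 / w) at_infinity (at (0::complex))"
          by (rule tendsto_add_filterlim_at_infinity[OF tendsto_const])
        have "filterlim (\<lambda>w. (- h 0 + 1 / w)\<^sup>2) at_infinity (at (0::complex))"
          unfolding power2_eq_square by (rule filterlim_at_infinity_times[OF 1 1])
        then have "filterlim (\<lambda>w. a + (- h 0 + 1 / w)\<^sup>2) at_infinity (at (0::complex))"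
          by (rule tendsto_add_filterlim_at_infinity[OF tendsto_const])
        then have "((\<lambda>w. stereo (Some (a + (- h 0 + 1 / w)\<^sup>2))) \<longlongrightarrow> stereo None) (at 0)"
          by (rule tendsto_stereo_infinity)
        moreover have "\<forall>\<^sub>F w in at 0. stereo (Some (a + (- h 0 + 1 / w)\<^sup>2)) = stereo (R w)"
          by (auto simp: eventually_at_filter R_def)
        ultimately have "((\<lambda>w. stereo (R w)) \<longlongrightarrow> stereo None) (at 0)"
          by (rule Lim_transform_eventually)
        then show ?thesis
          using True by (simp add: isCont_def R_def)
      qed
    qed
    show "finite (R -` {p})" for p
    proof (cases p)
      case None
      then have "R -` {p} \<subseteq> {0}"
        by (auto simp: R_def split: if_splits)
      then show ?thesis
        by (rule finite_subset) simp
    next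
      case (Some q)
      \<comment> \<open>A fibre over a finite point is given by a quadratic equation for 1 / w,
        hence the two candidates.\<close>
      have "R -` {p} \<subseteq> {1 / (h 0 + csqrt (q - a)), 1 / (h 0 - csqrt (q - a))}"
      proof
        fix w assume "w \<in> R -` {p}"
        then have w: "w \<noteq> 0" "(1 / w - h 0)\<^sup>2 = (csqrt (q - a))\<^sup>2"
          using Some unfolding power2_csqrt by (auto simp: R_def split: if_splits)
        then have "1 / w - h 0 = csqrt (q - a) \<or> 1 / w - h 0 = - csqrt (q - a)"
          unfolding power2_eq_iff by blast
        then have "1 / w = h 0 + csqrt (q - a) \<or> 1 / w = h 0 - csqrt (q - a)"
          by (auto simp: diff_eq_eq add.commute)
        moreover have "w = 1 / (1 / w)"
          by simp
        ultimately show "w \<in> {1 / (h 0 + csqrt (q - a)), 1 / (h 0 - csqrt (q - a))}"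
          by (metis insertCI)
      qed
      then show ?thesis
        by (rule finite_subset) simp
    qed
    show "R (f z) = Some (\<phi> z)" if "z \<in> ball 0 1" for z
      using nz[OF that] h(2)[OF that] by (simp add: R_def f_def) (metis add.commute diff_add_cancel)
  qed
qed

section \<open>Boundary behaviour of the Riemann map\<close>

locale riemann_mapping =
  fixes U :: "complex set" and \<phi> :: "complex \<Rightarrow> complex"
  assumes open_U: "open U" and conn_U: "connected U" and sc_U: "simply_connected U" and U_neq: "U \<noteq> UNIV"
    and riemann_map: "riemann_map \<phi> U"
begin

definition \<psi> :: "complex \<Rightarrow> complex" where "\<psi> = inv_into (ball 0 1) \<phi>"

text \<open>The Riemann map seen in the embedded sphere: boundary limits of \<phi>, the limit
  infinity included, are limits of \<Phi>.\<close>

definition \<Phi> :: "complex \<Rightarrow> complex \<times> real" where "\<Phi> z = stereo (Some (\<phi> z))"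

lemma hol: "\<phi> holomorphic_on ball 0 1"
  and inj: "inj_on \<phi> (ball 0 1)"
  and image: "\<phi> ` ball 0 1 = U"
  using riemann_map by (auto simp: riemann_map_def bij_betw_def)

lemma \<phi>_in_U: "z \<in> ball 0 1 \<Longrightarrow> \<phi> z \<in> U"
  using image by blast

lemma \<psi>_in_ball: "w \<in> U \<Longrightarrow> \<psi> w \<in> ball 0 1"
  unfolding \<psi>_def using image by (metis inv_into_into)

lemma \<phi>_\<psi>: "w \<in> U \<Longrightarrow> \<phi> (\<psi> w) = w"
  unfolding \<psi>_def using image by (metis f_inv_into_f)

lemma \<psi>_\<phi>: "z \<in> ball 0 1 \<Longrightarrow> \<psi> (\<phi> z) = z"
  unfolding \<psi>_def using inj by (rule inv_into_f_f)

lemma continuous_on_\<phi>: "continuous_on (ball 0 1) \<phi>"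
  using hol by (rule holomorphic_on_imp_continuous_on)

lemma continuous_on_\<psi>: "continuous_on U \<psi>"
proof -
  obtain g where g: "g holomorphic_on \<phi> ` ball 0 1" "\<And>z. z \<in> ball 0 1 \<Longrightarrow> g (\<phi> z) = z"
    using holomorphic_has_inverse[OF hol open_ball inj] by metis
  have "continuous_on U g"
    using g(1) image holomorphic_on_imp_continuous_on by auto
  moreover have "g w = \<psi> w" if "w \<in> U" for w
    using that g(2) image \<psi>_\<phi> by auto
  ultimately show ?thesis
    by (metis continuous_on_cong)
qed

lemma continuous_on_\<Phi>: "continuous_on (ball 0 1) \<Phi>"
  unfolding \<Phi>_def
  by (rule continuous_on_compose2[OF continuous_on_stereo_Some[of UNIV] continuous_on_\<phi>]) simp

text \<open>Carries \<open>arcs_with_small_image\<close> over from the bounded model. Smallness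
  passes through \<open>R\<close>, which is uniformly continuous on the compact closure of the
  image. Avoidance of \<open>F\<close> is asked for the whole preimage \<open>Q\<close> of
  \<open>F\<close> under \<open>R\<close>, which is again finite.\<close>

theorem good_arcs:
  assumes \<zeta>: "cmod \<zeta> = 1" and e: "e > 0"
  obtains \<delta> where "0 < \<delta>" "\<delta> \<le> 1"
    "\<And>r F. \<lbrakk>0 < r; r < \<delta>; finite F; F \<inter> Some ` U = {}\<rbrakk> \<Longrightarrow>
      \<exists>\<rho> g. r / 2 \<le> \<rho> \<and> \<rho> \<le> r \<and> continuous_on {0..1} (\<lambda>u. stereo (g u)) \<and>
        (\<forall>u\<in>{0<..<1}. g u = Some (\<phi> (circ_arc \<zeta> \<rho> u))) \<and>
        (\<forall>u\<in>{0<..<1}. \<forall>v\<in>{0<..<1}. dist (\<Phi> (circ_arc \<zeta> \<rho> u)) (\<Phi> (circ_arc \<zeta> \<rho> v)) < e) \<and>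
        (\<forall>p\<in>F. \<exists>d>0. \<forall>u\<in>{0<..<1}. d \<le> dist (\<Phi> (circ_arc \<zeta> \<rho> u)) (stereo p)) \<and>
        dist (\<Phi> (of_real (1 - \<rho>) * \<zeta>)) (\<Phi> (of_real (1 - r) * \<zeta>)) < e"
proof -
  obtain a where "a \<notin> \<phi> ` ball 0 1"
    using U_neq image by auto
  then obtain f R where f: "f holomorphic_on ball 0 1" "inj_on f (ball 0 1)" "bounded (f ` ball 0 1)"
    and R: "continuous_on UNIV (\<lambda>w. stereo (R w))" "\<And>p. finite (R -` {p})" "\<And>z. z \<in> ball 0 1 \<Longrightarrow> R (f z) = Some (\<phi> z)"
    using bounded_model[OF hol inj] by metis
  define K where "K = closure (f ` ball 0 1)"
  have K: "compact K" "\<And>z. z \<in> ball 0 1 \<Longrightarrow> f z \<in> K"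
    using f(3) closure_subset[of "f ` ball 0 1"] by (auto simp: K_def compact_closure)
  have \<Phi>R: "\<Phi> z = stereo (R (f z))" if "z \<in> ball 0 1" for z
    using R(3)[OF that] by (simp add: \<Phi>_def)
  have "uniformly_continuous_on K (\<lambda>w. stereo (R w))"
    using K(1) continuous_on_subset[OF R(1)] by (intro compact_uniformly_continuous) auto
  then obtain e' where e': "e' > 0" "\<And>x y. \<lbrakk>x \<in> K; y \<in> K; dist x y < e'\<rbrakk> \<Longrightarrow> dist (stereo (R x)) (stereo (R y)) < e"
    using e unfolding uniformly_continuous_on_def by metis
  obtain \<delta> where \<delta>: "0 < \<delta>" "\<delta> \<le> 1" and arcs:
    "\<And>r F. \<lbrakk>0 < r; r < \<delta>; finite F; F \<inter> f ` ball 0 1 = {}\<rbrakk> \<Longrightarrow>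
      \<exists>\<rho> g. r / 2 \<le> \<rho> \<and> \<rho> \<le> r \<and> continuous_on {0..1} g \<and>
        (\<forall>u\<in>{0<..<1}. g u = f (circ_arc \<zeta> \<rho> u)) \<and>
        (\<forall>u\<in>{0<..<1}. \<forall>v\<in>{0<..<1}. dist (g u) (g v) < e') \<and>
        (\<forall>q\<in>F. \<exists>d>0. \<forall>u\<in>{0<..<1}. d \<le> dist (g u) q) \<and>
        dist (f (of_real (1 - \<rho>) * \<zeta>)) (f (of_real (1 - r) * \<zeta>)) < e'"
    by (rule arcs_with_small_image[OF f \<zeta> e'(1)]) metis
  have main: "\<exists>\<rho> g. r / 2 \<le> \<rho> \<and> \<rho> \<le> r \<and> continuous_on {0..1} (\<lambda>u. stereo (g u)) \<and>
        (\<forall>u\<in>{0<..<1}. g u = Some (\<phi> (circ_arc \<zeta> \<rho> u))) \<and>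
        (\<forall>u\<in>{0<..<1}. \<forall>v\<in>{0<..<1}. dist (\<Phi> (circ_arc \<zeta> \<rho> u)) (\<Phi> (circ_arc \<zeta> \<rho> v)) < e) \<and>
        (\<forall>p\<in>F. \<exists>d>0. \<forall>u\<in>{0<..<1}. d \<le> dist (\<Phi> (circ_arc \<zeta> \<rho> u)) (stereo p)) \<and>
        dist (\<Phi> (of_real (1 - \<rho>) * \<zeta>)) (\<Phi> (of_real (1 - r) * \<zeta>)) < e"
    if r: "0 < r" "r < \<delta>" and F: "finite F" "F \<inter> Some ` U = {}" for r F
  proof -
    define Q where "Q = R -` F"
    have "Q = (\<Union>p\<in>F. R -` {p})"
      by (auto simp: Q_def)
    then have "finite Q"
      using F(1) R(2) by simp
    moreover have "Q \<inter> f ` ball 0 1 = {}"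
      using F(2) R(3) \<phi>_in_U by (fastforce simp: Q_def)
    ultimately obtain \<rho> g where g: "r / 2 \<le> \<rho>" "\<rho> \<le> r" "continuous_on {0..1} g"
        "\<And>u. u \<in> {0<..<1} \<Longrightarrow> g u = f (circ_arc \<zeta> \<rho> u)"
        "\<And>u v. u \<in> {0<..<1} \<Longrightarrow> v \<in> {0<..<1} \<Longrightarrow> dist (g u) (g v) < e'"
        "\<And>q. q \<in> Q \<Longrightarrow> \<exists>d>0. \<forall>u\<in>{0<..<1}. d \<le> dist (g u) q"
        "dist (f (of_real (1 - \<rho>) * \<zeta>)) (f (of_real (1 - r) * \<zeta>)) < e'"
      using arcs[OF r, of Q] by metis
    have \<rho>: "0 < \<rho>" "\<rho> \<le> 1"
      using g(1,2) r \<delta> by auto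
    have inb: "circ_arc \<zeta> \<rho> u \<in> ball 0 1" if "u \<in> {0<..<1}" for u
      using circ_arc_in_ball[OF \<zeta> \<rho>] that by simp
    have \<Phi>g: "\<Phi> (circ_arc \<zeta> \<rho> u) = stereo (R (g u))" "g u \<in> K" if "u \<in> {0<..<1}" for u
      using \<Phi>R[OF inb[OF that]] g(4)[OF that] K(2)[OF inb[OF that]] by auto
    have rad: "of_real (1 - x) * \<zeta> \<in> ball 0 1" if "0 < x" "x \<le> 1" for x
      using that \<zeta> by (simp add: norm_mult abs_less_iff del: of_real_diff)
    have 1: "continuous_on {0..1} (\<lambda>u. stereo (R (g u)))"
      by (rule continuous_on_compose2[OF R(1) g(3)]) simp
    have 2: "R (g u) = Some (\<phi> (circ_arc \<zeta> \<rho> u))" if "u \<in> {0<..<1}" for u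
      using R(3)[OF inb[OF that]] g(4)[OF that] by simp
    have 3: "dist (\<Phi> (circ_arc \<zeta> \<rho> u)) (\<Phi> (circ_arc \<zeta> \<rho> v)) < e" if "u \<in> {0<..<1}" "v \<in> {0<..<1}" for u v
      using \<Phi>g[OF that(1)] \<Phi>g[OF that(2)] e'(2) g(5)[OF that] by simp
    have 4: "\<exists>d>0. \<forall>u\<in>{0<..<1}. d \<le> dist (\<Phi> (circ_arc \<zeta> \<rho> u)) (stereo p)" if p: "p \<in> F" for p
    proof -
      obtain d where d: "\<And>q. q \<in> Q \<Longrightarrow> d q > 0 \<and> (\<forall>u\<in>{0<..<1}. d q \<le> dist (g u) q)"
        using g(6) by metis
      \<comment> \<open>\<open>L\<close> is a compact set that contains the arc and is disjoint from
        \<open>Q\<close>, so on it the distance of the \<open>R\<close>-image from \<open>p\<close>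
        attains a positive minimum.\<close>
      define L where "L = K \<inter> (\<Inter>q\<in>Q. {y. d q \<le> dist y q})"
      have "compact L"
        unfolding L_def using K(1)
        by (intro compact_Int_closed closed_INT ballI closed_Collect_le continuous_intros)
      moreover have gL: "g u \<in> L" if "u \<in> {0<..<1}" for u
        using \<Phi>g(2)[OF that] d that by (auto simp: L_def)
      then have "L \<noteq> {}"
        using gL[of "1/2"] by force
      moreover have "continuous_on L (\<lambda>y. dist (stereo (R y)) (stereo p))"
        by (intro continuous_intros continuous_on_subset[OF R(1)]) auto
      ultimately obtain y where y: "y \<in> L" "\<And>x. x \<in> L \<Longrightarrow> dist (stereo (R y)) (stereo p) \<le> dist (stereo (R x)) (stereo p)"
        using continuous_attains_inf[of L "\<lambda>y. dist (stereo (R y)) (stereo p)"] by blast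
      have "R y \<noteq> p"
      proof
        assume "R y = p"
        then have "y \<in> Q"
          using p by (simp add: Q_def)
        then have "d y \<le> 0" "d y > 0"
          using y(1) d[of y] by (auto simp: L_def)
        then show False
          by simp
      qed
      then show ?thesis
        using y(2) gL \<Phi>g(1) by (intro exI[of _ "dist (stereo (R y)) (stereo p)"]) auto
    qed
    have 5: "dist (\<Phi> (of_real (1 - \<rho>) * \<zeta>)) (\<Phi> (of_real (1 - r) * \<zeta>)) < e"
      using \<Phi>R[OF rad[of \<rho>]] \<Phi>R[OF rad[of r]] K(2)[OF rad[of \<rho>]] K(2)[OF rad[of r]] e'(2) g(7) \<rho> r \<delta> by simp
    show ?thesis
      by (rule exI[of _ \<rho>], rule exI[of _ "\<lambda>u. R (g u)"]) (use g(1,2) 1 2 3 4 5 in \<open>simp del: of_real_diff\<close>)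
  qed
  show ?thesis
    by (rule that[OF \<delta> main])
qed

text \<open>\<Phi> maps the closed disc of radius \<open>s\<close> onto a compact set that misses
  \<open>p\<close>, so values near \<open>p\<close> are taken only near the unit circle.\<close>

lemma escape:
  assumes p: "p \<notin> Some ` U" and s: "s < 1"
  shows "\<exists>d>0. \<forall>z\<in>ball 0 1. dist (\<Phi> z) (stereo p) < d \<longrightarrow> s < cmod z"
proof -
  have sub: "cball 0 s \<subseteq> ball (0::complex) 1"
    using s by auto
  have "compact (\<Phi> ` cball 0 s)"
    by (intro compact_continuous_image continuous_on_subset[OF continuous_on_\<Phi> sub]) auto
  moreover have "stereo p \<notin> \<Phi> ` cball 0 s"
    using p sub \<phi>_in_U by (auto simp: \<Phi>_def)
  ultimately obtain d where d: "d > 0" "\<And>y. y \<in> \<Phi> ` cball 0 s \<Longrightarrow> d \<le> dist (stereo p) y"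
    using separate_point_closed[OF compact_imp_closed] by metis
  have "s < cmod z" if "dist (\<Phi> z) (stereo p) < d" for z
    using d(2)[of "\<Phi> z"] that by (force simp: dist_commute)
  with d(1) show ?thesis
    by blast
qed

text \<open>At a limit in \<open>U\<close> the inverse map is continuous and would force the points
  \<open>z x\<close> to converge to a point of the open disc.\<close>

lemma limit_not_in_U:
  assumes F: "F \<noteq> bot" and z: "\<forall>\<^sub>F x in F. z x \<in> ball 0 1" and c: "((\<lambda>x. cmod (z x)) \<longlongrightarrow> 1) F"
    and l: "((\<lambda>x. \<Phi> (z x)) \<longlongrightarrow> stereo p) F"
  shows "p \<notin> Some ` U"
proof
  assume "p \<in> Some ` U"
  then obtain w where w: "p = Some w" "w \<in> U"
    by blast
  then have lw: "((\<lambda>x. \<phi> (z x)) \<longlongrightarrow> w) F"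
    using l by (simp add: \<Phi>_def tendsto_stereo_Some_iff)
  have "isCont \<psi> w"
    using continuous_on_\<psi> open_U w(2) by (simp add: continuous_on_eq_continuous_at)
  from isCont_tendsto_compose[OF this lw] have "((\<lambda>x. \<psi> (\<phi> (z x))) \<longlongrightarrow> \<psi> w) F" .
  moreover have "\<forall>\<^sub>F x in F. \<psi> (\<phi> (z x)) = z x"
    using z by eventually_elim (simp add: \<psi>_\<phi>)
  ultimately have "(z \<longlongrightarrow> \<psi> w) F"
    by (rule Lim_transform_eventually)
  then have "((\<lambda>x. cmod (z x)) \<longlongrightarrow> cmod (\<psi> w)) F"
    by (rule tendsto_norm)
  then have "cmod (\<psi> w) = 1"
    using c F tendsto_unique by blast
  then show False
    using \<psi>_in_ball[OF w(2)] by simp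
qed

lemma limit_in_sphere_boundary:
  assumes F: "F \<noteq> bot" and z: "\<forall>\<^sub>F x in F. z x \<in> ball 0 1" and c: "((\<lambda>x. cmod (z x)) \<longlongrightarrow> 1) F"
    and l: "((\<lambda>x. \<Phi> (z x)) \<longlongrightarrow> stereo p) F"
  shows "p \<in> sphere_boundary U"
proof -
  have "\<forall>\<^sub>F x in F. \<Phi> (z x) \<in> stereo ` Some ` U"
    using z by eventually_elim (use \<phi>_in_U in \<open>auto simp: \<Phi>_def\<close>)
  then have "\<forall>\<^sub>F x in F. \<Phi> (z x) \<in> closure (stereo ` Some ` U)"
    by (rule eventually_mono) (rule subsetD[OF closure_subset])
  then have "stereo p \<in> closure (stereo ` Some ` U)"
    by (rule Lim_in_closed_set[OF closed_closure _ F l])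
  then show ?thesis
    using limit_not_in_U[OF assms] by (simp add: sphere_boundary_iff[OF open_U])
qed

lemma sphere_boundary_not_in_U: "p \<in> sphere_boundary U \<Longrightarrow> p \<notin> Some ` U"
  by (simp add: sphere_boundary_iff[OF open_U])

text \<open>Otherwise two points of \<open>S n\<close> would tend along a subsequence to distinct
  limits \<open>a\<close> and \<open>b\<close>, with \<open>a\<close> on the circle by
  \<open>escape\<close>. Take an arc around \<open>a\<close> of radius below |a - b| whose image
  keeps a positive distance from \<open>p\<close>. The connected sets \<open>S n\<close> have to
  cross it, which contradicts the approach of their images to \<open>p\<close>.\<close>

theorem koebe:
  fixes S :: "nat \<Rightarrow> complex set"
  assumes conn: "\<And>n. connected (S n)" and sub: "\<And>n. S n \<subseteq> ball 0 1" and p: "p \<notin> Some ` U"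
    and lim: "\<And>d. d > 0 \<Longrightarrow> \<forall>\<^sub>F n in sequentially. \<forall>z\<in>S n. dist (\<Phi> z) (stereo p) < d"
    and e: "e > 0"
  shows "\<forall>\<^sub>F n in sequentially. \<forall>z\<in>S n. \<forall>w\<in>S n. dist z w < e"
proof (rule ccontr)
  assume "\<not> ?thesis"
  from not_eventually_sequentiallyD[OF this]
  obtain r :: "nat \<Rightarrow> nat" where r: "strict_mono r" "\<And>n. \<not> (\<forall>z\<in>S (r n). \<forall>w\<in>S (r n). dist z w < e)"
    by blast
  then have "\<exists>z w. z \<in> S (r n) \<and> w \<in> S (r n) \<and> e \<le> dist z w" for n
    by (meson not_less)
  then obtain z w where zw: "\<And>n. z n \<in> S (r n)" "\<And>n. w n \<in> S (r n)" "\<And>n. e \<le> dist (z n) (w n)"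
    by metis
  have limr: "\<forall>\<^sub>F n in sequentially. \<forall>z\<in>S (r n). dist (\<Phi> z) (stereo p) < d" if "d > 0" for d
    using eventually_subseq[OF r(1) lim[OF that]] .
  have zb: "z n \<in> ball 0 1" "w n \<in> ball 0 1" for n
    using zw sub by blast+
  \<comment> \<open>Pairs are used so that one subsequence serves both points.\<close>
  have "norm (z n, w n) \<le> 2" for n
    using norm_Pair_le[of "z n" "w n"] zb[of n] by simp
  then have "bounded (range (\<lambda>n. (z n, w n)))"
    by (auto intro: boundedI)
  then obtain l s where s: "strict_mono s" "((\<lambda>n. (z n, w n)) \<circ> s) \<longlonglongrightarrow> l"
    using bounded_imp_convergent_subsequence by blast
  obtain a b where l: "l = (a, b)"
    by (cases l)
  have za: "(\<lambda>n. z (s n)) \<longlonglongrightarrow> a" and wb: "(\<lambda>n. w (s n)) \<longlonglongrightarrow> b"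
    using tendsto_fst[OF s(2)] tendsto_snd[OF s(2)] by (auto simp: l o_def)
  have lims: "\<forall>\<^sub>F n in sequentially. \<forall>z\<in>S (r (s n)). dist (\<Phi> z) (stereo p) < d" if "d > 0" for d
    using eventually_subseq[OF s(1) limr[OF that]] .
  have "e \<le> dist a b"
    by (rule tendsto_lowerbound[OF tendsto_dist[OF za wb]]) (use zw in auto)
  have "cmod a = 1"
  proof (rule antisym)
    show "cmod a \<le> 1"
      by (rule tendsto_upperbound[OF tendsto_norm[OF za]]) (use zb in \<open>auto intro!: always_eventually less_imp_le\<close>)
    show "1 \<le> cmod a"
    proof (rule field_le_epsilon)
      fix x :: real assume "x > 0"
      then obtain d where d: "d > 0" "\<forall>z\<in>ball 0 1. dist (\<Phi> z) (stereo p) < d \<longrightarrow> 1 - x < cmod z"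
        using escape[OF p, of "1 - x"] by auto
      have "\<forall>\<^sub>F n in sequentially. 1 - x \<le> cmod (z (s n))"
        using lims[OF d(1)] by eventually_elim (use d(2) zw(1) zb(1) less_imp_le in metis)
      then have "1 - x \<le> cmod a"
        by (rule tendsto_lowerbound[OF tendsto_norm[OF za]]) auto
      then show "1 \<le> cmod a + x"
        by simp
    qed
  qed
  obtain \<delta> where \<delta>: "0 < \<delta>" "\<delta> \<le> 1" and arcs:
    "\<And>r F. \<lbrakk>0 < r; r < \<delta>; finite F; F \<inter> Some ` U = {}\<rbrakk> \<Longrightarrow>
      \<exists>\<rho> g. r / 2 \<le> \<rho> \<and> \<rho> \<le> r \<and> continuous_on {0..1} (\<lambda>u. stereo (g u)) \<and>
        (\<forall>u\<in>{0<..<1}. g u = Some (\<phi> (circ_arc a \<rho> u))) \<and>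
        (\<forall>u\<in>{0<..<1}. \<forall>v\<in>{0<..<1}. dist (\<Phi> (circ_arc a \<rho> u)) (\<Phi> (circ_arc a \<rho> v)) < 1) \<and>
        (\<forall>p\<in>F. \<exists>d>0. \<forall>u\<in>{0<..<1}. d \<le> dist (\<Phi> (circ_arc a \<rho> u)) (stereo p)) \<and>
        dist (\<Phi> (of_real (1 - \<rho>) * a)) (\<Phi> (of_real (1 - r) * a)) < 1"
    by (rule good_arcs[OF \<open>cmod a = 1\<close> zero_less_one]) metis
  \<comment> \<open>Below \<open>e\<close>, hence below the distance of the two limits: for large
    \<open>n\<close> one point is inside the circle and the other outside.\<close>
  define r0 where "r0 = min \<delta> e / 2"
  have r0: "0 < r0" "r0 < \<delta>" "r0 < e"
    using \<delta> e by (auto simp: r0_def)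
  obtain \<rho> d where \<rho>: "r0 / 2 \<le> \<rho>" "\<rho> \<le> r0" and d: "d > 0" "\<And>u. u \<in> {0<..<1} \<Longrightarrow> d \<le> dist (\<Phi> (circ_arc a \<rho> u)) (stereo p)"
    using arcs[OF r0(1,2), of "{p}"] p by auto
  have \<rho>': "0 < \<rho>" "\<rho> \<le> 1" "\<rho> < dist a b"
    using \<rho> r0 \<delta> \<open>e \<le> dist a b\<close> by auto
  have "\<forall>\<^sub>F n in sequentially. dist (z (s n)) a < \<rho>"
    using za \<rho>'(1) by (rule tendstoD)
  moreover have "\<forall>\<^sub>F n in sequentially. \<rho> < dist (w (s n)) a"
    using tendsto_dist[OF wb tendsto_const[of a]] \<rho>'(3) by (intro order_tendstoD(1)) (auto simp: dist_commute)
  ultimately have "\<forall>\<^sub>F n in sequentially. False"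
    using lims[OF d(1)]
  proof eventually_elim
    case (elim n)
    obtain x where x: "x \<in> S (r (s n))" "dist x a = \<rho>"
      using connected_dist_ivt[OF conn zw(1) zw(2), of "s n" a \<rho>] elim by auto
    then obtain u where "0 < u" "u < 1" "x = circ_arc a \<rho> u"
      using circ_arc_cover[OF \<open>cmod a = 1\<close> \<rho>'(1,2)] sub by blast
    then have "d \<le> dist (\<Phi> x) (stereo p)"
      using d(2)[of u] by simp
    with elim x(1) show False
      by force
  qed
  then show False
    by simp
qed

text \<open>The tails of the curve are connected sets on which \<Phi> tends to \<open>v\<close>, so
  by \<open>koebe\<close> their diameters tend to 0, which is the Cauchy criterion.
  \<open>escape\<close> then places the limit on the unit circle.\<close>

theorem curve_lands:
  fixes \<eta> :: "real \<Rightarrow> complex"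
  assumes cont: "continuous_on {0..<1} \<eta>" and sub: "\<eta> ` {0..<1} \<subseteq> ball 0 1"
    and lim: "((\<lambda>t. \<Phi> (\<eta> t)) \<longlongrightarrow> stereo v) (at_left 1)" and v: "v \<notin> Some ` U"
  obtains \<zeta> where "cmod \<zeta> = 1" "(\<eta> \<longlongrightarrow> \<zeta>) (at_left 1)"
proof -
  have inb: "\<eta> t \<in> ball 0 1" if "0 \<le> t" "t < 1" for t
    using sub that unfolding image_subset_iff by simp
  define S where "S n = \<eta> ` {1 - 1 / real (n + 2)..<1}" for n
  have idx: "1 - 1 / real (n + 2) \<in> {0..<1}" for n
    by (auto simp: field_simps)
  have mono: "1 - 1 / real (n + 2) \<le> 1 - 1 / real (m + 2)" if "n \<le> m" for n m
    using that by (auto intro!: divide_left_mono)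
  have conn: "connected (S n)" for n
    unfolding S_def using idx[of n] by (intro connected_continuous_image continuous_on_subset[OF cont]) auto
  have Ssub: "S n \<subseteq> ball 0 1" for n
  proof -
    have "0 \<le> 1 - 1 / real (n + 2)"
      using idx[of n] by simp
    then show ?thesis
      unfolding S_def by (meson atLeastLessThan_iff image_subsetI inb order_trans)
  qed
  have ev: "\<forall>\<^sub>F n in sequentially. \<forall>z\<in>S n. P z" if evP: "\<forall>\<^sub>F t in at_left 1. P (\<eta> t)" for P
  proof -
    have "\<exists>b<1. \<forall>t. b < t \<and> t < 1 \<longrightarrow> P (\<eta> t)"
      using evP unfolding eventually_at_left[OF zero_less_one] by blast
    then obtain b where b: "b < 1" "\<forall>t. b < t \<and> t < 1 \<longrightarrow> P (\<eta> t)"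
      by blast
    have "(\<lambda>n. 1 - 1 / real (n + 2)) \<longlonglongrightarrow> 1 - 0"
      by (intro tendsto_diff tendsto_const LIMSEQ_ignore_initial_segment[OF lim_1_over_n])
    then have "\<forall>\<^sub>F n in sequentially. b < 1 - 1 / real (n + 2)"
      using b(1) by (intro order_tendstoD(1)) auto
    then show ?thesis
    proof eventually_elim
      case (elim n)
      then show ?case
        using b(2) unfolding S_def by force
    qed
  qed
  have small: "\<forall>\<^sub>F n in sequentially. \<forall>z\<in>S n. \<forall>w\<in>S n. dist z w < e" if "e > 0" for e
  proof (rule koebe[OF conn Ssub v _ that])
    show "\<forall>\<^sub>F n in sequentially. \<forall>z\<in>S n. dist (\<Phi> z) (stereo v) < d" if "d > 0" for d
      using tendstoD[OF lim that] by (rule ev)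
  qed
  define x where "x n = \<eta> (1 - 1 / real (n + 2))" for n
  have xS: "x m \<in> S n" if "n \<le> m" for n m
    unfolding x_def S_def using mono[OF that] idx[of m] by (intro imageI) auto
  have "Cauchy x"
    unfolding Cauchy_def
  proof (intro allI impI)
    fix e :: real assume "e > 0"
    then obtain N where "\<forall>z\<in>S N. \<forall>w\<in>S N. dist z w < e"
      using small unfolding eventually_sequentially by blast
    then show "\<exists>M. \<forall>m\<ge>M. \<forall>n\<ge>M. dist (x m) (x n) < e"
      using xS by blast
  qed
  then obtain \<zeta> where \<zeta>: "x \<longlonglongrightarrow> \<zeta>"
    using Cauchy_convergent convergent_def by blast
  have lim\<eta>: "(\<eta> \<longlongrightarrow> \<zeta>) (at_left 1)"
  proof (rule tendstoI)
    fix e :: real assume "e > 0"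
    then have "\<forall>\<^sub>F n in sequentially. dist (x n) \<zeta> < e / 2"
      by (intro tendstoD[OF \<zeta>]) auto
    moreover have "\<forall>\<^sub>F n in sequentially. \<forall>z\<in>S n. \<forall>w\<in>S n. dist z w < e / 2"
      using \<open>e > 0\<close> by (intro small) auto
    ultimately obtain n where n: "dist (x n) \<zeta> < e / 2" "\<forall>z\<in>S n. \<forall>w\<in>S n. dist z w < e / 2"
      using eventually_happens[OF eventually_conj] sequentially_bot by blast
    have "\<forall>\<^sub>F t in at_left 1. t \<in> {1 - 1 / real (n + 2)<..<1}"
      using idx[of n] by (intro eventually_at_left_real) auto
    then show "\<forall>\<^sub>F t in at_left 1. dist (\<eta> t) \<zeta> < e"
    proof eventually_elim
      case (elim t)
      then have "\<eta> t \<in> S n"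
        by (auto simp: S_def)
      then have "dist (\<eta> t) (x n) < e / 2"
        using n(2) xS[of n n] by auto
      with n(1) show ?case
        using dist_triangle_half_r[of "x n" "\<eta> t" e \<zeta>] by (simp add: dist_commute)
    qed
  qed
  have "cmod \<zeta> = 1"
  proof (rule antisym)
    have in01: "\<forall>\<^sub>F t in at_left 1. t \<in> {0<..<1::real}"
      by (intro eventually_at_left_real) auto
    then have "\<forall>\<^sub>F t in at_left 1. cmod (\<eta> t) \<le> 1"
      by eventually_elim (use inb in \<open>simp add: less_imp_le\<close>)
    then show "cmod \<zeta> \<le> 1"
      by (rule tendsto_upperbound[OF tendsto_norm[OF lim\<eta>]]) auto
    show "1 \<le> cmod \<zeta>"
    proof (rule field_le_epsilon)
      fix s :: real assume "s > 0"
      then obtain d where d: "d > 0" "\<forall>z\<in>ball 0 1. dist (\<Phi> z) (stereo v) < d \<longrightarrow> 1 - s < cmod z"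
        using escape[OF v, of "1 - s"] by auto
      have "\<forall>\<^sub>F t in at_left 1. 1 - s \<le> cmod (\<eta> t)"
        using tendstoD[OF lim d(1)] in01
      proof eventually_elim
        case (elim t)
        then have "\<eta> t \<in> ball 0 1"
          by (intro inb) auto
        with elim d(2) show ?case
          by (auto intro: less_imp_le)
      qed
      then have "1 - s \<le> cmod \<zeta>"
        by (rule tendsto_lowerbound[OF tendsto_norm[OF lim\<eta>]]) auto
      then show "1 \<le> cmod \<zeta> + s"
        by simp
    qed
  qed
  with lim\<eta> that show ?thesis
    by blast
qed

text \<open>For every small \<open>r\<close> the curve crosses the arc chosen for \<open>r\<close>,
  and this arc contains the radial point at its own distance \<rho> from \<zeta>. Three steps of
  size e/3 lead from the radial point at distance \<open>r\<close> to the one at distance \<rho>,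
  along the arc to the curve, and from there to \<open>w\<close>. As \<open>r\<close> runs through
  all small numbers, the limit along the whole radius results.\<close>

theorem lindelof:
  fixes \<eta> :: "real \<Rightarrow> complex"
  assumes cont: "continuous_on {0..<1} \<eta>" and sub: "\<eta> ` {0..<1} \<subseteq> ball 0 1"
    and \<zeta>: "cmod \<zeta> = 1" "(\<eta> \<longlongrightarrow> \<zeta>) (at_left 1)"
    and lim: "((\<lambda>t. \<Phi> (\<eta> t)) \<longlongrightarrow> stereo w) (at_left 1)"
  shows "((\<lambda>t. \<Phi> (of_real t * \<zeta>)) \<longlongrightarrow> stereo w) (at_left 1)"
proof (rule tendstoI)
  have inb: "\<eta> t \<in> ball 0 1" if "0 \<le> t" "t < 1" for t
    using sub that unfolding image_subset_iff by simp
  fix e :: real assume "e > 0"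
  then have e3: "e / 3 > 0"
    by simp
  obtain \<delta> where \<delta>: "0 < \<delta>" "\<delta> \<le> 1" and arcs:
    "\<And>r F. \<lbrakk>0 < r; r < \<delta>; finite F; F \<inter> Some ` U = {}\<rbrakk> \<Longrightarrow>
      \<exists>\<rho> g. r / 2 \<le> \<rho> \<and> \<rho> \<le> r \<and> continuous_on {0..1} (\<lambda>u. stereo (g u)) \<and>
        (\<forall>u\<in>{0<..<1}. g u = Some (\<phi> (circ_arc \<zeta> \<rho> u))) \<and>
        (\<forall>u\<in>{0<..<1}. \<forall>v\<in>{0<..<1}. dist (\<Phi> (circ_arc \<zeta> \<rho> u)) (\<Phi> (circ_arc \<zeta> \<rho> v)) < e / 3) \<and>
        (\<forall>p\<in>F. \<exists>d>0. \<forall>u\<in>{0<..<1}. d \<le> dist (\<Phi> (circ_arc \<zeta> \<rho> u)) (stereo p)) \<and>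
        dist (\<Phi> (of_real (1 - \<rho>) * \<zeta>)) (\<Phi> (of_real (1 - r) * \<zeta>)) < e / 3"
    by (rule good_arcs[OF \<zeta>(1) e3]) metis
  obtain b where b: "b < 1" "\<And>t. b < t \<Longrightarrow> t < 1 \<Longrightarrow> dist (\<Phi> (\<eta> t)) (stereo w) < e / 3"
    using tendstoD[OF lim e3] unfolding eventually_at_left[OF zero_less_one] by blast
  define t1 where "t1 = max 0 b"
  have t1: "0 \<le> t1" "t1 < 1"
    using b(1) by (auto simp: t1_def)
  then have "\<eta> t1 \<in> ball 0 1"
    by (intro inb)
  then have d1: "dist (\<eta> t1) \<zeta> > 0"
    using \<zeta>(1) by auto
  have main: "dist (\<Phi> (of_real (1 - r) * \<zeta>)) (stereo w) < e" if r: "0 < r" "r < min \<delta> (dist (\<eta> t1) \<zeta>)" for r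
  proof -
    obtain \<rho> where \<rho>: "r / 2 \<le> \<rho>" "\<rho> \<le> r"
      and diam: "\<And>u v. u \<in> {0<..<1} \<Longrightarrow> v \<in> {0<..<1} \<Longrightarrow> dist (\<Phi> (circ_arc \<zeta> \<rho> u)) (\<Phi> (circ_arc \<zeta> \<rho> v)) < e / 3"
      and rad: "dist (\<Phi> (of_real (1 - \<rho>) * \<zeta>)) (\<Phi> (of_real (1 - r) * \<zeta>)) < e / 3"
      using arcs[of r "{}"] r by auto
    have \<rho>': "0 < \<rho>" "\<rho> \<le> 1" "\<rho> < dist (\<eta> t1) \<zeta>"
      using \<rho> r \<delta> by auto
    obtain t where t: "t1 < t" "t < 1" "dist (\<eta> t) \<zeta> = \<rho>"
      using curve_crosses_circle[OF cont \<zeta>(2) t1 \<rho>'(1,3)] .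
    have "\<eta> t \<in> ball 0 1"
      using t t1 by (intro inb) auto
    then obtain u where u: "0 < u" "u < 1" "\<eta> t = circ_arc \<zeta> \<rho> u"
      using circ_arc_cover[OF \<zeta>(1) \<rho>'(1,2) _ t(3)] by blast
    have "dist (\<Phi> (of_real (1 - \<rho>) * \<zeta>)) (\<Phi> (\<eta> t)) < e / 3"
      using diam[of "1/2" u] u unfolding circ_arc_half by simp
    moreover have "dist (\<Phi> (\<eta> t)) (stereo w) < e / 3"
      using b(2)[of t] t by (simp add: t1_def)
    ultimately show ?thesis
      using rad dist_triangle[of "\<Phi> (of_real (1 - r) * \<zeta>)" "stereo w" "\<Phi> (\<eta> t)"]
        dist_triangle[of "\<Phi> (of_real (1 - r) * \<zeta>)" "\<Phi> (\<eta> t)" "\<Phi> (of_real (1 - \<rho>) * \<zeta>)"]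
      by (simp add: dist_commute)
  qed
  have "\<forall>\<^sub>F t in at_left 1. t \<in> {1 - min \<delta> (dist (\<eta> t1) \<zeta>)<..<1}"
    using \<delta> d1 by (intro eventually_at_left_real) auto
  then show "\<forall>\<^sub>F t in at_left 1. dist (\<Phi> (of_real t * \<zeta>)) (stereo w) < e"
  proof eventually_elim
    case (elim t)
    then have "0 < 1 - t" "1 - t < min \<delta> (dist (\<eta> t1) \<zeta>)"
      by auto
    from main[OF this] show ?case
      by simp
  qed
qed

end

section \<open>Homotopies near the landing point\<close>

text \<open>The hypothesis speaks of points outside \<open>V\<close>. A point in another component
  \<open>W'\<close> is connected, within the closure of \<open>W'\<close>, to a frontier point of
  \<open>W'\<close>. The loop does not meet this closure, and the frontier point is outside
  \<open>V\<close>.\<close>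

lemma simply_connected_component:
  fixes V :: "complex set"
  assumes V: "open V" and W: "W \<in> components V"
    and wn: "\<And>p z. \<lbrakk>path p; path_image p \<subseteq> V; pathfinish p = pathstart p; z \<notin> V\<rbrakk> \<Longrightarrow> winding_number p z = 0"
  shows "simply_connected W"
proof -
  have "open W" "connected W" "W \<subseteq> V"
    using W V open_components in_components_connected in_components_subset by blast+
  have "winding_number p z = 0" if p: "path p" "path_image p \<subseteq> W" "pathfinish p = pathstart p" and z: "z \<notin> W" for p z
  proof (cases "z \<in> V")
    case False
    then show ?thesis
      using wn[OF p(1) _ p(3)] p(2) \<open>W \<subseteq> V\<close> by blast
  next
    case True
    define W' where "W' = connected_component_set V z"
    have W': "W' \<in> components V" "z \<in> W'"
      using True by (auto simp: W'_def components_def)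
    then have disj: "W' \<inter> W = {}"
      using components_nonoverlap[OF W'(1) W] z by blast
    have "W' \<noteq> UNIV"
      using disj p(2) path_image_nonempty[of p] by blast
    then have "frontier W' \<noteq> {}"
      using W'(2) frontier_eq_empty by blast
    then obtain b where b: "b \<in> frontier W'"
      by blast
    have "b \<in> frontier V"
      using frontier_of_components_subset[OF W'(1)] b by blast
    then have "b \<notin> V"
      using V by (simp add: frontier_def interior_open)
    then have "winding_number p b = 0"
      using wn[OF p(1) _ p(3)] p(2) \<open>W \<subseteq> V\<close> by blast
    moreover have "winding_number p z = winding_number p b"
    proof (rule winding_number_eq[OF p(1,3)])
      show "z \<in> closure W'" "b \<in> closure W'"
        using W'(2) b closure_subset by (auto simp: frontier_def)
      show "connected (closure W')"
        using W'(1) in_components_connected connected_imp_connected_closure by blast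
      have "W \<inter> closure W' = {}"
        using open_Int_closure_eq_empty[OF \<open>open W\<close>] disj by blast
      then show "closure W' \<inter> path_image p = {}"
        using p(2) by blast
    qed
    ultimately show ?thesis
      by simp
  qed
  then show ?thesis
    using \<open>connected W\<close> by (simp add: simply_connected_eq_winding_number_zero[OF \<open>open W\<close>])
qed

text \<open>A nonempty simply connected open subset of the plane is homeomorphic to the plane, so
  values prescribed on the closed union of the four edges extend over the square by Tietze's
  theorem.\<close>

lemma fill_square:
  fixes W :: "complex set" and a b :: real
  assumes W: "open W" "simply_connected W" and ab: "a < b"
    and l: "continuous_on {0..1} l" "l ` {0..1} \<subseteq> W" and r: "continuous_on {0..1} r" "r ` {0..1} \<subseteq> W"
    and bt: "continuous_on {a..b} bt" "bt ` {a..b} \<subseteq> W" and tp: "continuous_on {a..b} tp" "tp ` {a..b} \<subseteq> W"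
    and corners: "l 0 = bt a" "l 1 = tp a" "r 0 = bt b" "r 1 = tp b"
  obtains F where "continuous_on ({0..1::real} \<times> {a..b}) F" "F ` ({0..1} \<times> {a..b}) \<subseteq> W"
    "\<And>s. s \<in> {0..1} \<Longrightarrow> F (s, a) = l s" "\<And>s. s \<in> {0..1} \<Longrightarrow> F (s, b) = r s"
    "\<And>t. t \<in> {a..b} \<Longrightarrow> F (0, t) = bt t" "\<And>t. t \<in> {a..b} \<Longrightarrow> F (1, t) = tp t"
proof -
  have "W \<noteq> {}"
    using l(2) by force
  then have "W homeomorphic ball (0::complex) 1"
    using W simply_connected_eq_homeomorphic_to_disc by blast
  then have "W homeomorphic (UNIV :: complex set)"
    using homeomorphic_ball_UNIV[of 1 "0::complex"] homeomorphic_trans by force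
  then obtain h k where hk: "homeomorphism W (UNIV :: complex set) h k"
    by (auto simp: homeomorphic_def)
  define f where "f = (\<lambda>x. if snd x = a then l (fst x) else if snd x = b then r (fst x) else if fst x = 0 then bt (snd x) else tp (snd x))"
  define K1 K2 K3 K4 where "K1 = {0..1::real} \<times> {a}" and "K2 = {0..1::real} \<times> {b}"
    and "K3 = {0::real} \<times> {a..b}" and "K4 = {1::real} \<times> {a..b}"
  define K where "K = K1 \<union> (K2 \<union> (K3 \<union> K4))"
  have closed: "closed K1" "closed K2" "closed K3" "closed K4"
    by (simp_all add: K1_def K2_def K3_def K4_def closed_Times)
  have c1: "continuous_on K1 (\<lambda>x. l (fst x))" and c2: "continuous_on K2 (\<lambda>x. r (fst x))"
    and c3: "continuous_on K3 (\<lambda>x. bt (snd x))" and c4: "continuous_on K4 (\<lambda>x. tp (snd x))"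
    by (rule continuous_on_compose2[OF l(1)] continuous_on_compose2[OF r(1)] continuous_on_compose2[OF bt(1)] continuous_on_compose2[OF tp(1)];
        force simp: K1_def K2_def K3_def K4_def intro: continuous_intros)+
  have c34: "continuous_on (K3 \<union> K4) (\<lambda>x. if fst x = 0 then bt (snd x) else tp (snd x))"
    by (rule continuous_on_If[OF closed(3,4) c3 c4]) (auto simp: K3_def K4_def)
  have c234: "continuous_on (K2 \<union> (K3 \<union> K4)) (\<lambda>x. if snd x = b then r (fst x) else if fst x = 0 then bt (snd x) else tp (snd x))"
    by (rule continuous_on_If[OF closed(2) closed_Un[OF closed(3,4)] c2 c34])
       (use ab corners in \<open>auto simp: K2_def K3_def K4_def\<close>)
  have cf: "continuous_on K f"
    unfolding f_def K_def
    by (rule continuous_on_If[OF closed(1) closed_Un[OF closed(2) closed_Un[OF closed(3,4)]] c1 c234])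
       (use ab corners in \<open>auto simp: K1_def K2_def K3_def K4_def\<close>)
  have edges: "f (s, a) = l s" "f (s, b) = r s" for s
    using ab by (auto simp: f_def)
  have edges': "f (0, t) = bt t" "f (1, t) = tp t" for t
    using corners by (auto simp: f_def)
  have fW: "f x \<in> W" if "x \<in> K" for x
    using that edges edges' l(2) r(2) bt(2) tp(2)
    by (auto simp: K_def K1_def K2_def K3_def K4_def)
  have "continuous_on K (h \<circ> f)"
    using cf fW hk by (intro continuous_on_compose continuous_on_subset[OF homeomorphism_cont1[OF hk]]) auto
  moreover have "closedin (top_of_set ({0..1} \<times> {a..b})) K"
    using closed ab by (intro closed_subset) (auto simp: K_def K1_def K2_def K3_def K4_def)
  ultimately obtain G where G: "continuous_on ({0..1} \<times> {a..b}) G" "\<And>x. x \<in> K \<Longrightarrow> G x = (h \<circ> f) x"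
    using Tietze_unbounded[of K "h \<circ> f" "{0..1} \<times> {a..b}"] by blast
  show ?thesis
  proof (rule that[of "k \<circ> G"])
    show "continuous_on ({0..1} \<times> {a..b}) (k \<circ> G)"
      using G(1) by (intro continuous_on_compose continuous_on_subset[OF homeomorphism_cont2[OF hk]]) auto
    show "(k \<circ> G) ` ({0..1} \<times> {a..b}) \<subseteq> W"
      using homeomorphism_image2[OF hk] by auto
    have kG: "(k \<circ> G) x = f x" if "x \<in> K" for x
      using G(2)[OF that] homeomorphism_apply1[OF hk fW[OF that]] by simp
    show "(k \<circ> G) (s, a) = l s" "(k \<circ> G) (s, b) = r s" if "s \<in> {0..1}" for s
      using that kG[of "(s, a)"] kG[of "(s, b)"] edges by (auto simp: K_def K1_def K2_def)
    show "(k \<circ> G) (0, t) = bt t" "(k \<circ> G) (1, t) = tp t" if "t \<in> {a..b}" for t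
      using that kG[of "(0, t)"] kG[of "(1, t)"] edges' by (auto simp: K_def K3_def K4_def)
  qed
qed

lemma continuous_on_stereo_Some_iff:
  "continuous_on S (\<lambda>x. stereo (Some (h x))) \<longleftrightarrow> continuous_on S h"
  unfolding continuous_on_def tendsto_stereo_Some_iff ..

text \<open>The map t -> 2t - 1 fixes 1 and permutes its left neighbourhoods. It occurs when a path
  is put in front by \<open>+++\<close> and when a crosscut is halved.\<close>

lemma tendsto_at_left_reparam:
  fixes g :: "real \<Rightarrow> 'a::topological_space"
  shows "((\<lambda>t. g (2 * t - 1)) \<longlongrightarrow> l) (at_left 1) \<longleftrightarrow> (g \<longlongrightarrow> l) (at_left 1)"
proof -
  have "filtermap (\<lambda>t::real. 2 * t - 1) (at_left 1) = at_left 1"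
  proof (rule filtermap_fun_inverse[where g = "\<lambda>t. (t + 1) / 2"])
    show "filterlim (\<lambda>t::real. (t + 1) / 2) (at_left 1) (at_left 1)"
      unfolding filterlim_at
      by (auto intro!: tendsto_eq_intros eventually_at_leftI[of 0] simp: field_simps)
    show "filterlim (\<lambda>t::real. 2 * t - 1) (at_left 1) (at_left 1)"
      unfolding filterlim_at
      by (auto intro!: tendsto_eq_intros eventually_at_leftI[of 0])
    show "\<forall>\<^sub>F x in at_left 1. 2 * ((x + 1) / 2) - 1 = (x::real)"
      by (simp add: field_simps)
  qed
  then show ?thesis
    by (metis filterlim_def filterlim_filtermap)
qed

context riemann_mapping
begin

text \<open>Small neighbourhoods of \<open>v\<close> are taken as discs, or as complements of discs about the origin
  when \<open>v\<close> is the point at infinity; then loops in their intersection with \<open>U\<close> wind around no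
  omitted point.\<close>

lemma simply_connected_neighbourhood:
  assumes v: "v \<notin> Some ` U" and d: "d > 0"
  obtains N where "open N" "\<And>w. w \<in> N \<Longrightarrow> dist (stereo (Some w)) (stereo v) < d"
    "\<exists>d'>0. \<forall>w. dist (stereo (Some w)) (stereo v) < d' \<longrightarrow> w \<in> N"
    "\<And>p z. \<lbrakk>path p; path_image p \<subseteq> U \<inter> N; pathfinish p = pathstart p; z \<notin> U \<inter> N\<rbrakk> \<Longrightarrow> winding_number p z = 0"
proof -
  have wU: "winding_number p z = 0" if "path p" "path_image p \<subseteq> U" "pathfinish p = pathstart p" "z \<notin> U" for p z
    using that sc_U simply_connected_eq_winding_number_zero[OF open_U] by blast
  show ?thesis
  proof (cases v)
    case (Some c)
    have "open ((\<lambda>w. stereo (Some w)) -` ball (stereo (Some c)) d)"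
      by (rule open_vimage[OF open_ball continuous_on_stereo_Some])
    moreover have "c \<in> (\<lambda>w. stereo (Some w)) -` ball (stereo (Some c)) d"
      using d by simp
    ultimately obtain r where r: "r > 0" "ball c r \<subseteq> (\<lambda>w. stereo (Some w)) -` ball (stereo (Some c)) d"
      by (rule openE)
    have "open (ball c r)"
      by simp
    then obtain V where V: "open V" "Some ` ball c r = stereo -` V"
      by (rule open_Some_image_vimage)
    have "Some c \<in> stereo -` V"
      unfolding V(2)[symmetric] using r(1) by simp
    then have "stereo v \<in> V"
      using Some by simp
    then obtain d' where d': "d' > 0" "ball (stereo v) d' \<subseteq> V"
      using V(1) open_contains_ball by blast
    show ?thesis
    proof
      show "open (ball c r)"
        by simp
      show "dist (stereo (Some w)) (stereo v) < d" if "w \<in> ball c r" for w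
        using subsetD[OF r(2) that] Some by (simp add: dist_commute)
      have "w \<in> ball c r" if "dist (stereo (Some w)) (stereo v) < d'" for w
      proof -
        have "Some w \<in> stereo -` V"
          using d'(2) that by (auto simp: dist_commute)
        then show ?thesis
          using V(2) by blast
      qed
      then show "\<exists>d'>0. \<forall>w. dist (stereo (Some w)) (stereo v) < d' \<longrightarrow> w \<in> ball c r"
        using d'(1) by blast
      \<comment> \<open>A point of \<open>U\<close> that is not in the intersection lies outside the
        convex disc containing the loop.\<close>
      show "winding_number p z = 0" if p: "path p" "path_image p \<subseteq> U \<inter> ball c r" "pathfinish p = pathstart p" and z: "z \<notin> U \<inter> ball c r" for p z
      proof (cases "z \<in> U")
        case True
        then have "z \<notin> ball c r"
          using z by blast
        then show ?thesis
          using p winding_number_zero_outside[of p "ball c r" z] by auto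
      qed (use wU p in auto)
    qed
  next
    case None
    obtain a where a: "a \<notin> U"
      using U_neq by blast
    have "((\<lambda>w. stereo (Some w)) \<longlongrightarrow> stereo None) at_infinity"
      by (rule tendsto_stereo_infinity) (rule filterlim_ident)
    then have "\<forall>\<^sub>F w in at_infinity. dist (stereo (Some w)) (stereo None) < d"
      using d by (rule tendstoD)
    then obtain b where b: "\<And>w. b \<le> cmod w \<Longrightarrow> dist (stereo (Some w)) (stereo None) < d"
      by (auto simp: eventually_at_infinity)
    \<comment> \<open>The removed disc is made to contain a point \<open>a\<close> outside
      \<open>U\<close>. The loop winds equally often around all points of that disc, hence not at
      all, since it does not wind around \<open>a\<close>.\<close>
    define r where "r = max b (cmod a)"
    have "compact (stereo ` Some ` cball 0 r)"
      unfolding image_image by (intro compact_continuous_image continuous_on_stereo_Some compact_cball)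
    moreover have "stereo None \<notin> stereo ` Some ` cball 0 r"
      using stereo_Some_neq_None by fastforce
    ultimately obtain d' where d': "d' > 0" "\<And>y. y \<in> stereo ` Some ` cball 0 r \<Longrightarrow> d' \<le> dist (stereo None) y"
      using separate_point_closed[OF compact_imp_closed] by metis
    show ?thesis
    proof
      show "open (- cball (0::complex) r)"
        by (simp add: open_Compl)
      show "dist (stereo (Some w)) (stereo v) < d" if "w \<in> - cball 0 r" for w
        using b[of w] that None by (auto simp: r_def)
      show "\<exists>d'>0. \<forall>w. dist (stereo (Some w)) (stereo v) < d' \<longrightarrow> w \<in> - cball 0 r"
      proof (intro exI[of _ d'] conjI allI impI)
        fix w assume w: "dist (stereo (Some w)) (stereo v) < d'"
        then show "w \<in> - cball 0 r"
          using d'(2)[of "stereo (Some w)"] None by (force simp: dist_commute)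
      qed (rule d'(1))
      show "winding_number p z = 0" if p: "path p" "path_image p \<subseteq> U \<inter> - cball 0 r" "pathfinish p = pathstart p" and z: "z \<notin> U \<inter> - cball 0 r" for p z
      proof (cases "z \<in> U")
        case True
        then have "z \<in> cball 0 r"
          using z by blast
        moreover have "a \<in> cball 0 r"
          by (simp add: r_def)
        ultimately have "winding_number p z = winding_number p a"
          using p by (intro winding_number_eq[of p z "cball 0 r" a]) auto
        then show ?thesis
          using wU[of p a] p a by simp
      qed (use wU p in auto)
    qed
  qed
qed

text \<open>An arc close to \<zeta> links the tails of both preimage curves, so the image of the
  union is connected and lies in one component \<open>W\<close> of the intersection of
  \<open>U\<close> with a small neighbourhood of \<open>v\<close>. The last clause, by which
  \<open>W\<close> absorbs connected sets near \<open>v\<close> that meet it, is what makes the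
  domains for successive neighbourhoods nested.\<close>

lemma tails_in_simply_connected:
  fixes \<eta>1 \<eta>2 :: "real \<Rightarrow> complex"
  assumes v: "v \<notin> Some ` U" and d: "d > 0" and \<zeta>: "cmod \<zeta> = 1"
    and \<eta>1: "continuous_on {0..<1} \<eta>1" "\<eta>1 ` {0..<1} \<subseteq> ball 0 1" "(\<eta>1 \<longlongrightarrow> \<zeta>) (at_left 1)" "((\<lambda>t. \<Phi> (\<eta>1 t)) \<longlongrightarrow> stereo v) (at_left 1)"
    and \<eta>2: "continuous_on {0..<1} \<eta>2" "\<eta>2 ` {0..<1} \<subseteq> ball 0 1" "(\<eta>2 \<longlongrightarrow> \<zeta>) (at_left 1)" "((\<lambda>t. \<Phi> (\<eta>2 t)) \<longlongrightarrow> stereo v) (at_left 1)"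
  shows "\<exists>W T. open W \<and> simply_connected W \<and> W \<subseteq> U \<and> (\<forall>w\<in>W. dist (stereo (Some w)) (stereo v) < d) \<and>
    0 \<le> T \<and> T < 1 \<and> (\<forall>t. T \<le> t \<and> t < 1 \<longrightarrow> \<phi> (\<eta>1 t) \<in> W \<and> \<phi> (\<eta>2 t) \<in> W) \<and>
    (\<exists>e>0. \<forall>A. connected A \<and> A \<subseteq> U \<and> (\<forall>w\<in>A. dist (stereo (Some w)) (stereo v) < e) \<and> A \<inter> W \<noteq> {} \<longrightarrow> A \<subseteq> W)"
proof -
  obtain N where N: "open N" "\<And>w. w \<in> N \<Longrightarrow> dist (stereo (Some w)) (stereo v) < d"
    "\<exists>d'>0. \<forall>w. dist (stereo (Some w)) (stereo v) < d' \<longrightarrow> w \<in> N"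
    "\<And>p z. \<lbrakk>path p; path_image p \<subseteq> U \<inter> N; pathfinish p = pathstart p; z \<notin> U \<inter> N\<rbrakk> \<Longrightarrow> winding_number p z = 0"
    using simply_connected_neighbourhood[OF v d] by blast
  then obtain d' where d': "d' > 0" "\<And>w. dist (stereo (Some w)) (stereo v) < d' \<Longrightarrow> w \<in> N"
    by blast
  \<comment> \<open>Half of \<open>d'\<close> is for the oscillation on the arc, half for the
    distance of its crossing point from \<open>v\<close>.\<close>
  have d2: "d' / 2 > 0"
    using d' by simp
  have inb: "\<eta>1 t \<in> ball 0 1" "\<eta>2 t \<in> ball 0 1" if "0 \<le> t" "t < 1" for t
    using \<eta>1(2) \<eta>2(2) that unfolding image_subset_iff by simp_all
  have "\<forall>\<^sub>F t in at_left 1. dist (\<Phi> (\<eta>1 t)) (stereo v) < d' / 2 \<and> dist (\<Phi> (\<eta>2 t)) (stereo v) < d' / 2"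
    using tendstoD[OF \<eta>1(4) d2] tendstoD[OF \<eta>2(4) d2] by (rule eventually_conj)
  then have "\<exists>b<1. \<forall>t. b < t \<and> t < 1 \<longrightarrow> dist (\<Phi> (\<eta>1 t)) (stereo v) < d' / 2 \<and> dist (\<Phi> (\<eta>2 t)) (stereo v) < d' / 2"
    unfolding eventually_at_left[OF zero_less_one] by blast
  then obtain b where b: "b < 1" "\<And>t. b < t \<Longrightarrow> t < 1 \<Longrightarrow> dist (\<Phi> (\<eta>1 t)) (stereo v) < d' / 2 \<and> dist (\<Phi> (\<eta>2 t)) (stereo v) < d' / 2"
    by blast
  define T where "T = (max 0 b + 1) / 2"
  have T: "0 \<le> T" "T < 1" "b < T"
    using b(1) by (auto simp: T_def)
  obtain \<delta> where \<delta>: "0 < \<delta>" "\<delta> \<le> 1" and arcs: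
    "\<And>r F. \<lbrakk>0 < r; r < \<delta>; finite F; F \<inter> Some ` U = {}\<rbrakk> \<Longrightarrow>
      \<exists>\<rho> g. r / 2 \<le> \<rho> \<and> \<rho> \<le> r \<and> continuous_on {0..1} (\<lambda>u. stereo (g u)) \<and>
        (\<forall>u\<in>{0<..<1}. g u = Some (\<phi> (circ_arc \<zeta> \<rho> u))) \<and>
        (\<forall>u\<in>{0<..<1}. \<forall>v\<in>{0<..<1}. dist (\<Phi> (circ_arc \<zeta> \<rho> u)) (\<Phi> (circ_arc \<zeta> \<rho> v)) < d' / 2) \<and>
        (\<forall>p\<in>F. \<exists>d>0. \<forall>u\<in>{0<..<1}. d \<le> dist (\<Phi> (circ_arc \<zeta> \<rho> u)) (stereo p)) \<and>
        dist (\<Phi> (of_real (1 - \<rho>) * \<zeta>)) (\<Phi> (of_real (1 - r) * \<zeta>)) < d' / 2"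
    by (rule good_arcs[OF \<zeta> d2]) metis
  have pos: "0 < dist (\<eta>1 T) \<zeta>" "0 < dist (\<eta>2 T) \<zeta>"
    using inb[of T] T \<zeta> by auto
  \<comment> \<open>At time \<open>T\<close> both curves are farther than \<open>r\<close> from
    \<zeta>, so each of them crosses the arc after \<open>T\<close>.\<close>
  define r where "r = min \<delta> (min (dist (\<eta>1 T) \<zeta>) (dist (\<eta>2 T) \<zeta>)) / 2"
  have r: "0 < r" "r < \<delta>" "r < dist (\<eta>1 T) \<zeta>" "r < dist (\<eta>2 T) \<zeta>"
    using \<delta> pos unfolding r_def by linarith+
  obtain \<rho> where \<rho>: "r / 2 \<le> \<rho>" "\<rho> \<le> r"
    and diam: "\<And>u v. u \<in> {0<..<1} \<Longrightarrow> v \<in> {0<..<1} \<Longrightarrow> dist (\<Phi> (circ_arc \<zeta> \<rho> u)) (\<Phi> (circ_arc \<zeta> \<rho> v)) < d' / 2"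
    using arcs[OF r(1,2), of "{}"] by auto
  have \<rho>': "0 < \<rho>" "\<rho> \<le> 1" "\<rho> < dist (\<eta>1 T) \<zeta>" "\<rho> < dist (\<eta>2 T) \<zeta>"
    using \<rho> r \<delta> by auto
  obtain t1 where t1: "T < t1" "t1 < 1" "dist (\<eta>1 t1) \<zeta> = \<rho>"
    using curve_crosses_circle[OF \<eta>1(1,3) T(1,2) \<rho>'(1,3)] .
  obtain t2 where t2: "T < t2" "t2 < 1" "dist (\<eta>2 t2) \<zeta> = \<rho>"
    using curve_crosses_circle[OF \<eta>2(1,3) T(1,2) \<rho>'(1,4)] .
  obtain u1 where u1: "0 < u1" "u1 < 1" "\<eta>1 t1 = circ_arc \<zeta> \<rho> u1"
    using circ_arc_cover[OF \<zeta> \<rho>'(1,2) inb(1)[of t1] t1(3)] t1 T by auto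
  obtain u2 where u2: "0 < u2" "u2 < 1" "\<eta>2 t2 = circ_arc \<zeta> \<rho> u2"
    using circ_arc_cover[OF \<zeta> \<rho>'(1,2) inb(2)[of t2] t2(3)] t2 T by auto
  define A where "A = \<eta>1 ` {T..<1} \<union> circ_arc \<zeta> \<rho> ` {0<..<1} \<union> \<eta>2 ` {T..<1}"
  have cA: "connected A"
    unfolding A_def
  proof (intro connected_Un)
    show "connected (\<eta>1 ` {T..<1})" "connected (\<eta>2 ` {T..<1})" "connected (circ_arc \<zeta> \<rho> ` {0<..<1})"
      using T by (auto intro!: connected_continuous_image continuous_on_subset[OF \<eta>1(1)] continuous_on_subset[OF \<eta>2(1)] continuous_on_circ_arc)
    show "\<eta>1 ` {T..<1} \<inter> circ_arc \<zeta> \<rho> ` {0<..<1} \<noteq> {}"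
    proof -
      have "\<eta>1 t1 \<in> \<eta>1 ` {T..<1}"
        using t1 by (intro imageI) simp
      moreover have "\<eta>1 t1 \<in> circ_arc \<zeta> \<rho> ` {0<..<1}"
        unfolding u1(3) using u1 by (intro imageI) simp
      ultimately show ?thesis
        by blast
    qed
    show "(\<eta>1 ` {T..<1} \<union> circ_arc \<zeta> \<rho> ` {0<..<1}) \<inter> \<eta>2 ` {T..<1} \<noteq> {}"
    proof -
      have "\<eta>2 t2 \<in> \<eta>2 ` {T..<1}"
        using t2 by (intro imageI) simp
      moreover have "\<eta>2 t2 \<in> circ_arc \<zeta> \<rho> ` {0<..<1}"
        unfolding u2(3) using u2 by (intro imageI) simp
      ultimately show ?thesis
        by blast
    qed
  qed
  have Ab: "A \<subseteq> ball 0 1"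
  proof -
    have "circ_arc \<zeta> \<rho> u \<in> ball 0 1" if "u \<in> {0<..<1}" for u
      using circ_arc_in_ball[OF \<zeta> \<rho>'(1,2)] that by simp
    moreover have "\<eta>1 t \<in> ball 0 1" "\<eta>2 t \<in> ball 0 1" if "t \<in> {T..<1}" for t
      using inb[of t] that T by simp_all
    ultimately show ?thesis
      unfolding A_def by blast
  qed
  have near: "dist (\<Phi> z) (stereo v) < d'" if "z \<in> A" for z
    using that unfolding A_def
  proof (elim UnE imageE)
    fix t assume t: "z = \<eta>1 t" "t \<in> {T..<1}"
    then have "dist (\<Phi> z) (stereo v) < d' / 2"
      using b(2)[of t] T by simp
    then show ?thesis
      using d'(1) by linarith
  next
    fix t assume t: "z = \<eta>2 t" "t \<in> {T..<1}"
    then have "dist (\<Phi> z) (stereo v) < d' / 2"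
      using b(2)[of t] T by simp
    then show ?thesis
      using d'(1) by linarith
  next
    fix u assume u: "z = circ_arc \<zeta> \<rho> u" "u \<in> {0<..<1}"
    have "dist (\<Phi> z) (\<Phi> (\<eta>1 t1)) < d' / 2"
      using diam[of u u1] u u1 by simp
    moreover have "dist (\<Phi> (\<eta>1 t1)) (stereo v) < d' / 2"
      using b(2)[of t1] T t1 by simp
    ultimately show ?thesis
      using dist_triangle[of "\<Phi> z" "stereo v" "\<Phi> (\<eta>1 t1)"] by simp
  qed
  have "\<phi> ` A \<subseteq> U \<inter> N"
    using Ab near d'(2) \<phi>_in_U unfolding \<Phi>_def by blast
  moreover have "connected (\<phi> ` A)"
    by (intro connected_continuous_image cA continuous_on_subset[OF continuous_on_\<phi> Ab])
  moreover have ne: "\<phi> ` A \<noteq> {}"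
    using T by (auto simp: A_def)
  ultimately obtain W where W: "W \<in> components (U \<inter> N)" "\<phi> ` A \<subseteq> W"
    using exists_component_superset[of "\<phi> ` A" "U \<inter> N"] by (metis Int_empty_left le_inf_iff subset_empty)
  have "open (U \<inter> N)"
    using open_U N(1) by blast
  have "simply_connected W"
    using simply_connected_component[OF \<open>open (U \<inter> N)\<close> W(1)] N(4) by blast
  moreover have "open W" "W \<subseteq> U \<inter> N"
    using W(1) \<open>open (U \<inter> N)\<close> open_components in_components_subset by blast+
  moreover have "\<phi> (\<eta>1 t) \<in> W \<and> \<phi> (\<eta>2 t) \<in> W" if "T \<le> t" "t < 1" for t
    using W(2) that unfolding A_def by (auto simp: image_subset_iff)
  moreover have "A \<subseteq> W" if "connected A" "A \<subseteq> U" "\<forall>w\<in>A. dist (stereo (Some w)) (stereo v) < d'" "A \<inter> W \<noteq> {}" for A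
    using components_maximal[OF W(1) that(1)] that d'(2) by blast
  ultimately show ?thesis
    using T N(2) d'(1) by (intro exI[of _ W] exI[of _ T]) blast
qed

end

section \<open>Homotopies of access curves\<close>

text \<open>The characterisation of \<open>homotopic_with\<close> used next asks for a property that
  depends only on the values over the unit interval.\<close>

lemma access_curve_cong:
  assumes "\<And>x. x \<in> {0..1} \<Longrightarrow> h x = k x"
  shows "access_curve U z v h \<longleftrightarrow> access_curve U z v k"
proof -
  have "continuous_on {0..1} (\<lambda>x. stereo (h x)) \<longleftrightarrow> continuous_on {0..1} (\<lambda>x. stereo (k x))"
    by (rule continuous_on_cong) (simp_all add: assms)
  moreover have "h ` {0..<1} = k ` {0..<1}"
    by (rule image_cong) (simp_all add: assms)
  ultimately show ?thesis
    using assms[of 0] assms[of 1] by (simp add: access_curve_def pathin_riemann_sphere_iff)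
qed

text \<open>Unfolds the homotopy into one map of the square, read through \<open>stereo\<close>. In
  \<open>h (s, x)\<close> the first argument is the homotopy parameter, the second the time along
  the curve.\<close>

lemma access_homotopic_iff:
  "access_homotopic U z v \<gamma> \<gamma>' \<longleftrightarrow>
    (\<exists>h :: real \<times> real \<Rightarrow> complex option. continuous_on ({0..1} \<times> {0..1}) (\<lambda>x. stereo (h x)) \<and> h ` ({0..1} \<times> {0..1}) \<subseteq> Some ` U \<union> {v} \<and>
      (\<forall>x\<in>{0..1}. h (0, x) = \<gamma> x) \<and> (\<forall>x\<in>{0..1}. h (1, x) = \<gamma>' x) \<and> (\<forall>s\<in>{0..1}. access_curve U z v (\<lambda>x. h (s, x))))"
proof -
  have top: "prod_topology (top_of_set {0..1::real}) (top_of_set {0..1::real}) = top_of_set ({0..1} \<times> {0..1})"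
    unfolding subtopology_Times[symmetric] prod_topology_euclidean ..
  have "access_homotopic U z v \<gamma> \<gamma>' \<longleftrightarrow>
    (\<exists>h :: real \<times> real \<Rightarrow> complex option. continuous_map (prod_topology (top_of_set {0..1}) (top_of_set {0..1})) (subtopology riemann_sphere (Some ` U \<union> {v})) h \<and>
      (\<forall>x\<in>{0..1}. h (0, x) = \<gamma> x) \<and> (\<forall>x\<in>{0..1}. h (1, x) = \<gamma>' x) \<and> (\<forall>s\<in>{0..1}. access_curve U z v (\<lambda>x. h (s, x))))"
    unfolding access_homotopic_def
  proof (subst homotopic_with)
    show "access_curve U z v h \<longleftrightarrow> access_curve U z v k" if "\<And>x. x \<in> topspace (top_of_set {0..1}) \<Longrightarrow> h x = k x" for h k
      by (rule access_curve_cong) (use that in simp)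
  qed simp
  then show ?thesis
    by (simp add: top continuous_map_in_subtopology continuous_map_riemann_sphere_iff image_subset_iff Pi_iff)
qed

lemma monotone_cover:
  fixes t :: "nat \<Rightarrow> real"
  assumes "t 0 = 0" "t \<longlonglongrightarrow> 1" "0 \<le> x" "x < 1"
  obtains n where "t n \<le> x" "x < t (Suc n)"
proof -
  have "\<forall>\<^sub>F n in sequentially. x < t n"
    using assms by (intro order_tendstoD) auto
  then have ex: "\<exists>n. x < t n"
    by (auto simp: eventually_sequentially)
  define m where "m = (LEAST n. x < t n)"
  have "x < t m"
    unfolding m_def using ex by (rule LeastI_ex)
  moreover have "m \<noteq> 0"
  proof
    assume "m = 0"
    with \<open>x < t m\<close> assms(1,3) show False
      by simp
  qed
  moreover have "\<not> x < t (m - 1)"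
    using not_less_Least[of "m - 1" "\<lambda>n. x < t n"] \<open>m \<noteq> 0\<close> by (simp add: m_def)
  ultimately show ?thesis
    using that[of "m - 1"] by simp
qed

text \<open>The strips accumulate only at time 1, which is excluded, so they form a locally finite
  closed cover. Agreement on the common edges of consecutive strips suffices because
  \<open>t\<close> is strictly increasing and no other strips meet.\<close>

lemma paste_strips:
  fixes F :: "nat \<Rightarrow> real \<times> real \<Rightarrow> complex"
  assumes t: "strict_mono t" "t 0 = 0" "t \<longlonglongrightarrow> 1"
    and F: "\<And>n. continuous_on ({0..1} \<times> {t n..t (Suc n)}) (F n)"
    and agree: "\<And>n s. s \<in> {0..1} \<Longrightarrow> F n (s, t (Suc n)) = F (Suc n) (s, t (Suc n))"
  obtains g where "continuous_on ({0..1} \<times> {0..<1}) g"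
    "\<And>n x. x \<in> {0..1} \<times> {t n..t (Suc n)} \<Longrightarrow> g x = F n x"
proof -
  have mono: "t i \<le> t j \<longleftrightarrow> i \<le> j" for i j
    using t(1) by (simp add: strict_mono_less_eq)
  have t1: "t n < 1" for n
  proof -
    have "t n < t (Suc n)"
      using t(1) by (simp add: strict_mono_less)
    also have "t (Suc n) \<le> 1"
      by (rule incseq_le[OF strict_mono_mono[OF t(1), folded incseq_def] t(3)])
    finally show ?thesis .
  qed
  have t0: "0 \<le> t n" for n
    using mono[of 0 n] t(2) by simp
  have comp: "F i x = F j x" if x: "x \<in> {0..1} \<times> {t i..t (Suc i)}" "x \<in> {0..1} \<times> {t j..t (Suc j)}" and "i < j" for i j x
  proof -
    have "t j \<le> t (Suc i)"
      using x by auto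
    then have "j = Suc i"
      using mono[of j "Suc i"] \<open>i < j\<close> by simp
    then have "snd x = t (Suc i)" "fst x \<in> {0..1}"
      using x by (auto intro: antisym)
    then show ?thesis
      using agree[of "fst x" i] \<open>j = Suc i\<close> by (metis prod.collapse)
  qed
  have comp': "F i x = F j x" if "x \<in> {0..1} \<times> {t i..t (Suc i)}" "x \<in> {0..1} \<times> {t j..t (Suc j)}" for i j x
  proof (cases i j rule: linorder_cases)
    case less
    with comp[OF that] show ?thesis .
  next
    case greater
    with comp[OF that(2,1)] show ?thesis
      by simp
  qed simp
  define idx where "idx x = (SOME n. x \<in> {0..1} \<times> {t n..t (Suc n)})" for x :: "real \<times> real"
  define g where "g x = F (idx x) x" for x
  have idx: "x \<in> {0..1} \<times> {t (idx x)..t (Suc (idx x))}" if "x \<in> {0..1} \<times> {t n..t (Suc n)}" for x n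
    unfolding idx_def by (rule someI[of "\<lambda>n. x \<in> {0..1} \<times> {t n..t (Suc n)}", OF that])
  have cov: "\<exists>n. x \<in> {0..1} \<times> {t n..t (Suc n)}" if x: "x \<in> {0..1} \<times> {0..<1}" for x
  proof -
    have "0 \<le> snd x" "snd x < 1"
      using x by auto
    then obtain n where "t n \<le> snd x" "snd x < t (Suc n)"
      by (rule monotone_cover[OF t(2,3)])
    then show ?thesis
      using x by (cases x) (auto intro!: exI[of _ n])
  qed
  have gF: "g x = F n x" if "x \<in> {0..1} \<times> {t n..t (Suc n)}" for x n
    unfolding g_def using comp'[OF idx[OF that] that] .
  have "continuous_map (top_of_set ({0..1::real} \<times> {0..<1::real})) euclidean g"
  proof (rule pasting_lemma_locally_finite[where I = UNIV and T = "\<lambda>n. {0..1} \<times> {t n..t (Suc n)}" and f = F])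
    fix x assume "x \<in> topspace (top_of_set ({0..1::real} \<times> {0..<1::real}))"
    then have x: "x \<in> {0..1} \<times> {0..<1}"
      by simp
    have "0 \<le> snd x" "snd x < 1"
      using x by auto
    then obtain n where n: "t n \<le> snd x" "snd x < t (Suc n)"
      by (rule monotone_cover[OF t(2,3)])
    show "\<exists>V. openin (top_of_set ({0..1::real} \<times> {0..<1::real})) V \<and> x \<in> V \<and> finite {i \<in> UNIV. {0..1} \<times> {t i..t (Suc i)} \<inter> V \<noteq> {}}"
    proof (intro exI conjI)
      have "open (UNIV \<times> {..<t (Suc n)} :: (real \<times> real) set)"
        by (intro open_Times) auto
      then show "openin (top_of_set ({0..1::real} \<times> {0..<1::real})) (({0..1::real} \<times> {0..<1::real}) \<inter> (UNIV \<times> {..<t (Suc n)}))"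
        by (rule openin_open_Int)
      show "x \<in> ({0..1::real} \<times> {0..<1::real}) \<inter> (UNIV \<times> {..<t (Suc n)})"
        using x n by (cases x) auto
      have "i \<le> n" if "{0..1} \<times> {t i..t (Suc i)} \<inter> (({0..1::real} \<times> {0..<1::real}) \<inter> (UNIV \<times> {..<t (Suc n)})) \<noteq> {}" for i
      proof -
        have "t i < t (Suc n)"
          using that by auto
        then show ?thesis
          using mono[of "Suc n" i] by linarith
      qed
      then have "{i \<in> UNIV. {0..1} \<times> {t i..t (Suc i)} \<inter> (({0..1::real} \<times> {0..<1::real}) \<inter> (UNIV \<times> {..<t (Suc n)})) \<noteq> {}} \<subseteq> {..n}"
        by blast
      then show "finite {i \<in> UNIV. {0..1} \<times> {t i..t (Suc i)} \<inter> (({0..1::real} \<times> {0..<1::real}) \<inter> (UNIV \<times> {..<t (Suc n)})) \<noteq> {}}"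
        by (rule finite_subset) simp
    qed
    show "\<exists>j. j \<in> UNIV \<and> x \<in> {0..1} \<times> {t j..t (Suc j)} \<and> g x = F j x"
      using cov[OF x] gF by blast
  next
    fix i
    have sub: "{0..1} \<times> {t i..t (Suc i)} \<subseteq> {0..1} \<times> {0..<1}"
      using t0[of i] t1[of "Suc i"] by auto
    then show "closedin (top_of_set ({0..1::real} \<times> {0..<1::real})) ({0..1} \<times> {t i..t (Suc i)})"
      by (rule closed_subset) (simp add: closed_Times)
    show "continuous_map (subtopology (top_of_set ({0..1::real} \<times> {0..<1::real})) ({0..1} \<times> {t i..t (Suc i)})) euclidean (F i)"
      unfolding subtopology_subtopology Int_absorb1[OF sub] using F[of i] by simp
  next
    fix i j x
    assume "x \<in> topspace (top_of_set ({0..1::real} \<times> {0..<1::real})) \<inter> ({0..1} \<times> {t i..t (Suc i)}) \<inter> ({0..1} \<times> {t j..t (Suc j)})"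
    then show "F i x = F j x"
      by (intro comp') auto
  qed
  then show ?thesis
    using that gF by simp
qed

context riemann_mapping
begin

text \<open>The preimage curve in the disc; meaningful at times below 1, where an access curve takes
  finite values in \<open>U\<close>.\<close>

definition lift :: "(real \<Rightarrow> complex option) \<Rightarrow> real \<Rightarrow> complex" where
  "lift \<gamma> t = \<psi> (the (\<gamma> t))"

lemma access_curveD:
  assumes a: "access_curve U (\<phi> 0) v \<gamma>"
  shows "continuous_on {0..1} (\<lambda>t. stereo (\<gamma> t))"
    and "\<And>t. 0 \<le> t \<Longrightarrow> t < 1 \<Longrightarrow> \<gamma> t = Some (the (\<gamma> t))"
    and "\<And>t. 0 \<le> t \<Longrightarrow> t < 1 \<Longrightarrow> the (\<gamma> t) \<in> U"
    and "\<gamma> 0 = Some (\<phi> 0)" and "\<gamma> 1 = v"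
    and "continuous_on {0..<1} (\<lambda>t. the (\<gamma> t))"
    and "continuous_on {0..<1} (lift \<gamma>)" and "lift \<gamma> ` {0..<1} \<subseteq> ball 0 1"
    and "\<And>t. 0 \<le> t \<Longrightarrow> t < 1 \<Longrightarrow> \<phi> (lift \<gamma> t) = the (\<gamma> t)"
    and "((\<lambda>t. \<Phi> (lift \<gamma> t)) \<longlongrightarrow> stereo v) (at_left 1)"
proof -
  show c: "continuous_on {0..1} (\<lambda>t. stereo (\<gamma> t))" and "\<gamma> 0 = Some (\<phi> 0)" and v: "\<gamma> 1 = v"
    using a by (auto simp: access_curve_def pathin_riemann_sphere_iff)
  have sub: "\<gamma> ` {0..<1} \<subseteq> Some ` U"
    using a by (simp add: access_curve_def)
  have 0: "\<gamma> t = Some (the (\<gamma> t)) \<and> the (\<gamma> t) \<in> U" if "0 \<le> t" "t < 1" for t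
  proof -
    have "\<gamma> t \<in> Some ` U"
      using sub that by (simp add: image_subset_iff)
    then show ?thesis
      by auto
  qed
  then show 1: "\<gamma> t = Some (the (\<gamma> t))" "the (\<gamma> t) \<in> U" if "0 \<le> t" "t < 1" for t
    using that by simp_all
  have "continuous_on {0..<1} (\<lambda>t. stereo (\<gamma> t))"
    by (rule continuous_on_subset[OF c]) auto
  also have "?this \<longleftrightarrow> continuous_on {0..<1} (\<lambda>t. stereo (Some (the (\<gamma> t))))"
    by (rule continuous_on_cong) (use 0 in auto)
  finally show 2: "continuous_on {0..<1} (\<lambda>t. the (\<gamma> t))"
    by (simp only: continuous_on_stereo_Some_iff)
  show "continuous_on {0..<1} (lift \<gamma>)"
    unfolding lift_def by (rule continuous_on_compose2[OF continuous_on_\<psi> 2]) (use 0 in auto)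
  show "lift \<gamma> ` {0..<1} \<subseteq> ball 0 1"
    unfolding lift_def by (intro image_subsetI \<psi>_in_ball) (use 0 in auto)
  show 3: "\<phi> (lift \<gamma> t) = the (\<gamma> t)" if "0 \<le> t" "t < 1" for t
    unfolding lift_def using 0[OF that] by (simp add: \<phi>_\<psi>)
  have "((\<lambda>t. stereo (\<gamma> t)) \<longlongrightarrow> stereo (\<gamma> 1)) (at 1 within {0..1})"
    using c by (auto simp: continuous_on_def)
  then have "((\<lambda>t. stereo (\<gamma> t)) \<longlongrightarrow> stereo v) (at_left 1)"
    unfolding v by (simp add: at_within_Icc_at_left)
  moreover have "\<forall>\<^sub>F t in at_left 1. t \<in> {0<..<1::real}"
    by (intro eventually_at_left_real) auto
  then have "\<forall>\<^sub>F t in at_left 1. stereo (\<gamma> t) = \<Phi> (lift \<gamma> t)"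
    by eventually_elim (use 1(1) 3 in \<open>simp add: \<Phi>_def\<close>)
  ultimately show "((\<lambda>t. \<Phi> (lift \<gamma> t)) \<longlongrightarrow> stereo v) (at_left 1)"
    by (rule Lim_transform_eventually)
qed

lemma homotopic_imp_same_point:
  assumes v: "v \<notin> Some ` U" and hom: "access_homotopic U (\<phi> 0) v \<gamma> \<gamma>'"
    and l: "(lift \<gamma> \<longlongrightarrow> \<zeta>) (at_left 1)" "(lift \<gamma>' \<longlongrightarrow> \<zeta>') (at_left 1)"
  shows "\<zeta> = \<zeta>'"
proof -
  obtain h :: "real \<times> real \<Rightarrow> complex option" where h0: "continuous_on ({0..1} \<times> {0..1}) (\<lambda>x. stereo (h x)) \<and> h ` ({0..1} \<times> {0..1}) \<subseteq> Some ` U \<union> {v} \<and>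
      (\<forall>x\<in>{0..1}. h (0, x) = \<gamma> x) \<and> (\<forall>x\<in>{0..1}. h (1, x) = \<gamma>' x) \<and> (\<forall>s\<in>{0..1}. access_curve U (\<phi> 0) v (\<lambda>x. h (s, x)))"
    using hom unfolding access_homotopic_iff by (elim exE)
  then have h: "continuous_on ({0..1} \<times> {0..1}) (\<lambda>x. stereo (h x))"
    "\<And>x. x \<in> {0..1} \<Longrightarrow> h (0, x) = \<gamma> x" "\<And>x. x \<in> {0..1} \<Longrightarrow> h (1, x) = \<gamma>' x"
    "\<And>s. s \<in> {0..1} \<Longrightarrow> access_curve U (\<phi> 0) v (\<lambda>x. h (s, x))"
    by simp_all
  define x where "x n = 1 - 1 / real (n + 2)" for n
  have x: "0 \<le> x n" "x n < 1" for n
    by (auto simp: x_def field_simps)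
  have "(\<lambda>n. 1 - 1 / real (n + 2)) \<longlonglongrightarrow> 1 - 0"
    by (intro tendsto_diff tendsto_const LIMSEQ_ignore_initial_segment[OF lim_1_over_n])
  then have xlim: "x \<longlonglongrightarrow> 1"
    unfolding x_def[abs_def] by simp
  then have xl: "filterlim x (at_left 1) sequentially"
    unfolding filterlim_at using x by (auto intro!: always_eventually simp: less_le)
  define k where "k n s = \<psi> (the (h (s, x n)))" for n s
  have hk: "h (s, x n) = Some (the (h (s, x n)))" "the (h (s, x n)) \<in> U" if "s \<in> {0..1}" for s n
    using access_curveD(2,3)[OF h(4)[OF that] x] by auto
  have \<Phi>k: "\<Phi> (k n s) = stereo (h (s, x n))" if "s \<in> {0..1}" for n s
    using hk[OF that, of n] by (simp add: \<Phi>_def k_def \<phi>_\<psi>)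
  define S where "S n = k n ` {0..1}" for n
  have conn: "connected (S n)" for n
    unfolding S_def
  proof (rule connected_continuous_image)
    have "continuous_on {0..1} (\<lambda>s. stereo (h (s, x n)))"
      by (rule continuous_on_compose2[OF h(1)]) (use x[of n] in \<open>auto intro!: continuous_intros\<close>)
    also have "?this \<longleftrightarrow> continuous_on {0..1} (\<lambda>s. stereo (Some (the (h (s, x n)))))"
      by (rule continuous_on_cong) (use hk in auto)
    finally have "continuous_on {0..1} (\<lambda>s. the (h (s, x n)))"
      by (simp only: continuous_on_stereo_Some_iff)
    then show "continuous_on {0..1} (k n)"
      unfolding k_def by (rule continuous_on_compose2[OF continuous_on_\<psi>]) (use hk(2) in auto)
  qed simp
  have sub: "S n \<subseteq> ball 0 1" for n
    unfolding S_def k_def by (intro image_subsetI \<psi>_in_ball hk(2))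
  have lim: "\<forall>\<^sub>F n in sequentially. \<forall>z\<in>S n. dist (\<Phi> z) (stereo v) < d" if "d > 0" for d
  proof -
    \<comment> \<open>Uniform continuity on the square, together with \<open>h (s, 1) = v\<close>
      for all \<open>s\<close>, brings whole slices near \<open>v\<close> at once.\<close>
    have "uniformly_continuous_on ({0..1} \<times> {0..1}) (\<lambda>x. stereo (h x))"
      by (intro compact_uniformly_continuous h(1) compact_Times compact_Icc)
    then obtain e where e: "e > 0" "\<And>p q. \<lbrakk>p \<in> {0..1} \<times> {0..1}; q \<in> {0..1} \<times> {0..1}; dist q p < e\<rbrakk> \<Longrightarrow> dist (stereo (h q)) (stereo (h p)) < d"
      unfolding uniformly_continuous_on_def using \<open>d > 0\<close> by metis
    have "\<forall>\<^sub>F n in sequentially. dist (x n) 1 < e"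
      using xlim e(1) by (rule tendstoD)
    then show ?thesis
    proof eventually_elim
      case (elim n)
      have "dist (\<Phi> (k n s)) (stereo v) < d" if s: "s \<in> {0..1}" for s
      proof -
        have "dist (stereo (h (s, x n))) (stereo (h (s, 1))) < d"
          using elim s x[of n] by (intro e(2)) (auto simp: dist_Pair_Pair)
        then show ?thesis
          using \<Phi>k[OF s] access_curveD(5)[OF h(4)[OF s]] by simp
      qed
      then show ?case
        by (simp add: S_def)
    qed
  qed
  have "k n 0 = lift \<gamma> (x n)" "k n 1 = lift \<gamma>' (x n)" for n
    using h(2,3)[of "x n"] x[of n] by (auto simp: k_def lift_def)
  then have S: "lift \<gamma> (x n) \<in> S n" "lift \<gamma>' (x n) \<in> S n" for n
    unfolding S_def by (metis atLeastAtMost_iff imageI order_refl zero_le_one)+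
  have "(\<lambda>n. dist (lift \<gamma> (x n)) (lift \<gamma>' (x n))) \<longlonglongrightarrow> dist \<zeta> \<zeta>'"
    by (intro tendsto_dist filterlim_compose[OF l(1) xl] filterlim_compose[OF l(2) xl])
  moreover have "(\<lambda>n. dist (lift \<gamma> (x n)) (lift \<gamma>' (x n))) \<longlonglongrightarrow> 0"
  proof (rule tendstoI)
    fix e :: real assume "e > 0"
    have "\<forall>\<^sub>F n in sequentially. \<forall>z\<in>S n. \<forall>w\<in>S n. dist z w < e"
      by (rule koebe[OF conn sub v _ \<open>e > 0\<close>]) (rule lim)
    then show "\<forall>\<^sub>F n in sequentially. dist (dist (lift \<gamma> (x n)) (lift \<gamma>' (x n))) 0 < e"
      by eventually_elim (use S in auto)
  qed
  ultimately show ?thesis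
    using LIMSEQ_unique by fastforce
qed

text \<open>Nested domains \<open>W n\<close> shrinking to \<open>v\<close> are chosen together with
  times \<open>t n\<close> after which both curves stay in \<open>W n\<close>. A path
  \<open>c n\<close> in \<open>W n\<close> joins the curves at time \<open>t n\<close>, and the
  square between two such paths is filled inside \<open>W n\<close>; nesting is what puts the upper
  edge \<open>c (Suc n)\<close> into \<open>W n\<close>.\<close>

lemma same_point_imp_homotopic:
  assumes v: "v \<notin> Some ` U" and a1: "access_curve U (\<phi> 0) v \<gamma>1" and a2: "access_curve U (\<phi> 0) v \<gamma>2"
    and \<zeta>: "cmod \<zeta> = 1" and l1: "(lift \<gamma>1 \<longlongrightarrow> \<zeta>) (at_left 1)" and l2: "(lift \<gamma>2 \<longlongrightarrow> \<zeta>) (at_left 1)"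
  shows "access_homotopic U (\<phi> 0) v \<gamma>1 \<gamma>2"
proof -
  define g1 g2 where "g1 t = the (\<gamma>1 t)" and "g2 t = the (\<gamma>2 t)" for t
  note d1 = access_curveD[OF a1, folded g1_def] and d2 = access_curveD[OF a2, folded g2_def]
  define absorb where "absorb W e \<longleftrightarrow> (\<forall>A. connected A \<and> A \<subseteq> U \<and> (\<forall>w\<in>A. dist (stereo (Some w)) (stereo v) < e) \<and> A \<inter> W \<noteq> {} \<longrightarrow> A \<subseteq> W)"
    for W and e :: real
  define tails where "tails W T \<longleftrightarrow> 0 \<le> T \<and> T < 1 \<and> (\<forall>t. T \<le> t \<and> t < 1 \<longrightarrow> g1 t \<in> W \<and> g2 t \<in> W)" for W T
  have ex: "\<exists>W T e. open W \<and> simply_connected W \<and> W \<subseteq> U \<and> (\<forall>w\<in>W. dist (stereo (Some w)) (stereo v) < d) \<and>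
      tails W T \<and> e > 0 \<and> absorb W e" if "d > 0" for d
  proof -
    have "\<exists>W T. open W \<and> simply_connected W \<and> W \<subseteq> U \<and> (\<forall>w\<in>W. dist (stereo (Some w)) (stereo v) < d) \<and>
        0 \<le> T \<and> T < 1 \<and> (\<forall>t. T \<le> t \<and> t < 1 \<longrightarrow> \<phi> (lift \<gamma>1 t) \<in> W \<and> \<phi> (lift \<gamma>2 t) \<in> W) \<and> (\<exists>e>0. absorb W e)"
      using tails_in_simply_connected[OF v that \<zeta> d1(7,8) l1 d1(10) d2(7,8) l2 d2(10)] unfolding absorb_def .
    then obtain W T e where W: "open W" "simply_connected W" "W \<subseteq> U" "\<forall>w\<in>W. dist (stereo (Some w)) (stereo v) < d"
      and T: "0 \<le> T" "T < 1" "\<And>t. T \<le> t \<Longrightarrow> t < 1 \<Longrightarrow> \<phi> (lift \<gamma>1 t) \<in> W \<and> \<phi> (lift \<gamma>2 t) \<in> W" and "e > 0" "absorb W e"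
      by blast
    moreover have "tails W T"
      unfolding tails_def using T d1(9) d2(9) by (metis order_trans)
    ultimately show ?thesis
      by blast
  qed
  \<comment> \<open>A triple holds the domain, a time from which both curves stay in it, and a
    radius within which it absorbs connected sets. The start is all of \<open>U\<close> at time 0,
    so that the squares cover the curves completely.\<close>
  define good where "good n p \<longleftrightarrow> (case p of (W, T, e) \<Rightarrow> open W \<and> simply_connected W \<and> W \<subseteq> U \<and> tails W T \<and> e > 0 \<and> absorb W e \<and>
      (n = 0 \<longrightarrow> W = U \<and> T = 0) \<and> (0 < n \<longrightarrow> (\<forall>w\<in>W. dist (stereo (Some w)) (stereo v) < 1 / real n)))"
    for n :: nat and p :: "complex set \<times> real \<times> real"
  define step where "step n p p' \<longleftrightarrow> fst p' \<subseteq> fst p \<and> fst (snd p) < fst (snd p') \<and> 1 - 1 / real (n + 2) < fst (snd p')"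
    for n :: nat and p p' :: "complex set \<times> real \<times> real"
  have "\<exists>p. \<forall>n. good n (p n) \<and> step n (p n) (p (Suc n))"
  proof (rule dependent_nat_choice)
    have "good 0 (U, 0, 1)"
      using open_U sc_U d1(3) d2(3) by (auto simp: good_def tails_def absorb_def)
    then show "\<exists>p. good 0 p" ..
  next
    fix p n assume p: "good n p"
    obtain W T e where [simp]: "p = (W, T, e)"
      by (cases p)
    have W: "tails W T" "e > 0" "absorb W e"
      using p by (auto simp: good_def)
    \<comment> \<open>Asking the next domain to lie within \<open>e\<close> of \<open>v\<close> lets
      the current one absorb it; the bound 1 / (n + 1) makes the domains shrink.\<close>
    then have "min e (1 / real (Suc n)) > 0"
      by simp
    from ex[OF this] obtain W' T0 e' where W': "open W'" "simply_connected W'" "W' \<subseteq> U"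
      "\<forall>w\<in>W'. dist (stereo (Some w)) (stereo v) < min e (1 / real (Suc n))" "tails W' T0" "e' > 0" "absorb W' e'"
      by blast
    \<comment> \<open>A time strictly between three lower bounds and 1. The third bound drives the
      times to 1.\<close>
    define T' where "T' = (max (max T T0) (1 - 1 / real (n + 2)) + 1) / 2"
    have *: "T < 1" "T0 < 1" "0 \<le> T0" "1 - 1 / real (n + 2) < 1"
      using W(1) W'(5) by (auto simp: tails_def)
    have T': "T < T'" "T0 < T'" "T' < 1" "1 - 1 / real (n + 2) < T'"
    proof -
      define M where "M = max (max T T0) (1 - 1 / real (n + 2))"
      have M: "T \<le> M" "T0 \<le> M" "1 - 1 / real (n + 2) \<le> M" "M < 1"
        using * by (auto simp: M_def)
      have mid: "x < (M + 1) / 2" if "x \<le> M" for x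
        using that M(4) by (simp add: field_simps)
      show "T < T'" "T0 < T'" "T' < 1" "1 - 1 / real (n + 2) < T'"
        unfolding T'_def M_def[symmetric] using mid[OF M(1)] mid[OF M(2)] mid[OF M(3)] M(4) by simp_all
    qed
    have "tails W' T'"
      using W'(5) T' by (auto simp: tails_def)
    moreover have "W' \<subseteq> W"
    proof -
      have "g1 T' \<in> W" "g1 T' \<in> W'"
        using W(1) W'(5) T' unfolding tails_def by (meson less_imp_le)+
      moreover have "connected W'"
        using W'(2) by (rule simply_connected_imp_connected)
      ultimately show ?thesis
        using W(3) W'(3,4) unfolding absorb_def by (metis disjoint_iff min_less_iff_conj)
    qed
    ultimately have "good (Suc n) (W', T', e') \<and> step n p (W', T', e')"
      using W' T' by (simp add: good_def step_def)
    then show "\<exists>p'. good (Suc n) p' \<and> step n p p'" ..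
  qed
  then obtain p where p: "\<And>n. good n (p n)" "\<And>n. step n (p n) (p (Suc n))"
    by blast
  define W t where "W n = fst (p n)" and "t n = fst (snd (p n))" for n
  have W: "open (W n)" "simply_connected (W n)" "W n \<subseteq> U" "tails (W n) (t n)" for n
    using p(1)[of n] by (auto simp: good_def W_def t_def split: prod.splits)
  have W0: "W 0 = U" "t 0 = 0"
    using p(1)[of 0] by (auto simp: good_def W_def t_def split: prod.splits)
  have Wd: "dist (stereo (Some w)) (stereo v) < 1 / real n" if "w \<in> W n" "0 < n" for w n
    using p(1)[of n] that by (auto simp: good_def W_def split: prod.splits)
  have Wn: "W (Suc n) \<subseteq> W n" "t n < t (Suc n)" "1 - 1 / real (n + 2) < t (Suc n)" for n
    using p(2)[of n] by (auto simp: step_def W_def t_def)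
  have mono: "strict_mono t"
    using Wn(2) by (simp add: strict_mono_Suc_iff)
  have t01: "0 \<le> t n" "t n < 1" and gW: "\<And>x. t n \<le> x \<Longrightarrow> x < 1 \<Longrightarrow> g1 x \<in> W n \<and> g2 x \<in> W n" for n
    using W(4)[of n] by (auto simp: tails_def)
  have decW: "W m \<subseteq> W n" if "n \<le> m" for n m
    using Wn(1) that by (rule lift_Suc_antimono_le)
  have tlim: "t \<longlonglongrightarrow> 1"
  proof (rule LIMSEQ_imp_Suc, rule tendsto_sandwich)
    have "(\<lambda>n. 1 - 1 / real (n + 2)) \<longlonglongrightarrow> 1 - 0"
      by (intro tendsto_diff tendsto_const LIMSEQ_ignore_initial_segment[OF lim_1_over_n])
    then show "(\<lambda>n. 1 - 1 / real (n + 2)) \<longlonglongrightarrow> 1"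
      by simp
  qed (use Wn(3) t01(2) in \<open>auto intro!: always_eventually less_imp_le\<close>)
  have z0: "g1 0 = \<phi> 0" "g2 0 = \<phi> 0"
    using d1(4) d2(4) by (auto simp: g1_def g2_def)
  \<comment> \<open>The first path is taken constant, so that the homotopy keeps the starting point
    fixed.\<close>
  have "\<exists>c :: real \<Rightarrow> complex. continuous_on {0..1} c \<and> c ` {0..1} \<subseteq> W n \<and> c 0 = g1 (t n) \<and> c 1 = g2 (t n) \<and> (n = 0 \<longrightarrow> c = (\<lambda>_. \<phi> 0))" for n
  proof (cases "n = 0")
    case True
    then show ?thesis
      using z0 W0 gW[of 0 0] by (intro exI[of _ "\<lambda>_. \<phi> 0"]) auto
  next
    case False
    have "path_connected (W n)"
      using W(1,2) connected_open_path_connected simply_connected_imp_connected by blast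
    then obtain c where "path c" "path_image c \<subseteq> W n" "pathstart c = g1 (t n)" "pathfinish c = g2 (t n)"
      using gW[of n "t n"] t01 unfolding path_connected_def by blast
    then show ?thesis
      using False by (intro exI[of _ c]) (simp add: path_def path_image_def pathstart_def pathfinish_def)
  qed
  then obtain c :: "nat \<Rightarrow> real \<Rightarrow> complex" where c': "\<And>n. continuous_on {0..1} (c n) \<and> c n ` {0..1} \<subseteq> W n \<and> c n 0 = g1 (t n) \<and> c n 1 = g2 (t n) \<and>
      (n = 0 \<longrightarrow> c n = (\<lambda>_. \<phi> 0))"
    by metis
  then have c: "\<And>n. continuous_on {0..1} (c n)" "\<And>n. c n ` {0..1} \<subseteq> W n" "\<And>n. c n 0 = g1 (t n)"
    "\<And>n. c n 1 = g2 (t n)" "c 0 = (\<lambda>_. \<phi> 0)"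
    by simp_all
  have "\<exists>F. continuous_on ({0..1} \<times> {t n..t (Suc n)}) F \<and> F ` ({0..1} \<times> {t n..t (Suc n)}) \<subseteq> W n \<and>
     (\<forall>s\<in>{0..1}. F (s, t n) = c n s \<and> F (s, t (Suc n)) = c (Suc n) s) \<and>
     (\<forall>x\<in>{t n..t (Suc n)}. F (0, x) = g1 x \<and> F (1, x) = g2 x)" for n
  proof -
    have sub: "{t n..t (Suc n)} \<subseteq> {0..<1}"
      using t01(1)[of n] t01(2)[of "Suc n"] by auto
    have gsub: "g1 ` {t n..t (Suc n)} \<subseteq> W n" "g2 ` {t n..t (Suc n)} \<subseteq> W n"
      using gW t01(2)[of "Suc n"] by (auto simp: image_subset_iff)
    have cS: "c (Suc n) ` {0..1} \<subseteq> W n"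
      using c(2)[of "Suc n"] Wn(1)[of n] by blast
    obtain F where "continuous_on ({0..1} \<times> {t n..t (Suc n)}) F" "F ` ({0..1} \<times> {t n..t (Suc n)}) \<subseteq> W n"
      "\<And>s. s \<in> {0..1} \<Longrightarrow> F (s, t n) = c n s" "\<And>s. s \<in> {0..1} \<Longrightarrow> F (s, t (Suc n)) = c (Suc n) s"
      "\<And>x. x \<in> {t n..t (Suc n)} \<Longrightarrow> F (0, x) = g1 x" "\<And>x. x \<in> {t n..t (Suc n)} \<Longrightarrow> F (1, x) = g2 x"
      using fill_square[OF W(1,2) Wn(2) c(1,2) c(1) cS continuous_on_subset[OF d1(6) sub] gsub(1)
          continuous_on_subset[OF d2(6) sub] gsub(2) c(3,4) c(3,4)] by metis
    then show ?thesis
      by (intro exI[of _ F]) simp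
  qed
  then obtain F where F: "\<And>n. continuous_on ({0..1} \<times> {t n..t (Suc n)}) (F n)"
    "\<And>n. F n ` ({0..1} \<times> {t n..t (Suc n)}) \<subseteq> W n"
    "\<And>n s. s \<in> {0..1} \<Longrightarrow> F n (s, t n) = c n s" "\<And>n s. s \<in> {0..1} \<Longrightarrow> F n (s, t (Suc n)) = c (Suc n) s"
    "\<And>n x. x \<in> {t n..t (Suc n)} \<Longrightarrow> F n (0, x) = g1 x" "\<And>n x. x \<in> {t n..t (Suc n)} \<Longrightarrow> F n (1, x) = g2 x"
    by metis
  have agree: "F n (s, t (Suc n)) = F (Suc n) (s, t (Suc n))" if "s \<in> {0..1}" for n s
    using F(3)[OF that, of "Suc n"] F(4)[OF that, of n] by simp
  obtain g where g: "continuous_on ({0..1} \<times> {0..<1}) g" "\<And>n x. x \<in> {0..1} \<times> {t n..t (Suc n)} \<Longrightarrow> g x = F n x"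
    using paste_strips[OF mono W0(2) tlim F(1) agree] by metis
  have gin: "g (s, x) \<in> W n" if s: "s \<in> {0..1}" and x: "t n \<le> x" "x < 1" for s x n
  proof -
    have "0 \<le> x"
      using t01(1)[of n] x by simp
    then obtain m where m: "t m \<le> x" "x < t (Suc m)"
      using monotone_cover[OF W0(2) tlim _ x(2)] by blast
    then have "n \<le> m"
      using x(1) strict_mono_less[OF mono, of n "Suc m"] by simp
    have "(s, x) \<in> {0..1} \<times> {t m..t (Suc m)}"
      using s m by simp
    then have "g (s, x) \<in> W m"
      using g(2) F(2)[of m] by (metis image_subset_iff)
    then show ?thesis
      using decW[OF \<open>n \<le> m\<close>] by blast
  qed
  define h where "h = (\<lambda>x. if snd x < 1 then Some (g x) else v)"
  have cont: "continuous_on ({0..1} \<times> {0..1}) (\<lambda>x. stereo (h x))"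
    unfolding continuous_on_def
  proof
    fix x :: "real \<times> real" assume x: "x \<in> {0..1} \<times> {0..1}"
    show "((\<lambda>x. stereo (h x)) \<longlongrightarrow> stereo (h x)) (at x within {0..1} \<times> {0..1})"
    proof (cases "snd x < 1")
      case True
      have "continuous_on ({0..1} \<times> {0..<1}) (\<lambda>x. stereo (Some (g x)))"
        using g(1) by (simp only: continuous_on_stereo_Some_iff)
      also have "?this \<longleftrightarrow> continuous_on ({0..1} \<times> {0..<1}) (\<lambda>x. stereo (h x))"
        by (rule continuous_on_cong) (auto simp: h_def)
      finally have "((\<lambda>x. stereo (h x)) \<longlongrightarrow> stereo (h x)) (at x within {0..1} \<times> {0..<1})"
        using x True by (cases x) (auto simp: continuous_on_def)
      moreover have "at x within {0..1} \<times> {0..1} = at x within {0..1} \<times> {0..<1}"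
      proof (rule at_within_nhd)
        show "x \<in> UNIV \<times> {..<1}" "open (UNIV \<times> {..<1} :: (real \<times> real) set)"
          using True by (cases x; simp add: open_Times)+
      qed auto
      ultimately show ?thesis
        by simp
    next
      case False
      then have x1: "snd x = 1" "h x = v"
        using x by (auto simp: h_def)
      show ?thesis
      proof (rule tendstoI)
        fix e :: real assume "e > 0"
        \<comment> \<open>Continuity at time 1: after \<open>t n\<close> all values with time below
          1 lie in \<open>W n\<close>, within 1 / n of \<open>v\<close>.\<close>
        then obtain n where n: "0 < n" "1 / real n < e"
          by (metis nat_approx_posE zero_less_Suc)
        have "open (UNIV \<times> {t n<..} :: (real \<times> real) set)" "x \<in> UNIV \<times> {t n<..}"
          using x1 t01(2)[of n] by (cases x; simp add: open_Times)+
        then have "\<forall>\<^sub>F y in at x within {0..1} \<times> {0..1}. y \<in> UNIV \<times> {t n<..}"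
          by (rule topological_tendstoD[OF tendsto_ident_at])
        moreover have "\<forall>\<^sub>F y in at x within {0..1} \<times> {0..1}. y \<in> {0..1} \<times> {0..1}"
          by (simp add: eventually_at_filter)
        ultimately show "\<forall>\<^sub>F y in at x within {0..1} \<times> {0..1}. dist (stereo (h y)) (stereo (h x)) < e"
        proof eventually_elim
          case (elim y)
          show ?case
          proof (cases "snd y < 1")
            case True
            then have "g y \<in> W n"
              using gin[of "fst y" n "snd y"] elim by (cases y) auto
            then have "dist (stereo (Some (g y))) (stereo v) < 1 / real n"
              using Wd n(1) by blast
            then show ?thesis
              using True n(2) x1 by (simp add: h_def)
          qed (use x1 \<open>e > 0\<close> in \<open>simp add: h_def\<close>)
        qed
      qed
    qed
  qed
  have hU: "h (s, x) \<in> Some ` U" if "s \<in> {0..1}" "0 \<le> x" "x < 1" for s x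
    using gin[OF that(1), of 0 x] that W0 by (simp add: h_def)
  have h01: "h (0, x) = \<gamma>1 x" "h (1, x) = \<gamma>2 x" if "x \<in> {0..1}" for x
  proof -
    have "h (0, x) = \<gamma>1 x \<and> h (1, x) = \<gamma>2 x"
    proof (cases "x < 1")
      case True
      have "0 \<le> x"
        using that by simp
      then obtain m where m: "t m \<le> x" "x < t (Suc m)"
        using monotone_cover[OF W0(2) tlim _ True] by blast
      then have "g (0, x) = g1 x" "g (1, x) = g2 x"
        using g(2)[of _ m] F(5,6)[of x m] by simp_all
      then show ?thesis
        using True d1(2)[of x] d2(2)[of x] that by (simp add: h_def)
    next
      case False
      then show ?thesis
        using that d1(5) d2(5) by (auto simp: h_def)
    qed
    then show "h (0, x) = \<gamma>1 x" "h (1, x) = \<gamma>2 x"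
      by auto
  qed
  have acc: "access_curve U (\<phi> 0) v (\<lambda>x. h (s, x))" if s: "s \<in> {0..1}" for s
    unfolding access_curve_def pathin_riemann_sphere_iff
  proof (intro conjI)
    show "continuous_on {0..1} (\<lambda>x. stereo (h (s, x)))"
      by (rule continuous_on_compose2[OF cont]) (use s in \<open>auto intro!: continuous_intros\<close>)
    show "(\<lambda>x. h (s, x)) ` {0..<1} \<subseteq> Some ` U"
      by (intro image_subsetI hU s) auto
    have "g (s, 0) = \<phi> 0"
      using g(2)[of "(s, 0)" 0] F(3)[OF s, of 0] W0(2) Wn(2)[of 0] c(5) s by simp
    then show "h (s, 0) = Some (\<phi> 0)"
      by (simp add: h_def)
    show "h (s, 1) = v"
      by (simp add: h_def)
  qed
  have "h ` ({0..1} \<times> {0..1}) \<subseteq> Some ` U \<union> {v}"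
  proof (rule image_subsetI)
    fix x :: "real \<times> real" assume "x \<in> {0..1} \<times> {0..1}"
    then show "h x \<in> Some ` U \<union> {v}"
      using hU[of "fst x" "snd x"] by (cases "snd x < 1") (auto simp: h_def)
  qed
  then show ?thesis
    unfolding access_homotopic_iff using cont h01 acc by (intro exI[of _ h]) simp
qed

end

section \<open>The correspondence with circle points\<close>

lemma lands_at_iff: "lands_at \<gamma> v \<longleftrightarrow> ((\<lambda>t. stereo (Some (\<gamma> t))) \<longlongrightarrow> stereo v) (at_left 1)"
  by (simp add: lands_at_def limitin_riemann_sphere_iff)

lemma access_curve_close_curve:
  assumes c: "continuous_on {0..<1} g" and U: "g ` {0..<1} \<subseteq> U" and l: "lands_at g v"
  shows "access_curve U (g 0) v (close_curve v g)"
  unfolding access_curve_def pathin_riemann_sphere_iff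
proof (intro conjI)
  show "close_curve v g ` {0..<1} \<subseteq> Some ` U"
    using U by (auto simp: close_curve_def image_subset_iff)
  show "close_curve v g 0 = Some (g 0)" "close_curve v g 1 = v"
    by (simp_all add: close_curve_def)
  show "continuous_on {0..1} (\<lambda>t. stereo (close_curve v g t))"
    unfolding continuous_on_def
  proof
    fix t :: real assume t: "t \<in> {0..1}"
    show "((\<lambda>t. stereo (close_curve v g t)) \<longlongrightarrow> stereo (close_curve v g t)) (at t within {0..1})"
    proof (cases "t < 1")
      case True
      have "continuous_on {0..<1} (\<lambda>t. stereo (Some (g t)))"
        using c by (simp only: continuous_on_stereo_Some_iff)
      also have "?this \<longleftrightarrow> continuous_on {0..<1} (\<lambda>t. stereo (close_curve v g t))"
        by (rule continuous_on_cong) (auto simp: close_curve_def)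
      finally have "((\<lambda>t. stereo (close_curve v g t)) \<longlongrightarrow> stereo (close_curve v g t)) (at t within {0..<1})"
        using t True by (simp add: continuous_on_def)
      moreover have "at t within {0..1} = at t within {0..<1}"
        by (rule at_within_nhd[of _ "{..<1}"]) (use True in auto)
      ultimately show ?thesis
        by simp
    next
      case False
      then have t1: "t = 1"
        using t by simp
      have "((\<lambda>t. stereo (Some (g t))) \<longlongrightarrow> stereo v) (at_left 1)"
        using l by (simp add: lands_at_iff)
      moreover have "\<forall>\<^sub>F t in at_left 1. stereo (Some (g t)) = stereo (close_curve v g t)"
        by (auto simp: eventually_at_filter close_curve_def)
      ultimately have "((\<lambda>t. stereo (close_curve v g t)) \<longlongrightarrow> stereo v) (at_left 1)"
        by (rule Lim_transform_eventually)
      then show ?thesis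
        unfolding t1 by (simp add: at_within_Icc_at_left close_curve_def)
    qed
  qed
qed

text \<open>The second curve is only known to be continuous before its landing time, so this is not
  a join of two paths.\<close>

lemma continuous_on_joinpaths_half_open:
  fixes \<alpha> g :: "real \<Rightarrow> 'a::topological_space"
  assumes "path \<alpha>" "continuous_on {0..<1} g" "pathfinish \<alpha> = g 0"
  shows "continuous_on {0..<1} (\<alpha> +++ g)"
  unfolding joinpaths_def
proof (rule continuous_on_cases_le[where h = "\<lambda>x. x"])
  show "continuous_on {x \<in> {0..<1}. x \<le> 1 / 2} (\<lambda>x. \<alpha> (2 * x))"
    using assms(1) unfolding path_def
    by (rule continuous_on_compose2) (auto intro!: continuous_intros)
  show "continuous_on {x \<in> {0..<1}. 1 / 2 \<le> x} (\<lambda>x. g (2 * x - 1))"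
    by (rule continuous_on_compose2[OF assms(2)]) (auto intro!: continuous_intros)
  show "\<alpha> (2 * x) = g (2 * x - 1)" if "x = 1 / 2" for x
    unfolding that using assms(3) by (simp add: pathfinish_def)
qed (intro continuous_intros)

lemma joinpaths_half_open_image:
  assumes "path_image \<alpha> \<subseteq> U" "g ` {0..<1} \<subseteq> U"
  shows "(\<alpha> +++ g) ` {0..<1} \<subseteq> U"
proof (rule image_subsetI)
  fix x :: real assume x: "x \<in> {0..<1}"
  show "(\<alpha> +++ g) x \<in> U"
  proof (cases "x \<le> 1 / 2")
    case True
    then have "\<alpha> (2 * x) \<in> path_image \<alpha>"
      using x by (auto simp: path_image_def)
    then show ?thesis
      using True assms(1) by (auto simp: joinpaths_def)
  next
    case False
    then have "g (2 * x - 1) \<in> g ` {0..<1}"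
      using x by (intro imageI) auto
    then show ?thesis
      using False assms(2) by (auto simp: joinpaths_def)
  qed
qed

text \<open>Beyond time 1/2 the join is \<open>g\<close> at double speed, so the initial path does
  not affect the limit.\<close>

lemma tendsto_joinpaths_at_left:
  fixes l :: "'b::topological_space"
  shows "((\<lambda>t. h ((\<alpha> +++ g) t)) \<longlongrightarrow> l) (at_left 1) \<longleftrightarrow> ((\<lambda>t. h (g t)) \<longlongrightarrow> l) (at_left 1)"
proof -
  have "\<forall>\<^sub>F t in at_left 1. t \<in> {1/2<..<1::real}"
    by (intro eventually_at_left_real) auto
  then have "\<forall>\<^sub>F t in at_left 1. h ((\<alpha> +++ g) t) = h (g (2 * t - 1))"
    by eventually_elim (simp add: joinpaths_def)
  then have "((\<lambda>t. h ((\<alpha> +++ g) t)) \<longlongrightarrow> l) (at_left 1) \<longleftrightarrow> ((\<lambda>t. h (g (2 * t - 1))) \<longlongrightarrow> l) (at_left 1)"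
    by (rule tendsto_cong)
  then show ?thesis
    using tendsto_at_left_reparam[of "\<lambda>t. h (g t)" l] by simp
qed

context riemann_mapping
begin

text \<open>The landing point of the preimage curve. For access curves to a point outside
  \<open>U\<close> it exists by \<open>curve_lands\<close>, and limits are unique.\<close>

definition point_of :: "(real \<Rightarrow> complex option) \<Rightarrow> complex" where
  "point_of \<gamma> = (THE \<zeta>. (lift \<gamma> \<longlongrightarrow> \<zeta>) (at_left 1))"

text \<open>For a point \<zeta> where \<phi> has the radial limit \<open>v\<close> this turns out to
  be the access that corresponds to \<zeta>.\<close>

definition access_at :: "complex option \<Rightarrow> complex \<Rightarrow> (real \<Rightarrow> complex option) set" where
  "access_at v \<zeta> = {\<gamma>. access_curve U (\<phi> 0) v \<gamma> \<and> point_of \<gamma> = \<zeta>}"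

lemma point_of_eqI:
  assumes "(lift \<gamma> \<longlongrightarrow> \<zeta>) (at_left 1)"
  shows "point_of \<gamma> = \<zeta>"
  unfolding point_of_def
proof (rule the_equality)
  show "(lift \<gamma> \<longlongrightarrow> \<zeta>) (at_left 1)"
    by (rule assms)
  show "\<xi> = \<zeta>" if "(lift \<gamma> \<longlongrightarrow> \<xi>) (at_left 1)" for \<xi>
    using tendsto_unique[OF trivial_limit_at_left_real that assms] .
qed

lemma point_of:
  assumes "access_curve U (\<phi> 0) v \<gamma>" "v \<notin> Some ` U"
  shows "cmod (point_of \<gamma>) = 1" "(lift \<gamma> \<longlongrightarrow> point_of \<gamma>) (at_left 1)"
proof -
  note d = access_curveD[OF assms(1)]
  obtain \<zeta> where "cmod \<zeta> = 1" "(lift \<gamma> \<longlongrightarrow> \<zeta>) (at_left 1)"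
    using curve_lands[OF d(7,8,10) assms(2)] by blast
  then show "cmod (point_of \<gamma>) = 1" "(lift \<gamma> \<longlongrightarrow> point_of \<gamma>) (at_left 1)"
    using point_of_eqI by auto
qed

lemma access_homotopic_iff_point_of:
  assumes v: "v \<notin> Some ` U" and a: "access_curve U (\<phi> 0) v \<gamma>" "access_curve U (\<phi> 0) v \<gamma>'"
  shows "access_homotopic U (\<phi> 0) v \<gamma> \<gamma>' \<longleftrightarrow> point_of \<gamma> = point_of \<gamma>'"
proof
  assume "access_homotopic U (\<phi> 0) v \<gamma> \<gamma>'"
  then show "point_of \<gamma> = point_of \<gamma>'"
    using homotopic_imp_same_point[OF v] point_of(2)[OF a(1) v] point_of(2)[OF a(2) v] by blast
next
  assume "point_of \<gamma> = point_of \<gamma>'"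
  then show "access_homotopic U (\<phi> 0) v \<gamma> \<gamma>'"
    using same_point_imp_homotopic[OF v a point_of[OF a(1) v]] point_of(2)[OF a(2) v] by simp
qed

text \<open>By \<open>access_homotopic_iff_point_of\<close> the homotopy classes are the nonempty
  fibres of \<open>point_of\<close>.\<close>

lemma accesses_eq:
  assumes v: "v \<notin> Some ` U"
  shows "accesses U (\<phi> 0) v = (\<lambda>\<gamma>. access_at v (point_of \<gamma>)) ` {\<gamma>. access_curve U (\<phi> 0) v \<gamma>}"
proof -
  have "{(\<gamma>, \<gamma>'). access_curve U (\<phi> 0) v \<gamma> \<and> access_curve U (\<phi> 0) v \<gamma>' \<and> access_homotopic U (\<phi> 0) v \<gamma> \<gamma>'} `` {\<gamma>} =
      access_at v (point_of \<gamma>)" if "access_curve U (\<phi> 0) v \<gamma>" for \<gamma>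
    using that access_homotopic_iff_point_of[OF v that] by (auto simp: access_at_def)
  then show ?thesis
    unfolding accesses_def quotient_def by auto
qed

lemma has_radial_limit_iff: "has_radial_limit \<phi> \<zeta> v \<longleftrightarrow> ((\<lambda>t. \<Phi> (of_real t * \<zeta>)) \<longlongrightarrow> stereo v) (at_left 1)"
  by (simp add: has_radial_limit_def lands_at_iff \<Phi>_def)

lemma lift_close_curve: "t < 1 \<Longrightarrow> lift (close_curve v g) t = \<psi> (g t)"
  by (simp add: lift_def close_curve_def)

lemma tendsto_lift_close_curve:
  "(lift (close_curve v g) \<longlongrightarrow> \<zeta>) (at_left 1) \<longleftrightarrow> ((\<lambda>t. \<psi> (g t)) \<longlongrightarrow> \<zeta>) (at_left 1)"
  by (rule tendsto_cong) (auto simp: eventually_at_filter lift_close_curve)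

lemma radial_curve:
  assumes "cmod \<zeta> = 1"
  shows "continuous_on {0..<1} (\<lambda>t. of_real t * \<zeta>)" "(\<lambda>t. of_real t * \<zeta>) ` {0..<1} \<subseteq> ball 0 1"
    "((\<lambda>t. of_real t * \<zeta>) \<longlongrightarrow> \<zeta>) (at_left 1)"
proof -
  show "continuous_on {0..<1} (\<lambda>t. of_real t * \<zeta>)"
    by (intro continuous_intros)
  show "(\<lambda>t. of_real t * \<zeta>) ` {0..<1} \<subseteq> ball 0 1"
    using assms by (auto simp: norm_mult)
  have "((\<lambda>t. of_real t * \<zeta>) \<longlongrightarrow> of_real 1 * \<zeta>) (at_left 1)"
    by (intro tendsto_intros)
  then show "((\<lambda>t. of_real t * \<zeta>) \<longlongrightarrow> \<zeta>) (at_left 1)"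
    by simp
qed

lemma curve_image:
  assumes "continuous_on {0..<1} \<eta>" "\<eta> ` {0..<1} \<subseteq> ball 0 1"
  shows "continuous_on {0..<1} (\<lambda>t. \<phi> (\<eta> t))" "(\<lambda>t. \<phi> (\<eta> t)) ` {0..<1} \<subseteq> U"
  using assms \<phi>_in_U by (auto intro!: continuous_on_compose2[OF continuous_on_\<phi> assms(1)])

lemma tendsto_\<psi>_\<phi>:
  fixes \<eta> :: "real \<Rightarrow> complex"
  assumes "\<eta> ` {0..<1} \<subseteq> ball 0 1" "(\<eta> \<longlongrightarrow> \<zeta>) (at_left 1)"
  shows "((\<lambda>t. \<psi> (\<phi> (\<eta> t))) \<longlongrightarrow> \<zeta>) (at_left 1)"
proof (rule Lim_transform_eventually[OF assms(2)])
  have "\<forall>\<^sub>F t in at_left 1. t \<in> {0<..<1::real}"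
    by (intro eventually_at_left_real) auto
  then show "\<forall>\<^sub>F t in at_left 1. \<eta> t = \<psi> (\<phi> (\<eta> t))"
  proof eventually_elim
    case (elim t)
    then have "\<eta> t \<in> ball 0 1"
      using assms(1) unfolding image_subset_iff by simp
    then show ?case
      by (simp add: \<psi>_\<phi>)
  qed
qed

text \<open>The image of the radius itself, closed up by \<open>v\<close>, is an access curve, so
  every point with radial limit \<open>v\<close> is reached.\<close>

lemma access_at_radial:
  assumes \<zeta>: "cmod \<zeta> = 1" and r: "has_radial_limit \<phi> \<zeta> v"
  obtains \<gamma> where "access_curve U (\<phi> 0) v \<gamma>" "point_of \<gamma> = \<zeta>"
proof
  define g where "g t = \<phi> (of_real t * \<zeta>)" for t :: real
  have g: "continuous_on {0..<1} g" "g ` {0..<1} \<subseteq> U" "lands_at g v" "g 0 = \<phi> 0"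
    using curve_image[OF radial_curve(1,2)[OF \<zeta>]] r by (auto simp: g_def[abs_def] has_radial_limit_def)
  then show "access_curve U (\<phi> 0) v (close_curve v g)"
    using access_curve_close_curve[OF g(1-3)] by simp
  show "point_of (close_curve v g) = \<zeta>"
    using tendsto_\<psi>_\<phi>[OF radial_curve(2,3)[OF \<zeta>]]
    by (intro point_of_eqI) (simp add: tendsto_lift_close_curve g_def)
qed

text \<open>This is where Lindeloef's theorem turns an arbitrary landing curve into a radial
  limit.\<close>

lemma radial_limit_point_of:
  assumes a: "access_curve U (\<phi> 0) v \<gamma>" and v: "v \<notin> Some ` U"
  shows "has_radial_limit \<phi> (point_of \<gamma>) v"
  unfolding has_radial_limit_iff
  using lindelof[OF access_curveD(7,8)[OF a] point_of[OF a v] access_curveD(10)[OF a]] .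

lemma in_access_imp_tendsto:
  assumes i: "in_access U (\<phi> 0) v \<gamma> (access_at v \<zeta>)" and v: "v \<notin> Some ` U"
  shows "((\<lambda>t. \<psi> (\<gamma> t)) \<longlongrightarrow> \<zeta>) (at_left 1)"
proof (cases "\<gamma> 0 = \<phi> 0")
  case True
  then have "access_curve U (\<phi> 0) v (close_curve v \<gamma>)" "point_of (close_curve v \<gamma>) = \<zeta>"
    using i by (auto simp: in_access_def access_at_def)
  then show ?thesis
    using point_of(2)[OF _ v] tendsto_lift_close_curve by blast
next
  case False
  then obtain \<alpha> where "access_curve U (\<phi> 0) v (close_curve v (\<alpha> +++ \<gamma>))" "point_of (close_curve v (\<alpha> +++ \<gamma>)) = \<zeta>"
    using i by (auto simp: in_access_def access_at_def)
  then have "((\<lambda>t. \<psi> ((\<alpha> +++ \<gamma>) t)) \<longlongrightarrow> \<zeta>) (at_left 1)"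
    using point_of(2)[OF _ v] tendsto_lift_close_curve by blast
  then show ?thesis
    by (simp only: tendsto_joinpaths_at_left)
qed

text \<open>If the image curve does not start at \<open_point>\<open>\<phi> 0\<close>, a path in
  \<open>U\<close> is put in front of it; this changes neither its landing point nor that of its
  preimage.\<close>

lemma curve_in_access_at:
  fixes \<eta> :: "real \<Rightarrow> complex"
  assumes \<eta>: "continuous_on {0..<1} \<eta>" "\<eta> ` {0..<1} \<subseteq> ball 0 1" "(\<eta> \<longlongrightarrow> \<zeta>) (at_left 1)"
    and l: "lands_at (\<lambda>t. \<phi> (\<eta> t)) v"
  shows "in_access U (\<phi> 0) v (\<lambda>t. \<phi> (\<eta> t)) (access_at v \<zeta>)"
proof -
  note c = curve_image[OF \<eta>(1,2)]
  note t = tendsto_\<psi>_\<phi>[OF \<eta>(2,3)]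
  show ?thesis
  proof (cases "\<phi> (\<eta> 0) = \<phi> 0")
    case True
    have "point_of (close_curve v (\<lambda>t. \<phi> (\<eta> t))) = \<zeta>"
      by (rule point_of_eqI) (use t in \<open>simp only: tendsto_lift_close_curve\<close>)
    then show ?thesis
      using c l True access_curve_close_curve[OF c l] by (simp add: in_access_def curve_in_def access_at_def)
  next
    case False
    have U: "\<phi> 0 \<in> U" "\<phi> (\<eta> 0) \<in> U"
      using c(2) \<phi>_in_U by (auto simp: image_subset_iff)
    have "path_connected U"
      using open_U conn_U connected_open_path_connected by blast
    then obtain \<alpha> where \<alpha>: "path \<alpha>" "path_image \<alpha> \<subseteq> U" "pathstart \<alpha> = \<phi> 0" "pathfinish \<alpha> = \<phi> (\<eta> 0)"
      using U unfolding path_connected_def by blast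
    define g where "g = \<alpha> +++ (\<lambda>t. \<phi> (\<eta> t))"
    have g: "continuous_on {0..<1} g" "g ` {0..<1} \<subseteq> U"
      unfolding g_def using continuous_on_joinpaths_half_open[OF \<alpha>(1) c(1) \<alpha>(4)] joinpaths_half_open_image[OF \<alpha>(2) c(2)] by auto
    have lg: "lands_at g v"
      using l unfolding lands_at_iff g_def tendsto_joinpaths_at_left[of "\<lambda>x. stereo (Some x)"] .
    have "g 0 = \<phi> 0"
      using \<alpha>(3) by (simp add: g_def joinpaths_def pathstart_def)
    then have "access_curve U (\<phi> 0) v (close_curve v g)"
      using access_curve_close_curve[OF g lg] by simp
    moreover have "point_of (close_curve v g) = \<zeta>"
      by (rule point_of_eqI) (use t in \<open>simp only: tendsto_lift_close_curve g_def tendsto_joinpaths_at_left\<close>)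
    ultimately have "close_curve v g \<in> access_at v \<zeta>"
      by (simp add: access_at_def)
    then show ?thesis
      using False c l \<alpha> unfolding in_access_def curve_in_def g_def by auto
  qed
qed

lemma accesses_eq_radial:
  assumes v: "v \<notin> Some ` U"
  shows "accesses U (\<phi> 0) v = access_at v ` {\<zeta> \<in> sphere 0 1. has_radial_limit \<phi> \<zeta> v}"
proof -
  have "point_of ` {\<gamma>. access_curve U (\<phi> 0) v \<gamma>} = {\<zeta> \<in> sphere 0 1. has_radial_limit \<phi> \<zeta> v}"
  proof (intro equalityI subsetI)
    fix \<zeta> assume "\<zeta> \<in> point_of ` {\<gamma>. access_curve U (\<phi> 0) v \<gamma>}"
    then show "\<zeta> \<in> {\<zeta> \<in> sphere 0 1. has_radial_limit \<phi> \<zeta> v}"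
      using point_of(1)[OF _ v] radial_limit_point_of[OF _ v] by auto
  next
    fix \<zeta> assume "\<zeta> \<in> {\<zeta> \<in> sphere 0 1. has_radial_limit \<phi> \<zeta> v}"
    then have "cmod \<zeta> = 1" "has_radial_limit \<phi> \<zeta> v"
      by auto
    then show "\<zeta> \<in> point_of ` {\<gamma>. access_curve U (\<phi> 0) v \<gamma>}"
      using access_at_radial by (metis (mono_tags, lifting) image_eqI mem_Collect_eq)
  qed
  then show ?thesis
    unfolding accesses_eq[OF v] by (metis image_image)
qed

text \<open>\<open>access_at v \<zeta>\<close> is nonempty by \<open>access_at_radial\<close>, and
  any member of it determines \<zeta>.\<close>

lemma inj_on_access_at: "inj_on (access_at v) {\<zeta> \<in> sphere 0 1. has_radial_limit \<phi> \<zeta> v}"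
proof (rule inj_onI)
  fix \<zeta> \<xi> assume \<zeta>: "\<zeta> \<in> {\<zeta> \<in> sphere 0 1. has_radial_limit \<phi> \<zeta> v}" and eq: "access_at v \<zeta> = access_at v \<xi>"
  then obtain \<gamma> where "access_curve U (\<phi> 0) v \<gamma>" "point_of \<gamma> = \<zeta>"
    using access_at_radial[of \<zeta> v] by auto
  then have "\<gamma> \<in> access_at v \<xi>"
    using eq by (auto simp: access_at_def)
  then show "\<zeta> = \<xi>"
    using \<open>point_of \<gamma> = \<zeta>\<close> by (simp add: access_at_def)
qed

lemma bij_betw_access_at:
  assumes "v \<notin> Some ` U"
  shows "bij_betw (access_at v) {\<zeta> \<in> sphere 0 1. has_radial_limit \<phi> \<zeta> v} (accesses U (\<phi> 0) v)"
  using inj_on_access_at accesses_eq_radial[OF assms] by (simp add: bij_betw_def)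

end

section \<open>Null chains and prime ends\<close>

text \<open>The real supremum bounds its elements only for sets that are bounded above; compactness
  of the sphere provides the bound.\<close>

lemma dist_le_spherical_diameter:
  assumes "z \<in> C" "w \<in> C"
  shows "dist (stereo (Some z)) (stereo (Some w)) \<le> spherical_diameter C"
  unfolding spherical_diameter_def dist_stereo_Some[symmetric]
proof (rule cSUP_upper2[where x = "(z, w)"])
  obtain B where B: "\<And>p q. dist (stereo p) (stereo q) \<le> B"
    using compact_imp_bounded[OF compact_range_stereo] unfolding bounded_two_points by blast
  show "bdd_above ((\<lambda>(z, w). dist (stereo (Some z)) (stereo (Some w))) ` (C \<times> C))"
    by (rule bdd_aboveI[of _ B]) (use B in auto)
qed (use assms in auto)

lemma spherical_diameter_le:
  assumes "C \<noteq> {}" "\<And>z w. z \<in> C \<Longrightarrow> w \<in> C \<Longrightarrow> dist (stereo (Some z)) (stereo (Some w)) \<le> e"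
  shows "spherical_diameter C \<le> e"
  unfolding spherical_diameter_def dist_stereo_Some[symmetric]
  by (rule cSUP_least) (use assms in auto)

lemma spherical_diameter_nonneg:
  assumes "C \<noteq> {}"
  shows "0 \<le> spherical_diameter C"
proof -
  obtain z where "z \<in> C"
    using assms by blast
  then show ?thesis
    using dist_le_spherical_diameter[of z C z] by simp
qed

lemma crosscutE:
  assumes "crosscut U C" "open U"
  obtains g :: "real \<Rightarrow> complex option" where "continuous_on {0..1} (\<lambda>t. stereo (g t))" "inj_on g {0<..<1}" "g ` {0<..<1} = Some ` C"
    "g 0 \<notin> Some ` U" "g 1 \<notin> Some ` U" "C \<subseteq> U"
  using assms unfolding crosscut_def pathin_riemann_sphere_iff by (metis sphere_boundary_iff)

lemma limit_crosscut_end: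
  fixes g :: "real \<Rightarrow> complex option"
  assumes c: "continuous_on {0..1} (\<lambda>t. stereo (g t))" and i: "g ` {0<..<1} = Some ` C"
  shows "stereo (g 0) \<in> closure (stereo ` Some ` C)" "stereo (g 1) \<in> closure (stereo ` Some ` C)"
proof -
  have "(\<lambda>t. stereo (g t)) ` closure {0<..<1} \<subseteq> closure ((\<lambda>t. stereo (g t)) ` {0<..<1})"
    using c by (intro image_closure_subset) (simp_all add: closure_subset)
  also have "(\<lambda>t. stereo (g t)) ` {0<..<1} = stereo ` Some ` C"
    unfolding i[symmetric] by (simp add: image_image)
  finally show "stereo (g 0) \<in> closure (stereo ` Some ` C)" "stereo (g 1) \<in> closure (stereo ` Some ` C)"
    by (simp_all add: image_subset_iff)
qed

context riemann_mapping
begin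

definition pull :: "complex set \<Rightarrow> complex set" where
  "pull K = ball 0 1 \<inter> \<phi> -` K"

lemma pull_eq: "K \<subseteq> U \<Longrightarrow> pull K = \<psi> ` K"
  using \<psi>_in_ball \<phi>_\<psi> \<psi>_\<phi> by (force simp: pull_def)

lemma image_pull: "K \<subseteq> U \<Longrightarrow> \<phi> ` pull K = K"
  using image by (auto simp: pull_def)

lemma connected_pull: "K \<subseteq> U \<Longrightarrow> connected K \<Longrightarrow> connected (pull K)"
  by (simp add: pull_eq connected_continuous_image continuous_on_subset[OF continuous_on_\<psi>])

lemma pull_subset_ball: "pull K \<subseteq> ball 0 1"
  by (auto simp: pull_def)

lemma pull_mono: "K \<subseteq> L \<Longrightarrow> pull K \<subseteq> pull L"
  by (auto simp: pull_def)

text \<open>The second half of the crosscut, reparametrised over [0,1), is a curve landing outside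
  \<open>U\<close>, so \<open>curve_lands\<close> and \<open>lindelof\<close> apply to its preimage.
  The other end is handled later by reversing the crosscut.\<close>

lemma crosscut_lands:
  fixes g :: "real \<Rightarrow> complex option"
  assumes c: "continuous_on {0..1} (\<lambda>t. stereo (g t))" and i: "g ` {0<..<1} \<subseteq> Some ` U" and g1: "g 1 \<notin> Some ` U"
  obtains b where "cmod b = 1" "((\<lambda>t. \<psi> (the (g t))) \<longlongrightarrow> b) (at_left 1)"
    "((\<lambda>t. \<Phi> (of_real t * b)) \<longlongrightarrow> stereo (g 1)) (at_left 1)"
proof -
  have gt: "g t = Some (the (g t))" "the (g t) \<in> U" if "0 < t" "t < 1" for t
  proof -
    have "g t \<in> Some ` U"
      using i that by (auto simp: image_subset_iff)
    then show "g t = Some (the (g t))" "the (g t) \<in> U"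
      by auto
  qed
  define \<eta> where "\<eta> t = \<psi> (the (g ((1 + t) / 2)))" for t
  have h: "0 < (1 + t) / 2" "(1 + t) / 2 < 1" if "t \<in> {0..<1}" for t :: real
    using that by auto
  have \<Phi>\<eta>: "\<Phi> (\<eta> t) = stereo (g ((1 + t) / 2))" if "t \<in> {0..<1}" for t
    using gt[OF h[OF that]] by (simp add: \<eta>_def \<Phi>_def \<phi>_\<psi>)
  have "continuous_on {0..<1} (\<lambda>t. stereo (g ((1 + t) / 2)))"
    by (rule continuous_on_compose2[OF c]) (auto intro!: continuous_intros)
  also have "?this \<longleftrightarrow> continuous_on {0..<1} (\<lambda>t. stereo (Some (the (g ((1 + t) / 2)))))"
    by (rule continuous_on_cong[OF refl]) (use gt(1)[OF h] in simp)
  finally have c2: "continuous_on {0..<1} (\<lambda>t. the (g ((1 + t) / 2)))"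
    by (simp only: continuous_on_stereo_Some_iff)
  have c\<eta>: "continuous_on {0..<1} \<eta>"
    unfolding \<eta>_def by (rule continuous_on_compose2[OF continuous_on_\<psi> c2]) (use gt(2)[OF h] in auto)
  have s\<eta>: "\<eta> ` {0..<1} \<subseteq> ball 0 1"
    unfolding \<eta>_def by (intro image_subsetI \<psi>_in_ball gt(2) h)
  have "((\<lambda>t. stereo (g t)) \<longlongrightarrow> stereo (g 1)) (at 1 within {0..1})"
    using c by (auto simp: continuous_on_def)
  then have lg: "((\<lambda>t. stereo (g t)) \<longlongrightarrow> stereo (g 1)) (at_left 1)"
    by (simp add: at_within_Icc_at_left)
  have ev: "\<forall>\<^sub>F t in at_left 1. t \<in> {1/2<..<1::real}"
    by (intro eventually_at_left_real) auto
  have "\<forall>\<^sub>F t in at_left 1. stereo (g t) = \<Phi> (\<eta> (2 * t - 1))"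
    using ev by eventually_elim (subst \<Phi>\<eta>, auto)
  then have "((\<lambda>t. \<Phi> (\<eta> (2 * t - 1))) \<longlongrightarrow> stereo (g 1)) (at_left 1)"
    using lg by (rule Lim_transform_eventually[rotated])
  then have l\<eta>: "((\<lambda>t. \<Phi> (\<eta> t)) \<longlongrightarrow> stereo (g 1)) (at_left 1)"
    using tendsto_at_left_reparam[of "\<lambda>t. \<Phi> (\<eta> t)"] by simp
  obtain b where b: "cmod b = 1" "(\<eta> \<longlongrightarrow> b) (at_left 1)"
    using curve_lands[OF c\<eta> s\<eta> l\<eta> g1] .
  show ?thesis
  proof
    show "cmod b = 1" "((\<lambda>t. \<Phi> (of_real t * b)) \<longlongrightarrow> stereo (g 1)) (at_left 1)"
      using b lindelof[OF c\<eta> s\<eta> b l\<eta>] by auto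
    have "((\<lambda>t. \<eta> (2 * t - 1)) \<longlongrightarrow> b) (at_left 1)"
      using b(2) tendsto_at_left_reparam[of \<eta>] by simp
    then show "((\<lambda>t. \<psi> (the (g t))) \<longlongrightarrow> b) (at_left 1)"
      by (simp add: \<eta>_def)
  qed
qed

text \<open>The preimage of a crosscut accumulates on the circle only at the landing points of its
  two ends, and there \<phi> has the end of the crosscut as radial limit. Hence two crosscuts with
  disjoint closures cannot both accumulate at \<zeta>.\<close>

lemma crosscut_end_limit:
  assumes cc: "crosscut U C" and \<zeta>: "cmod \<zeta> = 1" "\<zeta> \<in> closure (pull C)"
  obtains p where "p \<in> riemann_sphere closure_of (Some ` C)" "((\<lambda>t. \<Phi> (of_real t * \<zeta>)) \<longlongrightarrow> stereo p) (at_left 1)"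
proof -
  obtain g :: "real \<Rightarrow> complex option" where g: "continuous_on {0..1} (\<lambda>t. stereo (g t))" "inj_on g {0<..<1}" "g ` {0<..<1} = Some ` C"
    "g 0 \<notin> Some ` U" "g 1 \<notin> Some ` U" "C \<subseteq> U"
    using crosscutE[OF cc open_U] .
  have gU: "g ` {0<..<1} \<subseteq> Some ` U"
    using g(3,6) by auto
  obtain b where b: "cmod b = 1" "((\<lambda>t. \<psi> (the (g t))) \<longlongrightarrow> b) (at_left 1)"
    "((\<lambda>t. \<Phi> (of_real t * b)) \<longlongrightarrow> stereo (g 1)) (at_left 1)"
    using crosscut_lands[OF g(1) gU g(5)] .
  define g' where "g' t = g (1 - t)" for t
  have img': "g' ` {0<..<1} = g ` {0<..<1}"
  proof -
    have "(\<lambda>t. 1 - t) ` {0<..<1} = {0<..<1::real}"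
      by (auto simp: image_iff intro!: bexI[of _ "1 - _"])
    then show ?thesis
      unfolding g'_def by (metis image_image)
  qed
  have "continuous_on {0..1} (\<lambda>t. stereo (g' t))"
    unfolding g'_def by (rule continuous_on_compose2[OF g(1)]) (auto intro!: continuous_intros)
  then obtain a where a: "cmod a = 1" "((\<lambda>t. \<psi> (the (g' t))) \<longlongrightarrow> a) (at_left 1)"
    "((\<lambda>t. \<Phi> (of_real t * a)) \<longlongrightarrow> stereo (g' 1)) (at_left 1)"
    using crosscut_lands[of g'] img' gU g(4) by (auto simp: g'_def)
  obtain z where z: "\<And>n. z n \<in> pull C" "z \<longlonglongrightarrow> \<zeta>"
    using \<zeta>(2) closure_sequential by blast
  have "\<exists>u\<in>{0<..<1}. z n = \<psi> (the (g u))" for n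
  proof -
    have "Some (\<phi> (z n)) \<in> g ` {0<..<1}"
      using z(1)[of n] g(3) by (auto simp: pull_def)
    then obtain u where "u \<in> {0<..<1}" "g u = Some (\<phi> (z n))"
      by force
    then show ?thesis
      using z(1)[of n] by (intro bexI[of _ u]) (auto simp: pull_def \<psi>_\<phi>)
  qed
  then obtain u where u: "\<And>n. u n \<in> {0<..<1}" "\<And>n. z n = \<psi> (the (g (u n)))"
    by metis
  have "seq_compact {0..1::real}"
    by (simp add: compact_eq_seq_compact_metric[symmetric])
  then obtain l s where l: "l \<in> {0..1}" "strict_mono (s :: nat \<Rightarrow> nat)" "(u \<circ> s) \<longlonglongrightarrow> l"
    using u(1) by (force elim!: seq_compactE[where f = u] simp: less_imp_le)
  have zs: "(\<lambda>n. \<psi> (the (g (u (s n))))) \<longlonglongrightarrow> \<zeta>"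
    using LIMSEQ_subseq_LIMSEQ[OF z(2) l(2)] by (simp add: o_def u(2))
  have us: "(\<lambda>n. u (s n)) \<longlonglongrightarrow> l"
    using l(3) by (simp add: o_def)
  consider "l = 0" | "l = 1" | "0 < l" "l < 1"
    using l(1) by fastforce
  then show ?thesis
  proof cases
    case 1
    have "(\<lambda>n. 1 - u (s n)) \<longlonglongrightarrow> 1"
      using tendsto_diff[OF tendsto_const[of 1] us] 1 by simp
    then have "filterlim (\<lambda>n. 1 - u (s n)) (at_left 1) sequentially"
      unfolding filterlim_at using u(1) by (auto intro!: always_eventually simp: less_le)
    then have "(\<lambda>n. \<psi> (the (g' (1 - u (s n))))) \<longlonglongrightarrow> a"
      by (rule filterlim_compose[OF a(2)])
    then have "\<zeta> = a"
      using zs LIMSEQ_unique by (fastforce simp: g'_def)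
    moreover have "g 0 \<in> riemann_sphere closure_of (Some ` C)"
      using limit_crosscut_end[OF g(1,3)] by (simp add: closure_of_riemann_sphere_iff)
    ultimately show ?thesis
      using that[of "g 0"] a(3) by (simp add: g'_def)
  next
    case 2
    have "filterlim (\<lambda>n. u (s n)) (at_left 1) sequentially"
      unfolding filterlim_at using u(1) us 2 by (auto intro!: always_eventually simp: less_le)
    then have "(\<lambda>n. \<psi> (the (g (u (s n))))) \<longlonglongrightarrow> b"
      by (rule filterlim_compose[OF b(2)])
    then have "\<zeta> = b"
      using zs LIMSEQ_unique by blast
    moreover have "g 1 \<in> riemann_sphere closure_of (Some ` C)"
      using limit_crosscut_end[OF g(1,3)] by (simp add: closure_of_riemann_sphere_iff)
    ultimately show ?thesis
      using that[of "g 1"] b(3) by simp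
  next
    \<comment> \<open>A limit parameter inside (0,1) gives a limit in \<open>U\<close>, whose
      preimage lies in the open disc and not on the circle.\<close>
    case 3
    have gt: "g t \<in> Some ` U" if "t \<in> {0<..<1}" for t
      using gU that by blast
    have "(\<lambda>n. stereo (g (u (s n)))) \<longlonglongrightarrow> stereo (g l)"
      using us by (rule continuous_on_tendsto_compose[OF g(1)]) (use l(1) u(1) in \<open>auto intro!: always_eventually less_imp_le simp: less_imp_le\<close>)
    moreover obtain w where w: "g l = Some w" "w \<in> U"
      using gt[of l] 3 by auto
    moreover have "g (u (s n)) = Some (the (g (u (s n))))" for n
      using gt[OF u(1), of "s n"] by auto
    ultimately have "(\<lambda>n. stereo (Some (the (g (u (s n)))))) \<longlonglongrightarrow> stereo (Some w)"
      by simp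
    then have lw: "(\<lambda>n. the (g (u (s n)))) \<longlonglongrightarrow> w"
      by (simp only: tendsto_stereo_Some_iff)
    have "isCont \<psi> w"
      using continuous_on_\<psi> open_U w(2) by (simp add: continuous_on_eq_continuous_at)
    from isCont_tendsto_compose[OF this lw] have "\<psi> w = \<zeta>"
      using zs LIMSEQ_unique by blast
    then show ?thesis
      using \<psi>_in_ball[OF w(2)] \<zeta>(1) by simp
  qed
qed

text \<open>For the openness: within \<open>U\<close> the crosscut agrees with the compact arc that
  includes its ends, because the ends lie outside \<open>U\<close>.\<close>

lemma crosscut_connected:
  assumes "crosscut U C"
  shows "connected C" "C \<noteq> {}" "C \<subseteq> U" "open (U - C)"
proof -
  obtain g :: "real \<Rightarrow> complex option" where g: "continuous_on {0..1} (\<lambda>t. stereo (g t))" "inj_on g {0<..<1}" "g ` {0<..<1} = Some ` C"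
    "g 0 \<notin> Some ` U" "g 1 \<notin> Some ` U" "C \<subseteq> U"
    using crosscutE[OF assms open_U] .
  have gC: "g t = Some (the (g t)) \<and> the (g t) \<in> C" if "t \<in> {0<..<1}" for t
  proof -
    have "g t \<in> Some ` C"
      using g(3) that by blast
    then show ?thesis
      by auto
  qed
  have "continuous_on {0<..<1} (\<lambda>t. stereo (g t))"
    by (rule continuous_on_subset[OF g(1)]) auto
  also have "?this \<longleftrightarrow> continuous_on {0<..<1} (\<lambda>t. stereo (Some (the (g t))))"
    by (rule continuous_on_cong[OF refl]) (use gC in simp)
  finally have "continuous_on {0<..<1} (\<lambda>t. the (g t))"
    by (simp only: continuous_on_stereo_Some_iff)
  then have "connected ((\<lambda>t. the (g t)) ` {0<..<1})"
    by (intro connected_continuous_image) auto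
  moreover have "(\<lambda>t. the (g t)) ` {0<..<1} = the ` Some ` C"
    unfolding g(3)[symmetric] by (simp add: image_image)
  ultimately show "connected C"
    by (simp add: image_image)
  have "(1/2 :: real) \<in> {0<..<1}"
    by simp
  then have "g (1/2) \<in> g ` {0<..<1}"
    by (rule imageI)
  then show "C \<noteq> {}"
    unfolding g(3) by auto
  show "C \<subseteq> U"
    by (rule g(6))
  define K where "K = (\<lambda>t. stereo (g t)) ` {0..1}"
  have "closed K"
    unfolding K_def by (intro compact_imp_closed compact_continuous_image g(1) compact_Icc)
  then have "open ((\<lambda>w. stereo (Some w)) -` (- K))"
    by (intro open_vimage continuous_on_stereo_Some) auto
  moreover have "U - C = U \<inter> (\<lambda>w. stereo (Some w)) -` (- K)"
  proof -
    have "w \<in> C \<longleftrightarrow> stereo (Some w) \<in> K" if w: "w \<in> U" for w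
    proof
      assume "w \<in> C"
      then have "Some w \<in> g ` {0<..<1}"
        using g(3) by simp
      then show "stereo (Some w) \<in> K"
        unfolding K_def by force
    next
      assume "stereo (Some w) \<in> K"
      then obtain t where t: "t \<in> {0..1}" "g t = Some w"
        unfolding K_def by (auto simp: image_iff)
      then have "t \<noteq> 0" "t \<noteq> 1"
        using g(4,5) w by auto
      then show "w \<in> C"
        using gC[of t] t by auto
    qed
    then show ?thesis
      by blast
  qed
  ultimately show "open (U - C)"
    using open_U by auto
qed

context
  fixes C :: "nat \<Rightarrow> complex set"
  assumes nc: "null_chain U C"
begin

lemma cc: "crosscut U (C n)"
  using nc by (simp add: null_chain_def)

lemma chain_closures: "(riemann_sphere closure_of (Some ` C n)) \<inter> (riemann_sphere closure_of (Some ` C (Suc n))) = {}"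
  using nc by (simp add: null_chain_def)

lemma chain_diameter: "(\<lambda>n. spherical_diameter (C n)) \<longlonglongrightarrow> 0"
  using nc by (simp add: null_chain_def)

lemma chain_disjoint: "C n \<inter> C (Suc n) = {}"
proof -
  have "w \<notin> C (Suc n)" if "w \<in> C n" for w
  proof
    assume "w \<in> C (Suc n)"
    then have "Some w \<in> riemann_sphere closure_of (Some ` C n)" "Some w \<in> riemann_sphere closure_of (Some ` C (Suc n))"
      using that closure_subset by (fastforce simp: closure_of_riemann_sphere_iff)+
    then show False
      using chain_closures by blast
  qed
  then show ?thesis
    by blast
qed

text \<open>\<open>C (Suc n)\<close> is connected, nonempty and disjoint from \<open>C n\<close>, so
  it lies in exactly one component; this justifies the definite description in the
  definition.\<close>

lemma chain_domain:
  "chain_domain U C n \<in> components (U - C n)" "C (Suc n) \<subseteq> chain_domain U C n"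
proof -
  have "C (Suc n) \<subseteq> U - C n"
    using chain_disjoint[of n] crosscut_connected(3)[OF cc] by blast
  then obtain K where K: "K \<in> components (U - C n)" "C (Suc n) \<subseteq> K"
    using exists_component_superset[OF _ _ crosscut_connected(1)[OF cc]] crosscut_connected(2)[OF cc] by (metis subset_empty)
  have *: "L = K" if "L \<in> components (U - C n)" "C (Suc n) \<subseteq> L" for L
    using components_nonoverlap[OF that(1) K(1)] that(2) K(2) crosscut_connected(2)[OF cc[of "Suc n"]] by blast
  have "chain_domain U C n = K"
    unfolding chain_domain_def by (rule the_equality) (use K * in blast)+
  then show "chain_domain U C n \<in> components (U - C n)" "C (Suc n) \<subseteq> chain_domain U C n"
    using K by auto
qed

lemma chain_domain_subset: "chain_domain U C n \<subseteq> U"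
  using in_components_subset[OF chain_domain(1)] by blast

lemma chain_domain_connected: "connected (chain_domain U C n)"
  using in_components_connected[OF chain_domain(1)] .

text \<open>By the separation clause of a null chain, the component containing
  \<open>C (Suc (Suc n))\<close> differs from the one containing \<open>C n\<close>.\<close>

lemma chain_domain_Suc_disjoint: "chain_domain U C (Suc n) \<inter> C n = {}"
proof -
  obtain K L where KL: "K \<in> components (U - C (Suc n))" "L \<in> components (U - C (Suc n))" "K \<noteq> L"
    "C n \<subseteq> K" "C (Suc (Suc n)) \<subseteq> L"
    using nc unfolding null_chain_def separates_in_def by blast
  have "chain_domain U C (Suc n) = L"
    using components_nonoverlap[OF chain_domain(1)[of "Suc n"] KL(2)] chain_domain(2)[of "Suc n"] KL(5)
      crosscut_connected(2)[OF cc[of "Suc (Suc n)"]] by blast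
  then show ?thesis
    using components_nonoverlap[OF KL(1,2)] KL(3,4) by blast
qed

text \<open>The later domain has a frontier point in \<open>U\<close>, being neither empty nor all
  of \<open>U\<close>. This point lies on \<open>C (Suc n)\<close>, hence in the earlier domain,
  which is open; so the two domains meet. As the later one is connected and avoids
  \<open>C n\<close>, it is contained in the earlier one.\<close>

lemma chain_domain_Suc_subset: "chain_domain U C (Suc n) \<subseteq> chain_domain U C n"
proof -
  let ?K = "chain_domain U C (Suc n)"
  have oU: "open (U - C (Suc n))"
    by (rule crosscut_connected(4)[OF cc])
  have oK: "open ?K"
    using open_components[OF oU chain_domain(1)] .
  have "?K \<noteq> {}"
    using chain_domain(2)[of "Suc n"] crosscut_connected(2)[OF cc[of "Suc (Suc n)"]] by blast
  moreover have "\<not> U \<subseteq> ?K"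
    using chain_domain_Suc_disjoint[of n] crosscut_connected(2,3)[OF cc[of n]] by blast
  ultimately have "U \<inter> frontier ?K \<noteq> {}"
    using connected_Int_frontier[OF conn_U, of ?K] chain_domain_subset[of "Suc n"] by blast
  then obtain x where x: "x \<in> U" "x \<in> frontier ?K"
    by blast
  have "x \<in> frontier (U - C (Suc n))"
    using frontier_of_components_subset[OF chain_domain(1)] x(2) by blast
  then have "x \<in> C (Suc n)"
    using oU x(1) by (auto simp: frontier_def interior_open)
  then have xK: "x \<in> chain_domain U C n"
    using chain_domain(2) by blast
  have oKn: "open (chain_domain U C n)"
    using open_components[OF crosscut_connected(4)[OF cc] chain_domain(1)] .
  have "chain_domain U C n \<inter> ?K \<noteq> {}"
    using xK x(2) open_Int_closure_eq_empty[OF oKn, of ?K] by (auto simp: frontier_def)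
  then show ?thesis
    using components_maximal[OF chain_domain(1) chain_domain_connected, of "Suc n" n]
      chain_domain_subset[of "Suc n"] chain_domain_Suc_disjoint[of n] by blast
qed

lemma chain_domain_antimono: "m \<le> n \<Longrightarrow> chain_domain U C n \<subseteq> chain_domain U C m"
  by (rule lift_Suc_antimono_le[of "chain_domain U C", OF chain_domain_Suc_subset])

lemma chain_subset_domain: "m < n \<Longrightarrow> C n \<subseteq> chain_domain U C m"
  using chain_domain(2)[of "n - 1"] chain_domain_antimono[of m "n - 1"] by fastforce

lemma chain_domain_disjoint_0: "0 < n \<Longrightarrow> chain_domain U C n \<inter> C 0 = {}"
  using chain_domain_Suc_disjoint[of 0] chain_domain_antimono[of 1 n] by fastforce

text \<open>The ends of a crosscut lie outside \<open>U\<close>, and the image of the closed disc of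
  radius \<open>s\<close> has a positive distance from the complement of \<open>U\<close> in the
  sphere. A crosscut of smaller diameter cannot reach that image.\<close>

lemma chain_escapes:
  assumes s: "s < 1"
  shows "\<forall>\<^sub>F n in sequentially. \<forall>z\<in>pull (C n). s < cmod z"
proof -
  obtain V where V: "open V" "Some ` U = stereo -` V"
    using open_Some_image_vimage[OF open_U] .
  have "compact (\<Phi> ` cball 0 s)"
    using s by (intro compact_continuous_image continuous_on_subset[OF continuous_on_\<Phi>]) auto
  moreover have "closed (range stereo - V)"
    using V(1) compact_imp_closed[OF compact_range_stereo] by (rule closed_Diff[rotated])
  moreover have "\<Phi> ` cball 0 s \<inter> (range stereo - V) = {}"
  proof -
    have "\<Phi> z \<in> V" if "z \<in> cball 0 s" for z
    proof -
      have "Some (\<phi> z) \<in> stereo -` V"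
        unfolding V(2)[symmetric] using that s by (intro imageI \<phi>_in_U) auto
      then show ?thesis
        by (simp add: \<Phi>_def)
    qed
    then show ?thesis
      by blast
  qed
  ultimately obtain d where d: "d > 0" "\<And>x y. x \<in> \<Phi> ` cball 0 s \<Longrightarrow> y \<in> range stereo - V \<Longrightarrow> d \<le> dist x y"
    using separate_compact_closed by metis
  have "\<forall>\<^sub>F n in sequentially. spherical_diameter (C n) < d"
    using chain_diameter d(1) by (rule order_tendstoD)
  then show ?thesis
  proof eventually_elim
    case (elim n)
    obtain g :: "real \<Rightarrow> complex option" where g: "continuous_on {0..1} (\<lambda>t. stereo (g t))" "inj_on g {0<..<1}" "g ` {0<..<1} = Some ` C n"
      "g 0 \<notin> Some ` U" "g 1 \<notin> Some ` U" "C n \<subseteq> U"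
      using crosscutE[OF cc open_U] .
    have "s < cmod z" if z: "z \<in> pull (C n)" for z
    proof (rule ccontr)
      assume "\<not> s < cmod z"
      then have "z \<in> cball 0 s"
        by simp
      moreover have "stereo (g 0) \<in> range stereo - V"
        using g(4) V(2) by auto
      ultimately have "d \<le> dist (\<Phi> z) (stereo (g 0))"
        using d(2) by blast
      moreover have "dist (\<Phi> z) (stereo (g 0)) \<le> spherical_diameter (C n)"
      proof -
        have "stereo ` Some ` C n \<subseteq> cball (\<Phi> z) (spherical_diameter (C n))"
          using z dist_le_spherical_diameter[of "\<phi> z" "C n"] by (auto simp: pull_def \<Phi>_def)
        then have "closure (stereo ` Some ` C n) \<subseteq> cball (\<Phi> z) (spherical_diameter (C n))"
          by (rule closure_minimal) simp
        then show ?thesis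
          using limit_crosscut_end(1)[OF g(1,3)] by auto
      qed
      ultimately show False
        using elim by simp
    qed
    then show ?case
      by blast
  qed
qed

text \<open>Along a subsequence the images of chosen points converge to some \<open>p\<close>, which
  is outside \<open>U\<close> by \<open>chain_escapes\<close>. As the diameters tend to 0, whole
  crosscuts approach \<open>p\<close>, and \<open>koebe\<close> applies to their preimages.\<close>

lemma chain_pull_small:
  assumes e: "e > 0"
  shows "\<forall>\<^sub>F n in sequentially. \<forall>z\<in>pull (C n). \<forall>w\<in>pull (C n). dist z w < e"
proof (rule ccontr)
  assume "\<not> ?thesis"
  from not_eventually_sequentiallyD[OF this]
  obtain r :: "nat \<Rightarrow> nat" where r: "strict_mono r" "\<And>n. \<not> (\<forall>z\<in>pull (C (r n)). \<forall>w\<in>pull (C (r n)). dist z w < e)"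
    by blast
  have "\<exists>z. z \<in> pull (C n)" for n
    using crosscut_connected(2,3)[OF cc[of n]] pull_eq[of "C n"] by auto
  then obtain x where x: "\<And>n. x n \<in> pull (C n)"
    by metis
  obtain p s where s: "strict_mono (s :: nat \<Rightarrow> nat)" "(\<lambda>n. stereo (Some (\<phi> (x (r (s n)))))) \<longlonglongrightarrow> stereo p"
    using stereo_convergent_subseq[of "\<lambda>n. Some (\<phi> (x (r n)))"] by metis
  define k where "k n = r (s n)" for n
  have k: "strict_mono k"
    using strict_mono_o[OF r(1) s(1)] by (simp add: k_def[abs_def] o_def)
  have lim: "(\<lambda>n. \<Phi> (x (k n))) \<longlonglongrightarrow> stereo p"
    using s(2) by (simp add: \<Phi>_def k_def)
  have xb: "x n \<in> ball 0 1" for n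
    using x[of n] by (simp add: pull_def)
  have "(\<lambda>n. cmod (x (k n))) \<longlonglongrightarrow> 1"
  proof (rule order_tendstoI)
    fix a :: real assume "a < 1"
    have "\<forall>\<^sub>F n in sequentially. \<forall>z\<in>pull (C (k n)). a < cmod z"
      by (rule eventually_subseq[OF k chain_escapes[OF \<open>a < 1\<close>]])
    then show "\<forall>\<^sub>F n in sequentially. a < cmod (x (k n))"
      by eventually_elim (use x in blast)
  next
    fix a :: real assume "1 < a"
    then show "\<forall>\<^sub>F n in sequentially. cmod (x (k n)) < a"
      using xb by (intro always_eventually) (auto intro: order.strict_trans)
  qed
  then have p: "p \<notin> Some ` U"
    using limit_not_in_U[OF sequentially_bot _ _ lim] xb by auto
  have "\<forall>\<^sub>F n in sequentially. \<forall>z\<in>pull (C (k n)). \<forall>w\<in>pull (C (k n)). dist z w < e"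
  proof (rule koebe[OF _ pull_subset_ball p _ e])
    show "connected (pull (C (k n)))" for n
      by (intro connected_pull crosscut_connected[OF cc])
    fix d :: real assume "d > 0"
    then have d2: "d / 2 > 0"
      by simp
    have "(\<lambda>n. spherical_diameter (C (k n))) \<longlonglongrightarrow> 0"
      using LIMSEQ_subseq_LIMSEQ[OF chain_diameter k] by (simp add: o_def)
    then have "\<forall>\<^sub>F n in sequentially. spherical_diameter (C (k n)) < d / 2"
      using d2 by (rule order_tendstoD)
    then show "\<forall>\<^sub>F n in sequentially. \<forall>z\<in>pull (C (k n)). dist (\<Phi> z) (stereo p) < d"
      using tendstoD[OF lim d2]
    proof eventually_elim
      case (elim n)
      have "dist (\<Phi> z) (stereo p) < d" if z: "z \<in> pull (C (k n))" for z
      proof -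
        have "dist (\<Phi> z) (\<Phi> (x (k n))) \<le> spherical_diameter (C (k n))"
          unfolding \<Phi>_def using z x[of "k n"] by (intro dist_le_spherical_diameter) (auto simp: pull_def)
        then show ?thesis
          using elim dist_triangle[of "\<Phi> z" "stereo p" "\<Phi> (x (k n))"] by linarith
      qed
      then show ?case
        by blast
    qed
  qed
  then obtain n where "\<forall>z\<in>pull (C (k n)). \<forall>w\<in>pull (C (k n)). dist z w < e"
    by (auto simp: eventually_sequentially)
  then show False
    using r(2)[of "s n"] by (simp add: k_def)
qed

text \<open>A small crosscut of the disc lies in a small cap, whose complement in the disc is convex and
  therefore on one side of the crosscut; that side contains \<open>C 0\<close>.\<close>

lemma chain_domain_in_cap:
  assumes \<delta>: "\<delta> > 0"
  shows "\<forall>\<^sub>F n in sequentially. \<exists>\<xi>. cmod \<xi> = 1 \<and> (\<forall>z\<in>pull (chain_domain U C n). 1 - \<delta> < Re (z * cnj \<xi>))"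
proof -
  obtain x0 where x0: "x0 \<in> pull (C 0)"
    using crosscut_connected(2,3)[OF cc[of 0]] pull_eq[of "C 0"] by auto
  then have x0b: "cmod x0 < 1"
    by (simp add: pull_def)
  \<comment> \<open>At most \<delta>, and small enough that the point \<open>x0\<close> of the
    preimage of \<open>C 0\<close> stays outside the cap.\<close>
  define e where "e = min \<delta> ((1 - cmod x0) / 2)"
  have e: "e > 0" "e \<le> \<delta>" "cmod x0 < 1 - e"
    using \<delta> x0b by (auto simp: e_def min_def field_simps)
  \<comment> \<open>Half of \<open>e\<close> is for the distance of a chosen point of the pulled
    back crosscut from the circle, half for the diameter of that crosscut.\<close>
  have e2: "1 - e / 2 < 1" "0 < e / 2"
    using e by simp_all
  show ?thesis
    using chain_escapes[OF e2(1)] chain_pull_small[OF e2(2)] eventually_gt_at_top[of 0]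
  proof eventually_elim
    case (elim n)
    obtain z0 where z0: "z0 \<in> pull (C n)"
      using crosscut_connected(2,3)[OF cc[of n]] pull_eq[of "C n"] by auto
    then have z0n: "1 - e / 2 < cmod z0"
      using elim by blast
    moreover have "e < 1"
      using e(3) norm_ge_zero[of x0] by linarith
    ultimately have "z0 \<noteq> 0"
      by auto
    define \<xi> where "\<xi> = z0 / of_real (cmod z0)"
    have \<xi>: "cmod \<xi> = 1"
      using \<open>z0 \<noteq> 0\<close> by (simp add: \<xi>_def norm_divide)
    have "z0 * cnj \<xi> = of_real (cmod z0)"
      using \<open>z0 \<noteq> 0\<close> by (simp add: \<xi>_def complex_norm_square[symmetric] power2_eq_square)
    then have Re0: "Re (z0 * cnj \<xi>) = cmod z0"
      by simp
    have T: "1 - e < Re (z * cnj \<xi>)" if "z \<in> pull (C n)" for z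
    proof -
      have "dist z z0 < e / 2"
        using elim that z0 by blast
      moreover have "\<bar>Re ((z - z0) * cnj \<xi>)\<bar> \<le> cmod (z - z0)"
        using abs_Re_le_cmod[of "(z - z0) * cnj \<xi>"] \<xi> by (simp add: norm_mult)
      moreover have "Re (z * cnj \<xi>) = Re (z0 * cnj \<xi>) + Re ((z - z0) * cnj \<xi>)"
        by (simp add: left_diff_distrib)
      ultimately show ?thesis
        using Re0 z0n unfolding dist_norm by linarith
    qed
    define B where "B = ball 0 1 \<inter> {z. Re (z * cnj \<xi>) \<le> 1 - e}"
    have "{z. Re (z * cnj \<xi>) \<le> 1 - e} = {z. inner \<xi> z \<le> 1 - e}"
      by (simp add: inner_complex_def mult.commute)
    then have "convex {z. Re (z * cnj \<xi>) \<le> 1 - e}"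
      by (simp only: convex_halfspace_le)
    then have "convex B"
      unfolding B_def by (intro convex_Int convex_ball)
    have BT: "B \<inter> pull (C n) = {}"
      using T by (force simp: B_def)
    have "connected (\<phi> ` B)"
      by (intro connected_continuous_image convex_connected[OF \<open>convex B\<close>] continuous_on_subset[OF continuous_on_\<phi>])
         (auto simp: B_def)
    moreover have "\<phi> ` B \<subseteq> U - C n"
      using BT \<phi>_in_U by (auto simp: B_def pull_def)
    moreover have x0B: "x0 \<in> B"
    proof -
      have "Re (x0 * cnj \<xi>) \<le> cmod x0"
        using complex_Re_le_cmod[of "x0 * cnj \<xi>"] \<xi> by (simp add: norm_mult)
      then show ?thesis
        using e(3) x0b by (simp add: B_def)
    qed
    moreover have "\<phi> x0 \<notin> chain_domain U C n"
      using chain_domain_disjoint_0[of n] elim x0 by (auto simp: pull_def)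
    ultimately have "chain_domain U C n \<inter> \<phi> ` B = {}"
      using components_maximal[OF chain_domain(1), of "\<phi> ` B" n] by blast
    then have "1 - e < Re (z * cnj \<xi>)" if "z \<in> pull (chain_domain U C n)" for z
      using that by (fastforce simp: pull_def B_def not_le)
    then show ?case
      using \<xi> e(2) by fastforce
  qed
qed

text \<open>A cap of height \<delta> lies within sqrt (2 \<delta>) of its top \<xi>, since |z -
  \<xi>|^2 <= 2 - 2 Re (z cnj \<xi>) in the closed disc. So the nested closures have diameters
  tending to 0 and a single common point, on the circle.\<close>

theorem chain_shrinks:
  obtains \<zeta> where "cmod \<zeta> = 1" "(\<Inter>n. closure (pull (chain_domain U C n))) = {\<zeta>}"
    "\<And>e. e > 0 \<Longrightarrow> \<forall>\<^sub>F n in sequentially. pull (chain_domain U C n) \<subseteq> ball \<zeta> e"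
proof -
  define P where "P n = closure (pull (chain_domain U C n))" for n
  have mono: "P n \<subseteq> P m" if "m \<le> n" for m n
    unfolding P_def by (intro closure_mono pull_mono chain_domain_antimono that)
  have cap: "\<forall>\<^sub>F n in sequentially. \<exists>\<xi>. cmod \<xi> = 1 \<and> (\<forall>z\<in>P n. 1 - \<delta> \<le> Re (z * cnj \<xi>) \<and> cmod z \<le> 1)" if \<delta>: "\<delta> > 0" for \<delta>
    using chain_domain_in_cap[OF \<delta>]
  proof eventually_elim
    case (elim n)
    then obtain \<xi> where \<xi>: "cmod \<xi> = 1" "\<And>z. z \<in> pull (chain_domain U C n) \<Longrightarrow> 1 - \<delta> < Re (z * cnj \<xi>)"
      by blast
    have "closed {z. 1 - \<delta> \<le> Re (z * cnj \<xi>)}"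
      by (intro closed_Collect_le continuous_intros)
    then have "closed ({z. 1 - \<delta> \<le> Re (z * cnj \<xi>)} \<inter> cball 0 1)"
      by (intro closed_Int closed_cball)
    moreover have "pull (chain_domain U C n) \<subseteq> {z. 1 - \<delta> \<le> Re (z * cnj \<xi>)} \<inter> cball 0 1"
      using \<xi>(2) pull_subset_ball by (fastforce intro: less_imp_le)
    ultimately have "P n \<subseteq> {z. 1 - \<delta> \<le> Re (z * cnj \<xi>)} \<inter> cball 0 1"
      unfolding P_def by (rule closure_minimal[rotated])
    then have "\<forall>z\<in>P n. 1 - \<delta> \<le> Re (z * cnj \<xi>) \<and> cmod z \<le> 1"
      by (auto simp: subset_iff)
    then show ?case
      using \<xi>(1) by blast
  qed
  have near: "(dist z \<xi>)\<^sup>2 \<le> 2 * \<delta>" if "cmod \<xi> = 1" "1 - \<delta> \<le> Re (z * cnj \<xi>)" "cmod z \<le> 1" for z \<xi> \<delta>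
  proof -
    have "(dist z \<xi>)\<^sup>2 = (cmod z)\<^sup>2 + (cmod \<xi>)\<^sup>2 - 2 * Re (z * cnj \<xi>)"
      unfolding dist_norm cmod_power2 by (simp add: power2_eq_square algebra_simps)
    moreover have "(cmod z)\<^sup>2 \<le> 1"
      using that(3) by (simp add: power_le_one)
    ultimately show ?thesis
      using that(1,2) by simp
  qed
  have small: "\<forall>\<^sub>F n in sequentially. \<forall>z\<in>P n. \<forall>w\<in>P n. dist z w < e" if e: "e > 0" for e
  proof -
    \<comment> \<open>With this height every point of the closed cap is within e / 3 of the top, so
      any two are less than \<open>e\<close> apart.\<close>
    have "(e / 3)\<^sup>2 / 2 > 0"
      using e by simp
    from cap[OF this] show ?thesis
    proof eventually_elim
      case (elim n)
      then obtain \<xi> where \<xi>: "cmod \<xi> = 1" "\<And>z. z \<in> P n \<Longrightarrow> 1 - (e / 3)\<^sup>2 / 2 \<le> Re (z * cnj \<xi>) \<and> cmod z \<le> 1"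
        by blast
      have P3: "dist z \<xi> \<le> e / 3" if "z \<in> P n" for z
      proof (rule power2_le_imp_le)
        show "(dist z \<xi>)\<^sup>2 \<le> (e / 3)\<^sup>2"
          using near[OF \<xi>(1), of "(e / 3)\<^sup>2 / 2" z] \<xi>(2)[OF that] by simp
      qed (use e in simp)
      then have "dist z w < e" if "z \<in> P n" "w \<in> P n" for z w
        using that(1)[THEN P3] that(2)[THEN P3] dist_triangle2[of z w \<xi>] e by simp
      then show ?case
        by blast
    qed
  qed
  have ne: "P n \<noteq> {}" for n
  proof -
    have "chain_domain U C n \<noteq> {}"
      using chain_domain(2)[of n] crosscut_connected(2)[OF cc[of "Suc n"]] by blast
    then have "pull (chain_domain U C n) \<noteq> {}"
      using pull_eq[OF chain_domain_subset] by simp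
    then show ?thesis
      by (simp add: P_def)
  qed
  have "\<exists>a. \<Inter>(range P) = {a}"
  proof (rule decreasing_closed_nest_sing)
    show "\<exists>n. \<forall>x\<in>P n. \<forall>y\<in>P n. dist x y < e" if "e > 0" for e
      using small[OF that] by (auto simp: eventually_sequentially)
  qed (use ne mono in \<open>auto simp: P_def\<close>)
  then obtain \<zeta> where \<zeta>: "(\<Inter>n. P n) = {\<zeta>}"
    by blast
  then have \<zeta>P: "\<zeta> \<in> P n" for n
    by blast
  have "cmod \<zeta> = 1"
  proof (rule antisym)
    obtain n \<xi> where "\<forall>z\<in>P n. 1 - 1 \<le> Re (z * cnj \<xi>) \<and> cmod z \<le> 1"
      using cap[of 1] by (auto simp: eventually_sequentially)
    then show "cmod \<zeta> \<le> 1"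
      using \<zeta>P by blast
    show "1 \<le> cmod \<zeta>"
    proof (rule field_le_epsilon)
      fix e :: real assume "e > 0"
      then obtain n \<xi> where n: "cmod \<xi> = 1" "\<forall>z\<in>P n. 1 - e \<le> Re (z * cnj \<xi>) \<and> cmod z \<le> 1"
        using cap[of e] by (auto simp: eventually_sequentially)
      then have "1 - e \<le> Re (\<zeta> * cnj \<xi>)"
        using \<zeta>P by blast
      also have "\<dots> \<le> cmod \<zeta>"
        using complex_Re_le_cmod[of "\<zeta> * cnj \<xi>"] n(1) by (simp add: norm_mult)
      finally show "1 \<le> cmod \<zeta> + e"
        by simp
    qed
  qed
  moreover have "\<forall>\<^sub>F n in sequentially. pull (chain_domain U C n) \<subseteq> ball \<zeta> e" if "e > 0" for e
    using small[OF that]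
  proof eventually_elim
    case (elim n)
    then show ?case
      using \<zeta>P[of n] closure_subset[of "pull (chain_domain U C n)"] by (auto simp: P_def)
  qed
  ultimately show ?thesis
    using that \<zeta> by (simp add: P_def)
qed

text \<open>Two successive crosscuts have disjoint closures, so by \<open>crosscut_end_limit\<close>
  the preimage of one of them, with index \<open>m\<close> or \<open>Suc m\<close>, stays away from
  \<zeta>. A small half disc at \<zeta> is convex, hence on one side of it, and \<zeta> being in the
  closure of the pulled back domain decides which side.\<close>

lemma half_disc_in_chain_domain:
  assumes \<zeta>: "cmod \<zeta> = 1" "\<And>n. \<zeta> \<in> closure (pull (chain_domain U C n))"
  obtains k e where "m \<le> k" "e > 0" "ball 0 1 \<inter> ball \<zeta> e \<subseteq> pull (chain_domain U C k)"
proof -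
  have "\<exists>k\<in>{m, Suc m}. \<zeta> \<notin> closure (pull (C k))"
  proof (rule ccontr)
    assume "\<not> ?thesis"
    then have "\<zeta> \<in> closure (pull (C m))" "\<zeta> \<in> closure (pull (C (Suc m)))"
      by auto
    then obtain p p' where p: "p \<in> riemann_sphere closure_of (Some ` C m)" "((\<lambda>t. \<Phi> (of_real t * \<zeta>)) \<longlongrightarrow> stereo p) (at_left 1)"
      and p': "p' \<in> riemann_sphere closure_of (Some ` C (Suc m))" "((\<lambda>t. \<Phi> (of_real t * \<zeta>)) \<longlongrightarrow> stereo p') (at_left 1)"
      using crosscut_end_limit[OF cc \<zeta>(1)] by metis
    have "p = p'"
      using tendsto_unique[OF trivial_limit_at_left_real p(2) p'(2)] by simp
    then show False
      using p(1) p'(1) chain_closures by blast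
  qed
  then obtain k where k: "m \<le> k" "\<zeta> \<notin> closure (pull (C k))"
    using le_SucI by blast
  then obtain e where e: "e > 0" "ball \<zeta> e \<subseteq> - closure (pull (C k))"
    using open_contains_ball[of "- closure (pull (C k))"] by (auto simp: open_Compl)
  define B where "B = ball 0 1 \<inter> ball \<zeta> e"
  have BT: "B \<inter> pull (C k) = {}"
    using e(2) closure_subset by (fastforce simp: B_def)
  have "connected (\<phi> ` B)"
    unfolding B_def
    by (intro connected_continuous_image convex_connected convex_Int convex_ball continuous_on_subset[OF continuous_on_\<phi>]) auto
  moreover have "\<phi> ` B \<subseteq> U - C k"
    using BT \<phi>_in_U by (auto simp: B_def pull_def)
  moreover have "chain_domain U C k \<inter> \<phi> ` B \<noteq> {}"
  proof -
    obtain z where "z \<in> pull (chain_domain U C k)" "dist z \<zeta> < e"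
      using \<zeta>(2)[of k] e(1) by (auto simp: closure_approachable)
    then have "\<phi> z \<in> chain_domain U C k" "z \<in> B"
      by (auto simp: pull_def B_def dist_commute)
    then show ?thesis
      by blast
  qed
  ultimately have "\<phi> ` B \<subseteq> chain_domain U C k"
    by (intro components_maximal[OF chain_domain(1)])
  then have "B \<subseteq> pull (chain_domain U C k)"
    by (auto simp: B_def pull_def)
  then show ?thesis
    using that k(1) e(1) by (simp add: B_def)
qed

end

end

section \<open>Prime ends and points of the circle\<close>

context riemann_mapping
begin

definition shrinks_to :: "(nat \<Rightarrow> complex set) \<Rightarrow> complex \<Rightarrow> bool" where
  "shrinks_to C \<zeta> \<longleftrightarrow> null_chain U C \<and> (\<Inter>n. closure (pull (chain_domain U C n))) = {\<zeta>}"

lemma shrinks_toD: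
  assumes "shrinks_to C \<zeta>"
  shows "null_chain U C" "cmod \<zeta> = 1" "\<And>n. \<zeta> \<in> closure (pull (chain_domain U C n))"
    "\<And>e. e > 0 \<Longrightarrow> \<forall>\<^sub>F n in sequentially. pull (chain_domain U C n) \<subseteq> ball \<zeta> e"
proof -
  show nc: "null_chain U C"
    using assms by (simp add: shrinks_to_def)
  have eq: "(\<Inter>n. closure (pull (chain_domain U C n))) = {\<zeta>}"
    using assms by (simp add: shrinks_to_def)
  then show "\<zeta> \<in> closure (pull (chain_domain U C n))" for n
    by blast
  obtain \<xi> where \<xi>: "cmod \<xi> = 1" "(\<Inter>n. closure (pull (chain_domain U C n))) = {\<xi>}"
    "\<And>e. e > 0 \<Longrightarrow> \<forall>\<^sub>F n in sequentially. pull (chain_domain U C n) \<subseteq> ball \<xi> e"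
    using chain_shrinks[OF nc] by metis
  have "\<xi> = \<zeta>"
    using \<xi>(2) eq by simp
  then show "cmod \<zeta> = 1" "\<And>e. e > 0 \<Longrightarrow> \<forall>\<^sub>F n in sequentially. pull (chain_domain U C n) \<subseteq> ball \<zeta> e"
    using \<xi> by auto
qed

lemma null_chain_shrinks_to: "null_chain U C \<Longrightarrow> \<exists>\<zeta>. shrinks_to C \<zeta>"
  using chain_shrinks unfolding shrinks_to_def by metis

lemma shrinks_to_unique: "shrinks_to C \<zeta> \<Longrightarrow> shrinks_to C \<xi> \<Longrightarrow> \<zeta> = \<xi>"
  by (simp add: shrinks_to_def)

text \<open>The preimage of some late domain of \<open>C\<close> contains a half disc at \<zeta>,
  and the preimages of the domains of \<open>C'\<close> shrink into every such half disc.\<close>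

lemma shrinks_to_domain_subset:
  assumes C: "shrinks_to C \<zeta>" and C': "shrinks_to C' \<zeta>"
  shows "\<exists>n. chain_domain U C' n \<subseteq> chain_domain U C m"
proof -
  note d = shrinks_toD[OF C] and d' = shrinks_toD[OF C']
  obtain k e where k: "m \<le> k" "e > 0" "ball 0 1 \<inter> ball \<zeta> e \<subseteq> pull (chain_domain U C k)"
    using half_disc_in_chain_domain[OF d(1-3)] by metis
  obtain n where n: "pull (chain_domain U C' n) \<subseteq> ball \<zeta> e"
    using d'(4)[OF k(2)] by (auto simp: eventually_sequentially)
  have "pull (chain_domain U C' n) \<subseteq> pull (chain_domain U C k)"
    using n k(3) pull_subset_ball by blast
  then have "\<phi> ` pull (chain_domain U C' n) \<subseteq> \<phi> ` pull (chain_domain U C k)"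
    by (rule image_mono)
  then have "chain_domain U C' n \<subseteq> chain_domain U C k"
    by (simp add: image_pull chain_domain_subset d(1) d'(1))
  also have "\<dots> \<subseteq> chain_domain U C m"
    by (rule chain_domain_antimono[OF d(1) k(1)])
  finally show ?thesis
    by blast
qed

text \<open>The point of one of two equivalent chains lies in the closures of all pulled back
  domains of the other, hence is its point too. The converse is
  \<open>shrinks_to_domain_subset\<close>, used both ways.\<close>

lemma chain_equiv_iff: "(C, C') \<in> chain_equiv U \<longleftrightarrow> (\<exists>\<zeta>. shrinks_to C \<zeta> \<and> shrinks_to C' \<zeta>)"
proof
  assume "\<exists>\<zeta>. shrinks_to C \<zeta> \<and> shrinks_to C' \<zeta>"
  then show "(C, C') \<in> chain_equiv U"
    using shrinks_to_domain_subset shrinks_toD(1) by (auto simp: chain_equiv_def)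
next
  assume eq: "(C, C') \<in> chain_equiv U"
  then have nc: "null_chain U C" "null_chain U C'"
    by (auto simp: chain_equiv_def)
  obtain \<zeta> \<zeta>' where z: "shrinks_to C \<zeta>" "shrinks_to C' \<zeta>'"
    using null_chain_shrinks_to[OF nc(1)] null_chain_shrinks_to[OF nc(2)] by blast
  have "\<zeta>' \<in> closure (pull (chain_domain U C m))" for m
  proof -
    obtain n where "chain_domain U C' n \<subseteq> chain_domain U C m"
      using eq unfolding chain_equiv_def by blast
    then show ?thesis
      using closure_mono[OF pull_mono] shrinks_toD(3)[OF z(2), of n] by blast
  qed
  then have "\<zeta>' = \<zeta>"
    using z(1) by (auto simp: shrinks_to_def)
  then show "\<exists>\<zeta>. shrinks_to C \<zeta> \<and> shrinks_to C' \<zeta>"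
    using z by blast
qed

definition prime_end_of :: "complex \<Rightarrow> (nat \<Rightarrow> complex set) set" where
  "prime_end_of \<zeta> = {C. shrinks_to C \<zeta>}"

text \<open>Both ends of the arc tend to the circle, and limits of \<phi> along points tending to
  the circle are boundary points of \<open>U\<close>. A general filter in \<open>key\<close> covers
  the two one-sided limits at once.\<close>

lemma arc_image_ends:
  assumes \<zeta>: "cmod \<zeta> = 1" and \<rho>: "0 < \<rho>" "\<rho> \<le> 1"
    and c: "continuous_on {0..1} (\<lambda>u. stereo (g u))"
    and g: "\<And>u. u \<in> {0<..<1} \<Longrightarrow> g u = Some (\<phi> (circ_arc \<zeta> \<rho> u))"
  shows "g 0 \<in> sphere_boundary U" "g 1 \<in> sphere_boundary U"
proof -
  have key: "g x \<in> sphere_boundary U" if x: "x \<in> {0..1}" "cmod (circ_arc \<zeta> \<rho> x) = 1" and F: "F \<noteq> bot" "F \<le> at x within {0..1}"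
    "\<forall>\<^sub>F u in F. u \<in> {0<..<1}" for x :: real and F
  proof (rule limit_in_sphere_boundary[OF F(1)])
    show "\<forall>\<^sub>F u in F. circ_arc \<zeta> \<rho> u \<in> ball 0 1"
      using F(3) by eventually_elim (use circ_arc_in_ball[OF \<zeta> \<rho>] in auto)
    have "((\<lambda>u. circ_arc \<zeta> \<rho> u) \<longlongrightarrow> circ_arc \<zeta> \<rho> x) (at x within {0..1})"
      using continuous_on_circ_arc[of "{0..1}" \<zeta> \<rho>] x(1) by (auto simp: continuous_on_def)
    then have "((\<lambda>u. circ_arc \<zeta> \<rho> u) \<longlongrightarrow> circ_arc \<zeta> \<rho> x) F"
      using F(2) by (rule tendsto_mono[rotated])
    then show "((\<lambda>u. cmod (circ_arc \<zeta> \<rho> u)) \<longlongrightarrow> 1) F"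
      using tendsto_norm x(2) by fastforce
    have "((\<lambda>u. stereo (g u)) \<longlongrightarrow> stereo (g x)) (at x within {0..1})"
      using c x(1) by (auto simp: continuous_on_def)
    then have "((\<lambda>u. stereo (g u)) \<longlongrightarrow> stereo (g x)) F"
      using F(2) by (rule tendsto_mono[rotated])
    moreover have "\<forall>\<^sub>F u in F. stereo (g u) = \<Phi> (circ_arc \<zeta> \<rho> u)"
      using F(3) by eventually_elim (simp add: g \<Phi>_def)
    ultimately show "((\<lambda>u. \<Phi> (circ_arc \<zeta> \<rho> u)) \<longlongrightarrow> stereo (g x)) F"
      by (rule Lim_transform_eventually)
  qed
  show "g 0 \<in> sphere_boundary U"
    by (rule key[of 0 "at_right 0"])
       (auto simp: norm_circ_arc_ends[OF \<zeta> \<rho>] at_within_Icc_at_right eventually_at_right_real[of 0 1, unfolded greaterThanLessThan_iff])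
  show "g 1 \<in> sphere_boundary U"
    by (rule key[of 1 "at_left 1"])
       (auto simp: norm_circ_arc_ends[OF \<zeta> \<rho>] at_within_Icc_at_left eventually_at_left_real[of 0 1, unfolded greaterThanLessThan_iff])
qed

text \<open>Arcs are chosen inductively, near the given radii so that their images approach
  \<open>w\<close>. Each image is asked to keep a distance from the two ends of its predecessor:
  nested circles alone would not make the closures of the images disjoint, since different arcs may
  have images with a common end.\<close>

theorem null_chain_at:
  fixes r :: "nat \<Rightarrow> real"
  assumes \<zeta>: "cmod \<zeta> = 1" and r: "\<And>n. 0 < r n" "r \<longlonglongrightarrow> 0"
    and lim: "(\<lambda>n. \<Phi> (of_real (1 - r n) * \<zeta>)) \<longlonglongrightarrow> stereo w"
  obtains C where "shrinks_to C \<zeta>" "\<And>d. d > 0 \<Longrightarrow> \<forall>\<^sub>F n in sequentially. \<forall>z\<in>C n. dist (stereo (Some z)) (stereo w) < d"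
proof -
  define isarc where "isarc \<rho> g \<longleftrightarrow> 0 < \<rho> \<and> \<rho> \<le> 1 \<and> continuous_on {0..1} (\<lambda>u. stereo (g u)) \<and>
      (\<forall>u\<in>{0<..<1}. g u = Some (\<phi> (circ_arc \<zeta> \<rho> u)))" for \<rho> and g :: "real \<Rightarrow> complex option"
  define avoids where "avoids \<rho> p \<longleftrightarrow> (\<exists>d>0. \<forall>u\<in>{0<..<1}. d \<le> dist (\<Phi> (circ_arc \<zeta> \<rho> u)) (stereo p))" for \<rho> p
  define near where "near \<rho> e \<longleftrightarrow> (\<forall>u\<in>{0<..<1}. dist (\<Phi> (circ_arc \<zeta> \<rho> u)) (stereo w) < e)" for \<rho> e
  have step: "\<exists>\<rho> g. isarc \<rho> g \<and> \<rho> < b \<and> near \<rho> e \<and> (\<forall>p\<in>F. avoids \<rho> p)"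
    if b: "0 < b" and e: "0 < e" and F: "finite F" "F \<inter> Some ` U = {}" for b e F
  proof -
    have e3: "e / 3 > 0"
      using e by simp
    obtain \<delta> where \<delta>: "0 < \<delta>" "\<delta> \<le> 1" and arcs:
      "\<And>r F. \<lbrakk>0 < r; r < \<delta>; finite F; F \<inter> Some ` U = {}\<rbrakk> \<Longrightarrow>
        \<exists>\<rho> g. r / 2 \<le> \<rho> \<and> \<rho> \<le> r \<and> continuous_on {0..1} (\<lambda>u. stereo (g u)) \<and>
          (\<forall>u\<in>{0<..<1}. g u = Some (\<phi> (circ_arc \<zeta> \<rho> u))) \<and>
          (\<forall>u\<in>{0<..<1}. \<forall>v\<in>{0<..<1}. dist (\<Phi> (circ_arc \<zeta> \<rho> u)) (\<Phi> (circ_arc \<zeta> \<rho> v)) < e / 3) \<and>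
          (\<forall>p\<in>F. \<exists>d>0. \<forall>u\<in>{0<..<1}. d \<le> dist (\<Phi> (circ_arc \<zeta> \<rho> u)) (stereo p)) \<and>
          dist (\<Phi> (of_real (1 - \<rho>) * \<zeta>)) (\<Phi> (of_real (1 - r) * \<zeta>)) < e / 3"
      by (rule good_arcs[OF \<zeta> e3]) metis
    have "\<forall>\<^sub>F n in sequentially. r n < min \<delta> b"
      using r(2) b \<delta>(1) by (intro order_tendstoD) auto
    moreover have "\<forall>\<^sub>F n in sequentially. dist (\<Phi> (of_real (1 - r n) * \<zeta>)) (stereo w) < e / 3"
      using lim e3 by (rule tendstoD)
    ultimately have "\<forall>\<^sub>F n in sequentially. r n < min \<delta> b \<and> dist (\<Phi> (of_real (1 - r n) * \<zeta>)) (stereo w) < e / 3"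
      by (rule eventually_conj)
    then obtain n where n: "r n < \<delta>" "r n < b" "dist (\<Phi> (of_real (1 - r n) * \<zeta>)) (stereo w) < e / 3"
      by (auto simp: eventually_sequentially)
    obtain \<rho> g where \<rho>: "r n / 2 \<le> \<rho>" "\<rho> \<le> r n" and g: "continuous_on {0..1} (\<lambda>u. stereo (g u))"
        "\<forall>u\<in>{0<..<1}. g u = Some (\<phi> (circ_arc \<zeta> \<rho> u))"
      and diam: "\<And>u v. u \<in> {0<..<1} \<Longrightarrow> v \<in> {0<..<1} \<Longrightarrow> dist (\<Phi> (circ_arc \<zeta> \<rho> u)) (\<Phi> (circ_arc \<zeta> \<rho> v)) < e / 3"
      and av: "\<forall>p\<in>F. \<exists>d>0. \<forall>u\<in>{0<..<1}. d \<le> dist (\<Phi> (circ_arc \<zeta> \<rho> u)) (stereo p)"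
      and rad: "dist (\<Phi> (of_real (1 - \<rho>) * \<zeta>)) (\<Phi> (of_real (1 - r n) * \<zeta>)) < e / 3"
      using arcs[OF r(1) n(1) F] by blast
    have "near \<rho> e"
      unfolding near_def
    proof
      fix u :: real assume "u \<in> {0<..<1}"
      then have "dist (\<Phi> (circ_arc \<zeta> \<rho> u)) (\<Phi> (of_real (1 - \<rho>) * \<zeta>)) < e / 3"
        using diam[of u "1/2"] unfolding circ_arc_half by simp
      then show "dist (\<Phi> (circ_arc \<zeta> \<rho> u)) (stereo w) < e"
        using rad n(3) dist_triangle[of "\<Phi> (circ_arc \<zeta> \<rho> u)" "stereo w" "\<Phi> (of_real (1 - r n) * \<zeta>)"]
          dist_triangle[of "\<Phi> (circ_arc \<zeta> \<rho> u)" "\<Phi> (of_real (1 - r n) * \<zeta>)" "\<Phi> (of_real (1 - \<rho>) * \<zeta>)"]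
        by linarith
    qed
    moreover have "0 < \<rho>" "\<rho> \<le> 1" "\<rho> < b"
      using \<rho> r(1)[of n] n \<delta> by linarith+
    ultimately show ?thesis
      using g av unfolding isarc_def avoids_def by blast
  qed
  have ends: "g 0 \<in> sphere_boundary U" "g 1 \<in> sphere_boundary U" if "isarc \<rho> g" for \<rho> g
    using arc_image_ends[OF \<zeta>, of \<rho> g] that by (auto simp: isarc_def)
  define good where "good n p \<longleftrightarrow> isarc (fst p) (snd p) \<and> near (fst p) (1 / real (Suc n))"
    for n :: nat and p :: "real \<times> (real \<Rightarrow> complex option)"
  define succ where "succ n p p' \<longleftrightarrow> fst p' < fst p \<and> fst p' < 1 / real (Suc n) \<and> avoids (fst p') (snd p 0) \<and> avoids (fst p') (snd p 1)"
    for n :: nat and p p' :: "real \<times> (real \<Rightarrow> complex option)"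
  have "\<exists>p. \<forall>n. good n (p n) \<and> succ n (p n) (p (Suc n))"
  proof (rule dependent_nat_choice)
    obtain \<rho> g where "isarc \<rho> g" "near \<rho> 1"
      using step[of 1 1 "{}"] by auto
    then have "good 0 (\<rho>, g)"
      by (simp add: good_def)
    then show "\<exists>p. good 0 p" ..
  next
    fix p n assume p: "good n p"
    have i: "isarc (fst p) (snd p)"
      using p by (simp add: good_def)
    have "{snd p 0, snd p 1} \<inter> Some ` U = {}"
      using ends[OF i] sphere_boundary_not_in_U by blast
    moreover have "0 < min (fst p) (1 / real (Suc n))"
      using i by (simp add: isarc_def)
    ultimately obtain \<rho> g where "isarc \<rho> g" "\<rho> < min (fst p) (1 / real (Suc n))" "near \<rho> (1 / real (Suc (Suc n)))"
      "\<forall>q\<in>{snd p 0, snd p 1}. avoids \<rho> q"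
      using step[of "min (fst p) (1 / real (Suc n))" "1 / real (Suc (Suc n))" "{snd p 0, snd p 1}"] by auto
    then have "good (Suc n) (\<rho>, g) \<and> succ n p (\<rho>, g)"
      by (simp add: good_def succ_def)
    then show "\<exists>p'. good (Suc n) p' \<and> succ n p p'" ..
  qed
  then obtain p where p: "\<And>n. good n (p n)" "\<And>n. succ n (p n) (p (Suc n))"
    by blast
  define \<rho> g where "\<rho> n = fst (p n)" and "g n = snd (p n)" for n
  have arc: "isarc (\<rho> n) (g n)" and nearn: "near (\<rho> n) (1 / real (Suc n))" for n
    using p(1)[of n] by (auto simp: good_def \<rho>_def g_def)
  have \<rho>: "0 < \<rho> n" "\<rho> n \<le> 1" and gc: "continuous_on {0..1} (\<lambda>u. stereo (g n u))"
    and garc: "\<And>u. u \<in> {0<..<1} \<Longrightarrow> g n u = Some (\<phi> (circ_arc \<zeta> (\<rho> n) u))" for n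
    using arc[of n] by (auto simp: isarc_def)
  have dec: "\<rho> (Suc n) < \<rho> n" and \<rho>small: "\<rho> (Suc n) < 1 / real (Suc n)"
    and av: "avoids (\<rho> (Suc n)) (g n 0)" "avoids (\<rho> (Suc n)) (g n 1)" for n
    using p(2)[of n] by (auto simp: succ_def \<rho>_def g_def)
  have ge: "g n 0 \<in> sphere_boundary U" "g n 1 \<in> sphere_boundary U" for n
    using ends[OF arc] by auto
  define A where "A n = circ_arc \<zeta> (\<rho> n) ` {0<..<1}" for n
  define C where "C n = \<phi> ` A n" for n
  have Ab: "A n \<subseteq> ball 0 1" for n
    using circ_arc_in_ball[OF \<zeta> \<rho>[of n]] by (auto simp: A_def)
  have Ad: "dist z \<zeta> = \<rho> n" if "z \<in> A n" for z n
    using that dist_circ_arc[OF \<zeta> \<rho>(1)[of n]] by (auto simp: A_def)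
  have inA: "z \<in> A n" if z: "z \<in> ball 0 1" "dist z \<zeta> = \<rho> n" for z n
  proof -
    obtain u where "0 < u" "u < 1" "z = circ_arc \<zeta> (\<rho> n) u"
      using circ_arc_cover[OF \<zeta> \<rho> z] .
    then show ?thesis
      by (simp add: A_def)
  qed
  have CU: "C n \<subseteq> U" for n
    unfolding C_def using Ab[of n] by (intro image_subsetI \<phi>_in_U) blast
  have pullC: "pull (C n) = A n" for n
    using Ab[of n] inj by (auto simp: pull_def C_def inj_on_def)
  have gC: "g n ` {0<..<1} = Some ` C n" for n
  proof -
    have "g n ` {0<..<1} = (\<lambda>u. Some (\<phi> (circ_arc \<zeta> (\<rho> n) u))) ` {0<..<1}"
      by (rule image_cong[OF refl]) (rule garc)
    then show ?thesis
      by (simp add: C_def A_def image_image)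
  qed
  have cc: "crosscut U (C n)" for n
    unfolding crosscut_def pathin_riemann_sphere_iff
  proof (intro conjI exI[of _ "g n"] CU gc gC ge)
    show "inj_on (g n) {0<..<1}"
    proof (rule inj_onI)
      fix u v :: real assume uv: "u \<in> {0<..<1}" "v \<in> {0<..<1}" "g n u = g n v"
      then have "\<phi> (circ_arc \<zeta> (\<rho> n) u) = \<phi> (circ_arc \<zeta> (\<rho> n) v)"
        by (simp add: garc)
      moreover have "circ_arc \<zeta> (\<rho> n) u \<in> ball 0 1" "circ_arc \<zeta> (\<rho> n) v \<in> ball 0 1"
        using circ_arc_in_ball[OF \<zeta> \<rho>[of n]] uv(1,2) by auto
      ultimately have "circ_arc \<zeta> (\<rho> n) u = circ_arc \<zeta> (\<rho> n) v"
        using inj by (auto dest: inj_onD)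
      then show "u = v"
        by (rule inj_onD[OF inj_on_circ_arc[OF \<zeta> \<rho>] _ uv(1,2)])
    qed
  qed
  have clC: "\<exists>u\<in>{0..1}. q = g n u" if "q \<in> riemann_sphere closure_of (Some ` C n)" for q n
  proof -
    have "closed ((\<lambda>u. stereo (g n u)) ` {0..1})"
      by (intro compact_imp_closed compact_continuous_image gc compact_Icc)
    moreover have "stereo ` Some ` C n \<subseteq> (\<lambda>u. stereo (g n u)) ` {0..1}"
      unfolding gC[symmetric] by auto
    ultimately have "closure (stereo ` Some ` C n) \<subseteq> (\<lambda>u. stereo (g n u)) ` {0..1}"
      by (rule closure_minimal[rotated])
    then have "stereo q \<in> (\<lambda>u. stereo (g n u)) ` {0..1}"
      using that unfolding closure_of_riemann_sphere_iff by blast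
    then obtain u where "u \<in> {0..1}" "stereo q = stereo (g n u)"
      by (rule imageE)
    then show ?thesis
      by auto
  qed
  \<comment> \<open>\<open>avoids\<close> keeps the open arc away from \<open>q\<close>; by
    continuity the same distance holds at its two ends.\<close>
  have avoid_closed: "g (Suc n) u \<noteq> q" if avq: "avoids (\<rho> (Suc n)) q" and u01: "u \<in> {0..1}" for n u q
  proof
    assume eq: "g (Suc n) u = q"
    obtain d where d: "d > 0" "\<And>u. u \<in> {0<..<1} \<Longrightarrow> d \<le> dist (\<Phi> (circ_arc \<zeta> (\<rho> (Suc n)) u)) (stereo q)"
      using avq unfolding avoids_def by blast
    have sub: "(\<lambda>u. stereo (g (Suc n) u)) ` {0<..<1} \<subseteq> - ball (stereo q) d"
    proof (rule image_subsetI)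
      fix u :: real assume u: "u \<in> {0<..<1}"
      have "d \<le> dist (stereo (g (Suc n) u)) (stereo q)"
        using d(2)[OF u] garc[OF u, of "Suc n"] by (simp add: \<Phi>_def)
      then show "stereo (g (Suc n) u) \<in> - ball (stereo q) d"
        by (simp add: dist_commute)
    qed
    have cl: "closure {0<..<1} = {0..1::real}"
      by simp
    have "(\<lambda>u. stereo (g (Suc n) u)) ` closure {0<..<1} \<subseteq> - ball (stereo q) d"
      by (rule image_closure_subset[OF _ _ sub]) (simp_all add: gc closed_Compl)
    then have "stereo (g (Suc n) u) \<in> - ball (stereo q) d"
      unfolding cl using u01 by blast
    then show False
      using eq d(1) by simp
  qed
  have cls: "(riemann_sphere closure_of (Some ` C n)) \<inter> (riemann_sphere closure_of (Some ` C (Suc n))) = {}" for n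
  proof -
    have False if q: "q \<in> riemann_sphere closure_of (Some ` C n)" "q \<in> riemann_sphere closure_of (Some ` C (Suc n))" for q
    proof -
      obtain u u' where u: "u \<in> {0..1}" "q = g n u" and u': "u' \<in> {0..1}" "q = g (Suc n) u'"
        using clC[OF q(1)] clC[OF q(2)] by blast
      consider "u = 0" | "u = 1" | "u \<in> {0<..<1}"
        using u(1) by fastforce
      then show False
      proof cases
        case 1
        then show False
          using avoid_closed[OF av(1) u'(1)] u(2) u'(2) by simp
      next
        case 2
        then show False
          using avoid_closed[OF av(2) u'(1)] u(2) u'(2) by simp
      next
        \<comment> \<open>A common point that is interior to the first arc lies in \<open>U\<close>,
          so it is interior to the second as well, and its preimage would have two different
          distances from \<zeta>.\<close>
        case 3
        then have qC: "q \<in> Some ` C n"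
          using u(2) gC by blast
        have "u' \<noteq> 0" "u' \<noteq> 1"
          using qC u'(2) ge[of "Suc n"] CU[of n] sphere_boundary_not_in_U by blast+
        then have "u' \<in> {0<..<1}"
          using u'(1) by simp
        then have "q \<in> Some ` C (Suc n)"
          unfolding u'(2) gC[symmetric] by (rule imageI)
        then obtain z where z: "z \<in> C n" "z \<in> C (Suc n)"
          using qC by auto
        moreover have "z \<in> U"
          using z(1) CU by blast
        ultimately have "\<psi> z \<in> A n" "\<psi> z \<in> A (Suc n)"
          unfolding pullC[symmetric] pull_def using \<psi>_in_ball \<phi>_\<psi> by simp_all
        then show False
          using Ad[of "\<psi> z" n] Ad[of "\<psi> z" "Suc n"] dec[of n] by simp
      qed
    qed
    then show ?thesis
      by blast
  qed
  have disj: "C n \<inter> C (Suc n) = {}" for n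
  proof -
    have "Some z \<in> riemann_sphere closure_of (Some ` C m)" if "z \<in> C m" for z m
      using that closure_subset by (fastforce simp: closure_of_riemann_sphere_iff)
    then show ?thesis
      using cls[of n] by blast
  qed
  have sep: "separates_in U (C (Suc n)) (C n) (C (Suc (Suc n)))" for n
  proof -
    have ex: "\<exists>K. K \<in> components (U - C (Suc n)) \<and> C m \<subseteq> K" if "C m \<inter> C (Suc n) = {}" for m
    proof -
      have sub: "C m \<subseteq> U - C (Suc n)"
        using CU[of m] that by blast
      moreover have "U - C (Suc n) \<noteq> {}"
        using sub crosscut_connected(2)[OF cc[of m]] by blast
      ultimately show ?thesis
        using exists_component_superset[OF _ _ crosscut_connected(1)[OF cc[of m]]] by metis
    qed
    obtain K where K: "K \<in> components (U - C (Suc n))" "C n \<subseteq> K"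
      using ex[OF disj] by blast
    have "C (Suc (Suc n)) \<inter> C (Suc n) = {}"
      using disj[of "Suc n"] by blast
    then obtain L where L: "L \<in> components (U - C (Suc n))" "C (Suc (Suc n)) \<subseteq> L"
      using ex by blast
    \<comment> \<open>A component containing both neighbours would have a connected preimage
      reaching from one circle to another, hence meeting the circle between them, whose part in the
      disc is mapped onto \<open>C (Suc n)\<close>.\<close>
    have "K \<noteq> L"
    proof
      assume eq: "K = L"
      have KU: "K \<subseteq> U - C (Suc n)"
        using K(1) by (rule in_components_subset)
      have "connected (pull K)"
        using KU in_components_connected[OF K(1)] by (intro connected_pull) auto
      moreover obtain x where x: "x \<in> A n"
        unfolding A_def by fastforce
      moreover obtain y where y: "y \<in> A (Suc (Suc n))"
        unfolding A_def by fastforce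
      moreover have "A n \<subseteq> pull K" "A (Suc (Suc n)) \<subseteq> pull K"
        using pull_mono[OF K(2)] pull_mono[OF L(2)] eq by (simp_all add: pullC)
      ultimately obtain z where z: "z \<in> pull K" "dist z \<zeta> = \<rho> (Suc n)"
        using connected_dist_ivt[of "pull K" y x \<zeta> "\<rho> (Suc n)"] Ad[OF x] Ad[OF y] dec[of n] dec[of "Suc n"]
        by (metis less_imp_le subsetD)
      then have "z \<in> A (Suc n)"
        using pull_subset_ball inA by blast
      then have "\<phi> z \<in> C (Suc n)"
        by (simp add: C_def)
      then show False
        using z(1) KU by (auto simp: pull_def)
    qed
    then show ?thesis
      unfolding separates_in_def using K L by blast
  qed
  have nearC: "dist (stereo (Some z)) (stereo w) < 1 / real (Suc n)" if "z \<in> C n" for z n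
    using that nearn[of n] by (auto simp: C_def A_def near_def \<Phi>_def)
  have lim1: "(\<lambda>n. 1 / real (Suc n)) \<longlonglongrightarrow> 0"
    by (rule LIMSEQ_Suc[OF lim_1_over_n])
  have diam: "(\<lambda>n. spherical_diameter (C n)) \<longlonglongrightarrow> 0"
  proof (rule tendsto_sandwich)
    have ne: "C n \<noteq> {}" for n
      by (rule crosscut_connected(2)[OF cc])
    show "\<forall>\<^sub>F n in sequentially. 0 \<le> spherical_diameter (C n)"
      by (intro always_eventually allI spherical_diameter_nonneg ne)
    show "\<forall>\<^sub>F n in sequentially. spherical_diameter (C n) \<le> 2 * (1 / real (Suc n))"
    proof (intro always_eventually allI spherical_diameter_le ne)
      fix n z z' assume "z \<in> C n" "z' \<in> C n"
      then show "dist (stereo (Some z)) (stereo (Some z')) \<le> 2 * (1 / real (Suc n))"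
        using nearC[of z n] nearC[of z' n] dist_triangle2[of "stereo (Some z)" "stereo (Some z')" "stereo w"] by linarith
    qed
    show "(\<lambda>n. 2 * (1 / real (Suc n))) \<longlonglongrightarrow> 0"
      using tendsto_mult_left[OF lim1, of 2] by simp
  qed simp
  have nc: "null_chain U C"
    unfolding null_chain_def using cc cls sep diam by blast
  obtain \<zeta>' where \<zeta>': "shrinks_to C \<zeta>'"
    using null_chain_shrinks_to[OF nc] by blast
  \<comment> \<open>The arcs lie in the pulled back domains, which shrink to \<zeta>', and their
    radii tend to 0; this identifies the two points.\<close>
  have "dist \<zeta>' \<zeta> \<le> 0"
  proof (rule field_le_epsilon)
    fix e :: real assume "e > 0"
    then have e2: "e / 2 > 0"
      by simp
    obtain N where N: "\<And>n. n \<ge> N \<Longrightarrow> pull (chain_domain U C n) \<subseteq> ball \<zeta>' (e / 2)"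
      using shrinks_toD(4)[OF \<zeta>' e2] by (auto simp: eventually_sequentially)
    obtain M where M: "1 / real (Suc M) < e / 2"
      using nat_approx_posE[OF e2] by blast
    define m where "m = max N M"
    have "1 / real (Suc m) \<le> 1 / real (Suc M)"
      by (rule divide_left_mono) (auto simp: m_def)
    then have \<rho>m: "\<rho> (Suc m) < e / 2"
      using \<rho>small[of m] M by linarith
    obtain x where x: "x \<in> A (Suc m)"
      unfolding A_def by fastforce
    have "A (Suc m) \<subseteq> pull (chain_domain U C m)"
      using pull_mono[OF chain_domain(2)[OF nc]] by (simp add: pullC)
    then have "x \<in> ball \<zeta>' (e / 2)"
      using x N[of m] by (auto simp: m_def)
    then show "dist \<zeta>' \<zeta> \<le> 0 + e"
      using Ad[OF x] \<rho>m dist_triangle[of \<zeta>' \<zeta> x] by simp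
  qed
  then have "\<zeta>' = \<zeta>"
    by simp
  moreover have "\<forall>\<^sub>F n in sequentially. \<forall>z\<in>C n. dist (stereo (Some z)) (stereo w) < d" if "d > 0" for d
  proof -
    have "\<forall>\<^sub>F n in sequentially. 1 / real (Suc n) < d"
      using lim1 that by (rule order_tendstoD)
    then show ?thesis
      by eventually_elim (use nearC in \<open>force intro: order.strict_trans\<close>)
  qed
  ultimately show ?thesis
    using that \<zeta>' by simp
qed

section \<open>Principal points and radial limits\<close>

lemma principal_point_iff:
  "principal_point P p \<longleftrightarrow> (\<exists>C\<in>P. \<forall>d>0. \<forall>\<^sub>F n in sequentially. \<forall>z\<in>C n. dist (stereo (Some z)) (stereo p) < d)"
proof -
  have "(\<forall>W. openin riemann_sphere W \<and> p \<in> W \<longrightarrow> (\<forall>\<^sub>F n in sequentially. Some ` C n \<subseteq> W)) \<longleftrightarrow>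
      (\<forall>d>0. \<forall>\<^sub>F n in sequentially. \<forall>z\<in>C n. dist (stereo (Some z)) (stereo p) < d)" for C :: "nat \<Rightarrow> complex set"
  proof (intro iffI allI impI)
    fix d :: real
    assume C: "\<forall>W. openin riemann_sphere W \<and> p \<in> W \<longrightarrow> (\<forall>\<^sub>F n in sequentially. Some ` C n \<subseteq> W)" and "d > 0"
    have "openin riemann_sphere (stereo -` ball (stereo p) d)" "p \<in> stereo -` ball (stereo p) d"
      using \<open>d > 0\<close> by (auto simp: openin_riemann_sphere_iff)
    then have "\<forall>\<^sub>F n in sequentially. Some ` C n \<subseteq> stereo -` ball (stereo p) d"
      using C by blast
    then show "\<forall>\<^sub>F n in sequentially. \<forall>z\<in>C n. dist (stereo (Some z)) (stereo p) < d"
      by eventually_elim (auto simp: dist_commute image_subset_iff)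
  next
    fix W
    assume C: "\<forall>d>0. \<forall>\<^sub>F n in sequentially. \<forall>z\<in>C n. dist (stereo (Some z)) (stereo p) < d"
      and W: "openin riemann_sphere W \<and> p \<in> W"
    obtain V where V: "open V" "W = stereo -` V"
      using W by (auto simp: openin_riemann_sphere_iff)
    moreover have "stereo p \<in> V"
      using W V(2) by simp
    ultimately obtain d where d: "d > 0" "ball (stereo p) d \<subseteq> V"
      by (auto elim: openE)
    have "\<forall>\<^sub>F n in sequentially. \<forall>z\<in>C n. dist (stereo (Some z)) (stereo p) < d"
      using C d(1) by blast
    then show "\<forall>\<^sub>F n in sequentially. Some ` C n \<subseteq> W"
    proof eventually_elim
      case (elim n)
      then have "\<forall>z\<in>C n. stereo (Some z) \<in> ball (stereo p) d"
        by (simp add: dist_commute)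
      then have "\<forall>z\<in>C n. stereo (Some z) \<in> V"
        using d(2) by blast
      then show ?case
        unfolding V(2) by auto
    qed
  qed
  then show ?thesis
    by (simp add: principal_point_def)
qed

text \<open>The sphere is compact, so \<Phi> converges along a subsequence of the radial points, and
  \<open>null_chain_at\<close> builds a chain for the limit: radial cluster values are principal
  points.\<close>

lemma ex_radial_cluster_chain:
  fixes r :: "nat \<Rightarrow> real"
  assumes \<zeta>: "cmod \<zeta> = 1" and r: "\<And>n. 0 < r n" "r \<longlonglongrightarrow> 0"
  obtains w s where "strict_mono (s :: nat \<Rightarrow> nat)" "(\<lambda>n. \<Phi> (of_real (1 - r (s n)) * \<zeta>)) \<longlonglongrightarrow> stereo w" "principal_point (prime_end_of \<zeta>) w"
proof -
  obtain w s where s: "strict_mono (s :: nat \<Rightarrow> nat)" "(\<lambda>n. \<Phi> (of_real (1 - r (s n)) * \<zeta>)) \<longlonglongrightarrow> stereo w"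
    using stereo_convergent_subseq[of "\<lambda>n. Some (\<phi> (of_real (1 - r n) * \<zeta>))"] unfolding \<Phi>_def by blast
  have "(\<lambda>n. r (s n)) \<longlonglongrightarrow> 0"
    using LIMSEQ_subseq_LIMSEQ[OF r(2) s(1)] by (simp add: o_def)
  then obtain C where "shrinks_to C \<zeta>" "\<And>d. d > 0 \<Longrightarrow> \<forall>\<^sub>F n in sequentially. \<forall>z\<in>C n. dist (stereo (Some z)) (stereo w) < d"
    using null_chain_at[OF \<zeta>, of "\<lambda>n. r (s n)", OF r(1) _ s(2)] by blast
  then have "principal_point (prime_end_of \<zeta>) w"
    unfolding principal_point_iff by (intro bexI[of _ C]) (auto simp: prime_end_of_def)
  with s that show ?thesis
    by blast
qed

lemma prime_end_of_nonempty:
  assumes "cmod \<zeta> = 1"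
  shows "prime_end_of \<zeta> \<noteq> {}"
proof -
  have "(\<lambda>n. 1 / real (Suc n)) \<longlonglongrightarrow> 0"
    by (rule LIMSEQ_Suc[OF lim_1_over_n])
  then obtain w where "principal_point (prime_end_of \<zeta>) w"
    using ex_radial_cluster_chain[OF assms, of "\<lambda>n. 1 / real (Suc n)"] by auto
  then show ?thesis
    by (auto simp: principal_point_iff)
qed

text \<open>By \<open>chain_equiv_iff\<close> a class consists of all chains shrinking to one point,
  and by \<open>prime_end_of_nonempty\<close> every point of the circle has such chains.\<close>

lemma prime_ends_eq: "prime_ends U = prime_end_of ` sphere 0 1"
proof -
  have cls: "chain_equiv U `` {C} = prime_end_of \<zeta>" if "shrinks_to C \<zeta>" for C \<zeta>
    using that shrinks_to_unique by (auto simp: chain_equiv_iff prime_end_of_def Image_def)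
  have "prime_ends U \<subseteq> prime_end_of ` sphere 0 1"
  proof
    fix P assume "P \<in> prime_ends U"
    then obtain C where C: "null_chain U C" "P = chain_equiv U `` {C}"
      by (auto simp: prime_ends_def quotient_def)
    then obtain \<zeta> where \<zeta>: "shrinks_to C \<zeta>"
      using null_chain_shrinks_to by blast
    then show "P \<in> prime_end_of ` sphere 0 1"
      using C(2) cls[OF \<zeta>] shrinks_toD(2)[OF \<zeta>] by auto
  qed
  moreover have "prime_end_of \<zeta> \<in> prime_ends U" if \<zeta>: "\<zeta> \<in> sphere 0 1" for \<zeta>
  proof -
    obtain C where C: "shrinks_to C \<zeta>"
      using prime_end_of_nonempty[of \<zeta>] \<zeta> by (auto simp: prime_end_of_def)
    then show ?thesis
      using cls[OF C] shrinks_toD(1)[OF C] unfolding prime_ends_def by (metis mem_Collect_eq quotientI)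
  qed
  ultimately show ?thesis
    by blast
qed

lemma inj_on_prime_end_of: "inj_on prime_end_of (sphere 0 1)"
proof (rule inj_onI)
  fix \<zeta> \<xi> assume \<zeta>: "\<zeta> \<in> sphere (0::complex) 1" and eq: "prime_end_of \<zeta> = prime_end_of \<xi>"
  then obtain C where "shrinks_to C \<zeta>"
    using prime_end_of_nonempty[of \<zeta>] by (auto simp: prime_end_of_def)
  moreover from this have "shrinks_to C \<xi>"
    using eq by (auto simp: prime_end_of_def)
  ultimately show "\<zeta> = \<xi>"
    by (rule shrinks_to_unique)
qed

lemma prime_end_at_prime_end_of:
  assumes "cmod \<zeta> = 1"
  shows "prime_end_at \<phi> U (prime_end_of \<zeta>) \<zeta>"
  unfolding prime_end_at_def using assms
  by (auto simp: prime_ends_eq) (auto simp: prime_end_of_def shrinks_to_def pull_def)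

text \<open>The crosscuts of a chain converging to \<open>p\<close> eventually lie in any given
  domain of any equivalent chain.\<close>

lemma principal_point_in_impression:
  assumes "principal_point (prime_end_of \<zeta>) p"
  shows "p \<in> impression U (prime_end_of \<zeta>)"
proof -
  obtain C where C: "shrinks_to C \<zeta>" "\<And>d. d > 0 \<Longrightarrow> \<forall>\<^sub>F n in sequentially. \<forall>z\<in>C n. dist (stereo (Some z)) (stereo p) < d"
    using assms by (auto simp: principal_point_iff prime_end_of_def)
  note nc = shrinks_toD(1)[OF C(1)]
  have "stereo p \<in> closure (stereo ` Some ` chain_domain U C' m)" if C': "shrinks_to C' \<zeta>" for C' m
    unfolding closure_approachable
  proof (intro allI impI)
    fix e :: real assume "e > 0"
    obtain n where n: "chain_domain U C n \<subseteq> chain_domain U C' m"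
      using shrinks_to_domain_subset[OF C' C(1)] by blast
    have "\<forall>\<^sub>F k in sequentially. n < k \<and> (\<forall>z\<in>C k. dist (stereo (Some z)) (stereo p) < e)"
      by (intro eventually_conj eventually_gt_at_top C(2) \<open>e > 0\<close>)
    then obtain k where k: "n < k" "\<forall>z\<in>C k. dist (stereo (Some z)) (stereo p) < e"
      by (auto simp: eventually_sequentially)
    obtain z where "z \<in> C k"
      using crosscut_connected(2)[OF cc[OF nc]] by blast
    then show "\<exists>y\<in>stereo ` Some ` chain_domain U C' m. dist y (stereo p) < e"
      using k chain_subset_domain[OF nc k(1)] n by blast
  qed
  then show ?thesis
    by (auto simp: impression_def prime_end_of_def closure_of_riemann_sphere_iff)
qed

text \<open>The end of the radius lies in a late domain of the chain, by
  \<open>half_disc_in_chain_domain\<close>, while a point of the radius at a fixed distance from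
  \<zeta> is outside that domain. So the radius meets a late crosscut \<open>C k\<close> near
  \<zeta>, and there \<Phi> is close both to \<open>v\<close> and to \<open>p\<close>.\<close>

lemma principal_point_eq_radial_limit:
  assumes \<zeta>: "cmod \<zeta> = 1" and rad: "has_radial_limit \<phi> \<zeta> v" and p: "principal_point (prime_end_of \<zeta>) p"
  shows "p = v"
proof -
  obtain C where C: "shrinks_to C \<zeta>" "\<And>d. d > 0 \<Longrightarrow> \<forall>\<^sub>F n in sequentially. \<forall>z\<in>C n. dist (stereo (Some z)) (stereo p) < d"
    using p by (auto simp: principal_point_iff prime_end_of_def)
  note s = shrinks_toD[OF C(1)]
  have "dist (stereo p) (stereo v) \<le> 0"
  proof (rule field_le_epsilon)
    fix e :: real assume "e > 0"
    then have e2: "e / 2 > 0"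
      by simp
    have "\<forall>\<^sub>F t in at_left 1. dist (\<Phi> (of_real t * \<zeta>)) (stereo v) < e / 2"
      using rad e2 unfolding has_radial_limit_iff by (rule tendstoD)
    then have "\<exists>b<1. \<forall>t. b < t \<and> t < 1 \<longrightarrow> dist (\<Phi> (of_real t * \<zeta>)) (stereo v) < e / 2"
      unfolding eventually_at_left[OF zero_less_one] by blast
    then obtain b where b: "b < 1" "\<And>t. b < t \<Longrightarrow> t < 1 \<Longrightarrow> dist (\<Phi> (of_real t * \<zeta>)) (stereo v) < e / 2"
      by blast
    \<comment> \<open>From \<open>t0\<close> on the radial values are within e / 2 of
      \<open>v\<close>; the domains are later shrunk so as to exclude the point at
      \<open>t0\<close>.\<close>
    define t0 where "t0 = (max 0 b + 1) / 2"
    have t0: "0 \<le> t0" "b < t0" "t0 < 1"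
      using b(1) by (auto simp: t0_def)
    have d0: "dist \<zeta> (of_real t0 * \<zeta>) = 1 - t0"
    proof -
      have "\<zeta> - of_real t0 * \<zeta> = of_real (1 - t0) * \<zeta>"
        by (simp add: left_diff_distrib)
      then show ?thesis
        using \<zeta> t0 by (simp add: dist_norm norm_mult del: of_real_diff)
    qed
    have "1 - t0 > 0"
      using t0 by simp
    have "\<forall>\<^sub>F n in sequentially. pull (chain_domain U C n) \<subseteq> ball \<zeta> (1 - t0) \<and> (\<forall>z\<in>C n. dist (stereo (Some z)) (stereo p) < e / 2)"
      using s(4)[OF \<open>1 - t0 > 0\<close>] C(2)[OF e2] by (rule eventually_conj)
    then obtain N where N: "\<And>n. n \<ge> N \<Longrightarrow> pull (chain_domain U C n) \<subseteq> ball \<zeta> (1 - t0)"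
      "\<And>n z. n \<ge> N \<Longrightarrow> z \<in> C n \<Longrightarrow> dist (stereo (Some z)) (stereo p) < e / 2"
      by (auto simp: eventually_sequentially)
    obtain k d where k: "N \<le> k" "d > 0" "ball 0 1 \<inter> ball \<zeta> d \<subseteq> pull (chain_domain U C k)"
      using half_disc_in_chain_domain[OF s(1-3)] by metis
    define S where "S = (\<lambda>t. of_real t * \<zeta>) ` {t0..<1}"
    have Sb: "S \<subseteq> ball 0 1"
      using \<zeta> t0 by (auto simp: S_def norm_mult)
    have "connected S"
      unfolding S_def by (intro connected_continuous_image continuous_intros) simp
    have "\<phi> ` S \<inter> C k \<noteq> {}"
    proof
      assume no: "\<phi> ` S \<inter> C k = {}"
      have "\<phi> ` S \<subseteq> U - C k"
        using no Sb \<phi>_in_U by blast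
      moreover have "connected (\<phi> ` S)"
        by (intro connected_continuous_image \<open>connected S\<close> continuous_on_subset[OF continuous_on_\<phi> Sb])
      moreover have "chain_domain U C k \<inter> \<phi> ` S \<noteq> {}"
      proof -
        define t where "t = max t0 (1 - d / 2)"
        have t: "t0 \<le> t" "t < 1" "1 - d / 2 \<le> t"
          using t0 k(2) by (auto simp: t_def)
        have "\<zeta> - of_real t * \<zeta> = of_real (1 - t) * \<zeta>"
          by (simp add: left_diff_distrib)
        then have "dist \<zeta> (of_real t * \<zeta>) = 1 - t"
          using \<zeta> t by (simp add: dist_norm norm_mult del: of_real_diff)
        also have "\<dots> < d"
          using t k(2) by linarith
        finally have "of_real t * \<zeta> \<in> S" "of_real t * \<zeta> \<in> ball \<zeta> d"
          using t by (auto simp: S_def)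
        then have "of_real t * \<zeta> \<in> S" "\<phi> (of_real t * \<zeta>) \<in> chain_domain U C k"
          using k(3) Sb by (auto simp: pull_def)
        then show ?thesis
          by blast
      qed
      ultimately have "\<phi> ` S \<subseteq> chain_domain U C k"
        by (intro components_maximal[OF chain_domain(1)[OF s(1)]])
      moreover have "of_real t0 * \<zeta> \<in> S"
        using t0 by (auto simp: S_def)
      ultimately have "of_real t0 * \<zeta> \<in> pull (chain_domain U C k)"
        using Sb by (auto simp: pull_def)
      then show False
        using N(1)[OF k(1)] d0 by auto
    qed
    then obtain t where t: "t0 \<le> t" "t < 1" "\<phi> (of_real t * \<zeta>) \<in> C k"
      by (auto simp: S_def)
    have "dist (\<Phi> (of_real t * \<zeta>)) (stereo v) < e / 2"
      using b(2)[of t] t t0 by simp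
    moreover have "dist (\<Phi> (of_real t * \<zeta>)) (stereo p) < e / 2"
      using N(2)[OF k(1) t(3)] by (simp add: \<Phi>_def)
    ultimately show "dist (stereo p) (stereo v) \<le> 0 + e"
      using dist_triangle3[of "stereo p" "stereo v" "\<Phi> (of_real t * \<zeta>)"] by simp
  qed
  then show ?thesis
    by simp
qed

text \<open>If the radial limit is \<open>v\<close>, it is the only principal point, and then the
  prime end is of one of the two types. Conversely, both types have just one principal point, the
  first because principal points lie in the impression. If the radial limit failed, values at
  distance at least \<open>e\<close> from \<open>v\<close> would cluster along the radius at a
  second principal point.\<close>

theorem radial_limit_iff_prime_end:
  assumes \<zeta>: "cmod \<zeta> = 1"
  shows "has_radial_limit \<phi> \<zeta> v \<longleftrightarrow>
    (first_type U (prime_end_of \<zeta>) \<or> second_type U (prime_end_of \<zeta>)) \<and> principal_point (prime_end_of \<zeta>) v"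
proof
  assume rad: "has_radial_limit \<phi> \<zeta> v"
  have "(\<lambda>n. 1 / real (Suc n)) \<longlonglongrightarrow> 0"
    by (rule LIMSEQ_Suc[OF lim_1_over_n])
  then obtain w where "principal_point (prime_end_of \<zeta>) w"
    using ex_radial_cluster_chain[OF \<zeta>, of "\<lambda>n. 1 / real (Suc n)"] by auto
  then have "principal_point (prime_end_of \<zeta>) v"
    using principal_point_eq_radial_limit[OF \<zeta> rad] by blast
  moreover from this have "\<exists>!p. principal_point (prime_end_of \<zeta>) p"
    using principal_point_eq_radial_limit[OF \<zeta> rad] by blast
  ultimately show "(first_type U (prime_end_of \<zeta>) \<or> second_type U (prime_end_of \<zeta>)) \<and> principal_point (prime_end_of \<zeta>) v"
    by (auto simp: first_type_def second_type_def)
next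
  assume type: "(first_type U (prime_end_of \<zeta>) \<or> second_type U (prime_end_of \<zeta>)) \<and> principal_point (prime_end_of \<zeta>) v"
  have uniq: "p = v" if "principal_point (prime_end_of \<zeta>) p" for p
  proof (cases "is_singleton (impression U (prime_end_of \<zeta>))")
    case True
    then show ?thesis
      using principal_point_in_impression[OF that] principal_point_in_impression[of \<zeta> v] type
      by (auto elim: is_singletonE)
  next
    case False
    then show ?thesis
      using type that by (auto simp: first_type_def second_type_def)
  qed
  show "has_radial_limit \<phi> \<zeta> v"
    unfolding has_radial_limit_iff
  proof (rule tendstoI, rule ccontr)
    fix e :: real assume "e > 0" and no: "\<not> (\<forall>\<^sub>F t in at_left 1. dist (\<Phi> (of_real t * \<zeta>)) (stereo v) < e)"
    have "\<exists>t. 1 - 1 / real (Suc n) < t \<and> t < 1 \<and> e \<le> dist (\<Phi> (of_real t * \<zeta>)) (stereo v)" for n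
    proof (rule ccontr)
      assume "\<not> ?thesis"
      then have "\<forall>t. 1 - 1 / real (Suc n) < t \<and> t < 1 \<longrightarrow> dist (\<Phi> (of_real t * \<zeta>)) (stereo v) < e"
        by (meson not_less)
      moreover have "1 - 1 / real (Suc n) < 1"
        by simp
      ultimately show False
        using no unfolding eventually_at_left[OF zero_less_one] by blast
    qed
    then obtain t where t: "\<And>n. 1 - 1 / real (Suc n) < t n" "\<And>n. t n < 1" "\<And>n. e \<le> dist (\<Phi> (of_real (t n) * \<zeta>)) (stereo v)"
      by metis
    have pos: "0 < 1 - t n" for n
      using t(2) by simp
    have l0: "(\<lambda>n. 1 - t n) \<longlonglongrightarrow> 0"
    proof (rule tendsto_sandwich[OF _ _ tendsto_const LIMSEQ_Suc[OF lim_1_over_n]])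
      show "\<forall>\<^sub>F n in sequentially. 0 \<le> 1 - t n"
        using t(2) by (intro always_eventually allI) (simp add: less_imp_le)
      show "\<forall>\<^sub>F n in sequentially. 1 - t n \<le> 1 / real (Suc n)"
      proof (intro always_eventually allI)
        fix n
        show "1 - t n \<le> 1 / real (Suc n)"
          using t(1)[of n] by linarith
      qed
    qed
    obtain w s where s: "strict_mono (s :: nat \<Rightarrow> nat)" "(\<lambda>n. \<Phi> (of_real (1 - (1 - t (s n))) * \<zeta>)) \<longlonglongrightarrow> stereo w"
      "principal_point (prime_end_of \<zeta>) w"
      by (rule ex_radial_cluster_chain[OF \<zeta> pos l0])
    have "w = v"
      using uniq[OF s(3)] .
    then have "(\<lambda>n. \<Phi> (of_real (t (s n)) * \<zeta>)) \<longlonglongrightarrow> stereo v"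
      using s(2) by simp
    then have "\<forall>\<^sub>F n in sequentially. dist (\<Phi> (of_real (t (s n)) * \<zeta>)) (stereo v) < e"
      using \<open>e > 0\<close> by (rule tendstoD)
    then obtain n where "dist (\<Phi> (of_real (t (s n)) * \<zeta>)) (stereo v) < e"
      by (auto simp: eventually_sequentially)
    then show False
      using t(3)[of "s n"] by simp
  qed
qed

lemma bij_betw_prime_end_of:
  "bij_betw prime_end_of {\<zeta> \<in> sphere 0 1. has_radial_limit \<phi> \<zeta> v}
     {P \<in> prime_ends U. (first_type U P \<or> second_type U P) \<and> principal_point P v}"
proof -
  have "inj_on prime_end_of {\<zeta> \<in> sphere 0 1. has_radial_limit \<phi> \<zeta> v}"
    by (rule inj_on_subset[OF inj_on_prime_end_of]) auto
  moreover have "prime_end_of ` {\<zeta> \<in> sphere 0 1. has_radial_limit \<phi> \<zeta> v} =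
     {P \<in> prime_ends U. (first_type U P \<or> second_type U P) \<and> principal_point P v}"
    unfolding prime_ends_eq using radial_limit_iff_prime_end by auto
  ultimately show ?thesis
    by (simp add: bij_betw_def)
qed

end

theorem mainTheorem6:
  fixes U :: "complex set" and \<phi> :: "complex \<Rightarrow> complex" and v :: "complex option"
  assumes "open U" and "connected U" and "simply_connected U" and "U \<noteq> UNIV"
    and "riemann_map \<phi> U"
    and "v \<in> sphere_boundary U"
  shows "\<exists>Z :: (real \<Rightarrow> complex option) set \<Rightarrow> complex.
    bij_betw Z (accesses U (\<phi> 0) v) {\<zeta> \<in> sphere 0 1. has_radial_limit \<phi> \<zeta> v} \<and>
    (\<forall>A \<in> accesses U (\<phi> 0) v. \<forall>\<gamma>. in_access U (\<phi> 0) v \<gamma> A \<longrightarrow>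
       ((\<lambda>t. inv_into (ball 0 1) \<phi> (\<gamma> t)) \<longlongrightarrow> Z A) (at_left 1)) \<and>
    (\<forall>\<zeta> \<in> sphere 0 1. has_radial_limit \<phi> \<zeta> v \<longrightarrow>
       (\<exists>A \<in> accesses U (\<phi> 0) v. Z A = \<zeta> \<and>
          (\<forall>\<eta> w. curve_in (ball 0 1) \<eta> \<and> (\<eta> \<longlongrightarrow> \<zeta>) (at_left 1) \<and> lands_at (\<lambda>t. \<phi> (\<eta> t)) w \<longrightarrow>
             w = v \<and> in_access U (\<phi> 0) v (\<lambda>t. \<phi> (\<eta> t)) A))) \<and>
    (\<exists>E. bij_betw E (accesses U (\<phi> 0) v)
           {P \<in> prime_ends U. (first_type U P \<or> second_type U P) \<and> principal_point P v} \<and>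
         (\<forall>A \<in> accesses U (\<phi> 0) v. prime_end_at \<phi> U (E A) (Z A)))"
proof -
  interpret riemann_mapping U \<phi>
    by unfold_locales (fact assms)+
  define R where "R = {\<zeta> \<in> sphere 0 1. has_radial_limit \<phi> \<zeta> v}"
  \<comment> \<open>The theorem asks for a map from accesses to points, whereas
    \<open>access_at\<close> goes the other way.\<close>
  define Z where "Z = inv_into R (access_at v)"
  have v: "v \<notin> Some ` U"
    by (rule sphere_boundary_not_in_U[OF assms(6)])
  have bij: "bij_betw (access_at v) R (accesses U (\<phi> 0) v)"
    unfolding R_def by (rule bij_betw_access_at[OF v])
  then have bijZ: "bij_betw Z (accesses U (\<phi> 0) v) R"
    unfolding Z_def by (rule bij_betw_inv_into)
  have Z_at: "Z (access_at v \<zeta>) = \<zeta>" if "\<zeta> \<in> R" for \<zeta>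
    unfolding Z_def using bij_betw_inv_into_left[OF bij that] .
  have at_Z: "access_at v (Z A) = A" if "A \<in> accesses U (\<phi> 0) v" for A
    unfolding Z_def using bij_betw_inv_into_right[OF bij that] .
  have a: "((\<lambda>t. inv_into (ball 0 1) \<phi> (\<gamma> t)) \<longlongrightarrow> Z A) (at_left 1)"
    if "A \<in> accesses U (\<phi> 0) v" "in_access U (\<phi> 0) v \<gamma> A" for A \<gamma>
    using in_access_imp_tendsto[of v \<gamma> "Z A"] that at_Z[OF that(1)] v by (simp add: \<psi>_def)
  have b: "w = v \<and> in_access U (\<phi> 0) v (\<lambda>t. \<phi> (\<eta> t)) (access_at v \<zeta>)"
    if "\<zeta> \<in> R" and \<eta>: "curve_in (ball 0 1) \<eta>" "(\<eta> \<longlongrightarrow> \<zeta>) (at_left 1)" "lands_at (\<lambda>t. \<phi> (\<eta> t)) w" for \<zeta> \<eta> w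
  proof -
    have \<zeta>: "cmod \<zeta> = 1" "has_radial_limit \<phi> \<zeta> v"
      using \<open>\<zeta> \<in> R\<close> by (auto simp: R_def)
    have c: "continuous_on {0..<1} \<eta>" "\<eta> ` {0..<1} \<subseteq> ball 0 1"
      using \<eta>(1) by (auto simp: curve_in_def)
    \<comment> \<open>Lindeloef's theorem makes \<open>w\<close> a radial limit at \<zeta>, and
      radial limits are unique.\<close>
    have "((\<lambda>t. \<Phi> (of_real t * \<zeta>)) \<longlongrightarrow> stereo w) (at_left 1)"
      using \<eta>(3) by (intro lindelof[OF c \<zeta>(1) \<eta>(2)]) (simp add: lands_at_iff \<Phi>_def)
    then have "w = v"
      using tendsto_unique[OF trivial_limit_at_left_real] \<zeta>(2) unfolding has_radial_limit_iff by fastforce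
    then show ?thesis
      using curve_in_access_at[OF c \<eta>(2)] \<eta>(3) by simp
  qed
  have E: "bij_betw (prime_end_of \<circ> Z) (accesses U (\<phi> 0) v)
      {P \<in> prime_ends U. (first_type U P \<or> second_type U P) \<and> principal_point P v}"
    using bij_betw_trans[OF bijZ] bij_betw_prime_end_of[of v] by (simp add: R_def)
  have pe: "prime_end_at \<phi> U ((prime_end_of \<circ> Z) A) (Z A)" if "A \<in> accesses U (\<phi> 0) v" for A
    using prime_end_at_prime_end_of[of "Z A"] bij_betw_apply[OF bijZ that] by (simp add: R_def)
  have c: "\<exists>A \<in> accesses U (\<phi> 0) v. Z A = \<zeta> \<and>
          (\<forall>\<eta> w. curve_in (ball 0 1) \<eta> \<and> (\<eta> \<longlongrightarrow> \<zeta>) (at_left 1) \<and> lands_at (\<lambda>t. \<phi> (\<eta> t)) w \<longrightarrow>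
             w = v \<and> in_access U (\<phi> 0) v (\<lambda>t. \<phi> (\<eta> t)) A)"
    if "\<zeta> \<in> sphere 0 1" "has_radial_limit \<phi> \<zeta> v" for \<zeta>
  proof -
    have "\<zeta> \<in> R"
      using that by (simp add: R_def)
    then show ?thesis
      using Z_at b bij_betw_apply[OF bij] by (intro bexI[of _ "access_at v \<zeta>"]) blast+
  qed
  show ?thesis
    using bijZ a c E pe unfolding R_def by (intro exI[of _ Z] conjI) blast+
qed

end
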